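(* If the second-order field $\Gamma$ represents (locally) a gyroscopic system, i.e. there exist (locally) a regular function $L$ and a 2-form $\omega$ on the base with components $\omega_{ki}(q)=-\omega_{ik}(q)$ such that the equations $$\frac{d}{dt}\left(\frac{\partial L}{\partial \dot q^i}\right)-\frac{\partial L}{\partial q^i}=\omega_{ki}(q)\dot q^k$$ are equivalent to $\ddot q^i=f^i(q,\dot q)$, then there exists (locally) a non-singular symmetric type $(0,2)$ tensor field $g$ along $\tau$ such that $D^Vg$ is symmetric, $\nabla g=0$ and $$\left(\Phi\lrcorner g-(\Phi\lrcorner g)^T\right)(X,Y)=\sum_{X,Y,\mathbf T}g(R(X,Y),\mathbf T)$$ for all vector fields $X,Y$ along $\tau$. The converse is true as well (existence, locally, of such a $g$ implies that $\Gamma$ represents, locally, a gyroscopic system), provided it is assumed that $\Phi\lrcorner g$ is smooth on the zero section of $TQ\to Q$.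
   Context: All objects are smooth; the summation convention is used. $Q$ is an $n$-dimensional manifold, $\tau:TQ\to Q$ its tangent bundle, with local coordinates $q^i$ on $Q$ and induced coordinates $(q^i,v^i)$ on $TQ$ ($v^i=\dot q^i$ along curves). $\Gamma=v^i\frac{\partial}{\partial q^i}+f^i(q,v)\frac{\partial}{\partial v^i}$ is a given second-order vector field on $TQ$, corresponding to $\ddot q^i=f^i(q,\dot q)$. Two systems of equations are equivalent if they have the same solutions. A function $L$ is regular if the matrix $\left(\frac{\partial^2L}{\partial v^i\partial v^j}\right)$ is everywhere non-singular. "Locally" means: every point of $Q$ has an open neighbourhood $U$ such that the objects in question exist on $TU$ (functions on $TU$, tensor fields along $\tau|_{TU}$; the 2-form $\omega=\frac12\omega_{ij}(q)dq^i\wedge dq^j$ on $U$). Tensor fields along $\tau$ are sections over $TQ$ of the pull-backs by $\tau$ of the tensor bundles of $Q$; in coordinates they are expressed in terms of $\frac{\partial}{\partial q^i}$, $dq^i$ with coefficients that are functions on $TQ$. $\mathbf T=v^i\frac{\partial}{\partial q^i}$ is the canonical vector field along $\tau$ (the identity map of $TQ$). Put $\Gamma^j_i=-\frac12\frac{\partial f^j}{\partial v^i}$, $V_i=\frac{\partial}{\partial v^i}$, $H_i=\frac{\partial}{\partial q^i}-\Gamma^j_i\frac{\partial}{\partial v^j}$. For $X=X^i\frac{\partial}{\partial q^i}$ along $\tau$, $D^V_X$ is the degree 0 tensor derivation with $D^V_XF=X^iV_i(F)$, $D^V_X\frac{\partial}{\partial q^i}=0$, $D^V_Xdq^i=0$,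 and $D^Vg(X,Y,Z)=(D^V_Xg)(Y,Z)$. "$D^Vg$ is symmetric" means symmetric in all its arguments. Dynamical covariant derivative: $\nabla$ is the degree 0 tensor derivation with $\nabla F=\Gamma(F)$, $\nabla\frac{\partial}{\partial q^j}=\Gamma^i_j\frac{\partial}{\partial q^i}$, $\nabla dq^i=-\Gamma^i_jdq^j$. Jacobi endomorphism: $\Phi=\Phi^i_j\,dq^j\otimes\frac{\partial}{\partial q^i}$ with $\Phi^i_j=-\frac{\partial f^i}{\partial q^j}-\Gamma^k_j\Gamma^i_k-\Gamma(\Gamma^i_j)$. Curvature: $R\left(\frac{\partial}{\partial q^i},\frac{\partial}{\partial q^j}\right)=R^k_{ij}\frac{\partial}{\partial q^k}$ with $R^k_{ij}=H_j(\Gamma^k_i)-H_i(\Gamma^k_j)$. $(\Phi\lrcorner g)(X,Y)=g(\Phi X,Y)$ and $(\Phi\lrcorner g-(\Phi\lrcorner g)^T)(X,Y):=g(\Phi X,Y)-g(X,\Phi Y)$. The symbol $\sum_{X,Y,\mathbf T}$ denotes the cyclic sum, so $\sum_{X,Y,\mathbf T}g(R(X,Y),\mathbf T)=g(R(X,Y),\mathbf T)+g(R(Y,\mathbf T),X)+g(R(\mathbf T,X),Y)$. *)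

theory Defs
  imports "HOL-Analysis.Analysis"
begin

section \<open>Smooth maps\<close>

text \<open>Used on open sets only: all iterated directional derivatives exist and are continuous.\<close>

primrec Ck_on :: "nat \<Rightarrow> 'a::real_normed_vector set \<Rightarrow> ('a \<Rightarrow> 'b::real_normed_vector) \<Rightarrow> bool" where
  "Ck_on 0 S F \<longleftrightarrow> continuous_on S F"
| "Ck_on (Suc k) S F \<longleftrightarrow> (\<forall>x\<in>S. F differentiable (at x)) \<and>
     (\<forall>v. Ck_on k S (\<lambda>x. frechet_derivative F (at x) v))"

definition smooth_on :: "'a::real_normed_vector set \<Rightarrow> ('a \<Rightarrow> 'b::real_normed_vector) \<Rightarrow> bool" where
  "smooth_on S F \<longleftrightarrow> (\<forall>k. Ck_on k S F)"

section \<open>Smooth manifolds and geometric objects on them\<close>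

text \<open>The manifold \<open>Q\<close> is a whole type \<open>'q\<close> (Hausdorff, second countable) with an atlas of charts
  into \<open>\<real>\<^sup>n\<close>, \<open>n = CARD('n)\<close>. A chart is a pair of its domain and its coordinate map (whose values
  outside the domain are irrelevant).\<close>

type_synonym ('q, 'n) chart = "'q set \<times> ('q \<Rightarrow> real ^ 'n)"

definition transition :: "('q, 'n::finite) chart \<Rightarrow> ('q, 'n) chart \<Rightarrow> real ^ 'n \<Rightarrow> real ^ 'n" where
  "transition c d = snd d \<circ> inv_into (fst c) (snd c)"

definition smooth_atlas ::
    "('q::{t2_space, second_countable_topology}, 'n::finite) chart set \<Rightarrow> bool" where
  "smooth_atlas A \<longleftrightarrow>
     (\<forall>c\<in>A. open (fst c) \<and> open (snd c ` fst c) \<and>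
        homeomorphism (fst c) (snd c ` fst c) (snd c) (inv_into (fst c) (snd c))) \<and>
     (\<Union>c\<in>A. fst c) = UNIV \<and>
     (\<forall>c\<in>A. \<forall>d\<in>A. smooth_on (snd c ` (fst c \<inter> fst d)) (transition c d))"

text \<open>Points of \<open>TQ\<close> over the domain of a chart have coordinates \<open>(q, v)\<close>.\<close>

type_synonym 'n tcoord = "(real ^ 'n) \<times> (real ^ 'n)"

definition jac :: "('q, 'n::finite) chart \<Rightarrow> ('q, 'n) chart \<Rightarrow> real ^ 'n \<Rightarrow> real ^ 'n \<Rightarrow> real ^ 'n" where
  "jac c d q = frechet_derivative (transition c d) (at q)"

definition hess :: "('q, 'n::finite) chart \<Rightarrow> ('q, 'n) chart \<Rightarrow> real ^ 'n \<Rightarrow> real ^ 'n \<Rightarrow> real ^ 'n" where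
  "hess c d q v = frechet_derivative (\<lambda>y. jac c d y v) (at q) v"

definition coords :: "('q, 'n::finite) chart \<Rightarrow> 'q set \<Rightarrow> (real ^ 'n) set" where
  "coords c U = snd c ` (U \<inter> fst c)"

definition bil :: "real ^ 'n ^ 'n \<Rightarrow> real ^ 'n \<Rightarrow> real ^ 'n \<Rightarrow> real" where
  "bil M x y = (\<Sum>i\<in>UNIV. \<Sum>j\<in>UNIV. M $ i $ j * x $ i * y $ j)"

text \<open>A geometric object over \<open>U\<close> is the family of its coordinate representatives, one for
  each chart of the atlas, related by the appropriate transformation law.

  The first law below is that of a second-order vector field \<open>v\<^sup>i \<partial>/\<partial>q\<^sup>i + f\<^sup>i(q, v) \<partial>/\<partial>v\<^sup>i\<close> on \<open>TQ\<close>: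
  in the coordinates \<open>q' = \<phi>(q)\<close>, \<open>v' = D\<phi>(q) v\<close> it has \<open>f' = D\<phi>(q) f + D\<^sup>2\<phi>(q)(v, v)\<close>.\<close>

definition second_order_field ::
    "('q, 'n::finite) chart set \<Rightarrow> (('q, 'n) chart \<Rightarrow> 'n tcoord \<Rightarrow> real ^ 'n) \<Rightarrow> bool" where
  "second_order_field A f \<longleftrightarrow>
     (\<forall>c\<in>A. smooth_on (coords c UNIV \<times> UNIV) (f c)) \<and>
     (\<forall>c\<in>A. \<forall>d\<in>A. \<forall>x \<in> fst c \<inter> fst d. \<forall>v.
        f d (snd d x, jac c d (snd c x) v) =
          jac c d (snd c x) (f c (snd c x, v)) + hess c d (snd c x) v)"

definition smooth_function_on_TU ::
    "('q, 'n::finite) chart set \<Rightarrow> 'q set \<Rightarrow> (('q, 'n) chart \<Rightarrow> 'n tcoord \<Rightarrow> real) \<Rightarrow> bool" where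
  "smooth_function_on_TU A U L \<longleftrightarrow>
     (\<forall>c\<in>A. smooth_on (coords c U \<times> UNIV) (L c)) \<and>
     (\<forall>c\<in>A. \<forall>d\<in>A. \<forall>x \<in> U \<inter> fst c \<inter> fst d. \<forall>v.
        L d (snd d x, jac c d (snd c x) v) = L c (snd c x, v))"

definition two_form_on ::
    "('q, 'n::finite) chart set \<Rightarrow> 'q set \<Rightarrow> (('q, 'n) chart \<Rightarrow> real ^ 'n \<Rightarrow> real ^ 'n ^ 'n) \<Rightarrow> bool" where
  "two_form_on A U \<omega> \<longleftrightarrow>
     (\<forall>c\<in>A. smooth_on (coords c U) (\<omega> c)) \<and>
     (\<forall>c\<in>A. \<forall>q \<in> coords c U. \<forall>i k. \<omega> c q $ k $ i = - (\<omega> c q $ i $ k)) \<and>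
     (\<forall>c\<in>A. \<forall>d\<in>A. \<forall>x \<in> U \<inter> fst c \<inter> fst d. \<forall>X Y.
        bil (\<omega> d (snd d x)) (jac c d (snd c x) X) (jac c d (snd c x) Y) = bil (\<omega> c (snd c x)) X Y)"

text \<open>Type \<open>(0,2)\<close> tensor fields along \<open>\<tau>\<close> restricted to \<open>TU\<close>.\<close>

definition tensor02_along ::
    "('q, 'n::finite) chart set \<Rightarrow> 'q set \<Rightarrow> (('q, 'n) chart \<Rightarrow> 'n tcoord \<Rightarrow> real ^ 'n ^ 'n) \<Rightarrow> bool" where
  "tensor02_along A U g \<longleftrightarrow>
     (\<forall>c\<in>A. smooth_on (coords c U \<times> UNIV) (g c)) \<and>
     (\<forall>c\<in>A. \<forall>d\<in>A. \<forall>x \<in> U \<inter> fst c \<inter> fst d. \<forall>v X Y.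
        bil (g d (snd d x, jac c d (snd c x) v)) (jac c d (snd c x) X) (jac c d (snd c x) Y) =
          bil (g c (snd c x, v)) X Y)"

section \<open>Calculus along \<open>\<tau>\<close> in a chart\<close>

text \<open>Here \<open>f\<close>, \<open>g\<close>, \<open>L\<close>, \<open>\<omega>\<close> are coordinate representatives in a fixed chart, and vector
  fields along \<open>\<tau>\<close> are given by their component functions.\<close>

definition dq :: "'n \<Rightarrow> ('n::finite tcoord \<Rightarrow> real) \<Rightarrow> 'n tcoord \<Rightarrow> real" where
  "dq i F z = frechet_derivative F (at z) (axis i 1, 0)"

definition dv :: "'n \<Rightarrow> ('n::finite tcoord \<Rightarrow> real) \<Rightarrow> 'n tcoord \<Rightarrow> real" where
  "dv i F z = frechet_derivative F (at z) (0, axis i 1)"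

definition SODE :: "('n::finite tcoord \<Rightarrow> real ^ 'n) \<Rightarrow> ('n tcoord \<Rightarrow> real) \<Rightarrow> 'n tcoord \<Rightarrow> real" where
  "SODE f F z = (\<Sum>i\<in>UNIV. snd z $ i * dq i F z) + (\<Sum>i\<in>UNIV. f z $ i * dv i F z)"

text \<open>\<open>Gam f j i\<close> is \<open>\<Gamma>\<close> with upper index \<open>j\<close> and lower index \<open>i\<close>; likewise the first index of
  \<open>Phi\<close> and \<open>Rc\<close> below is the upper one.\<close>

definition Gam :: "('n::finite tcoord \<Rightarrow> real ^ 'n) \<Rightarrow> 'n \<Rightarrow> 'n \<Rightarrow> 'n tcoord \<Rightarrow> real" where
  "Gam f j i z = - (1 / 2) * dv i (\<lambda>w. f w $ j) z"

definition dH ::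
    "('n::finite tcoord \<Rightarrow> real ^ 'n) \<Rightarrow> 'n \<Rightarrow> ('n tcoord \<Rightarrow> real) \<Rightarrow> 'n tcoord \<Rightarrow> real" where
  "dH f i F z = dq i F z - (\<Sum>j\<in>UNIV. Gam f j i z * dv j F z)"

definition Phi :: "('n::finite tcoord \<Rightarrow> real ^ 'n) \<Rightarrow> 'n \<Rightarrow> 'n \<Rightarrow> 'n tcoord \<Rightarrow> real" where
  "Phi f i j z = - dq j (\<lambda>w. f w $ i) z - (\<Sum>k\<in>UNIV. Gam f k j z * Gam f i k z) - SODE f (Gam f i j) z"

definition Rc :: "('n::finite tcoord \<Rightarrow> real ^ 'n) \<Rightarrow> 'n \<Rightarrow> 'n \<Rightarrow> 'n \<Rightarrow> 'n tcoord \<Rightarrow> real" where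
  "Rc f k i j z = dH f j (Gam f k i) z - dH f i (Gam f k j) z"

definition Phi_app ::
    "('n::finite tcoord \<Rightarrow> real ^ 'n) \<Rightarrow> ('n tcoord \<Rightarrow> real ^ 'n) \<Rightarrow> 'n tcoord \<Rightarrow> real ^ 'n" where
  "Phi_app f X z = (\<chi> i. \<Sum>j\<in>UNIV. Phi f i j z * X z $ j)"

definition R_app ::
    "('n::finite tcoord \<Rightarrow> real ^ 'n) \<Rightarrow> ('n tcoord \<Rightarrow> real ^ 'n) \<Rightarrow> ('n tcoord \<Rightarrow> real ^ 'n) \<Rightarrow>
      'n tcoord \<Rightarrow> real ^ 'n" where
  "R_app f X Y z = (\<chi> k. \<Sum>i\<in>UNIV. \<Sum>j\<in>UNIV. Rc f k i j z * X z $ i * Y z $ j)"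

definition TT :: "'n tcoord \<Rightarrow> real ^ 'n" where
  "TT z = snd z"

definition app2 ::
    "('n tcoord \<Rightarrow> real ^ 'n ^ 'n) \<Rightarrow> ('n tcoord \<Rightarrow> real ^ 'n) \<Rightarrow> ('n tcoord \<Rightarrow> real ^ 'n) \<Rightarrow>
      'n tcoord \<Rightarrow> real" where
  "app2 g X Y z = bil (g z) (X z) (Y z)"

definition Phi_contract ::
    "('n::finite tcoord \<Rightarrow> real ^ 'n) \<Rightarrow> ('n tcoord \<Rightarrow> real ^ 'n ^ 'n) \<Rightarrow> 'n tcoord \<Rightarrow> real ^ 'n ^ 'n" where
  "Phi_contract f g z =
     (\<chi> i j. app2 g (Phi_app f (\<lambda>_. axis i 1)) (\<lambda>_. axis j 1) z)"

text \<open>The tensor derivations \<open>D\<^sup>V\<^sub>X\<close> and \<open>\<nabla>\<close> on functions, vector fields and, by the Leibniz rule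
  \<open>(D g)(Y, Z) = D (g(Y, Z)) - g(D Y, Z) - g(Y, D Z)\<close>, on type \<open>(0,2)\<close> tensor fields.\<close>

definition DV_fun :: "('n::finite tcoord \<Rightarrow> real ^ 'n) \<Rightarrow> ('n tcoord \<Rightarrow> real) \<Rightarrow> 'n tcoord \<Rightarrow> real" where
  "DV_fun X F z = (\<Sum>i\<in>UNIV. X z $ i * dv i F z)"

definition DV_vec ::
    "('n::finite tcoord \<Rightarrow> real ^ 'n) \<Rightarrow> ('n tcoord \<Rightarrow> real ^ 'n) \<Rightarrow> 'n tcoord \<Rightarrow> real ^ 'n" where
  "DV_vec X Y z = (\<chi> i. DV_fun X (\<lambda>w. Y w $ i) z)"

definition DV_tensor ::
    "('n::finite tcoord \<Rightarrow> real ^ 'n ^ 'n) \<Rightarrow> ('n tcoord \<Rightarrow> real ^ 'n) \<Rightarrow> ('n tcoord \<Rightarrow> real ^ 'n) \<Rightarrow>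
      ('n tcoord \<Rightarrow> real ^ 'n) \<Rightarrow> 'n tcoord \<Rightarrow> real" where
  "DV_tensor g X Y Z z =
     DV_fun X (app2 g Y Z) z - app2 g (DV_vec X Y) Z z - app2 g Y (DV_vec X Z) z"

definition nabla_vec ::
    "('n::finite tcoord \<Rightarrow> real ^ 'n) \<Rightarrow> ('n tcoord \<Rightarrow> real ^ 'n) \<Rightarrow> 'n tcoord \<Rightarrow> real ^ 'n" where
  "nabla_vec f X z =
     (\<chi> i. SODE f (\<lambda>w. X w $ i) z + (\<Sum>j\<in>UNIV. Gam f i j z * X z $ j))"

definition nabla_tensor ::
    "('n::finite tcoord \<Rightarrow> real ^ 'n) \<Rightarrow> ('n tcoord \<Rightarrow> real ^ 'n ^ 'n) \<Rightarrow>
      ('n tcoord \<Rightarrow> real ^ 'n) \<Rightarrow> ('n tcoord \<Rightarrow> real ^ 'n) \<Rightarrow> 'n tcoord \<Rightarrow> real" where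
  "nabla_tensor f g X Y z =
     SODE f (app2 g X Y) z - app2 g (nabla_vec f X) Y z - app2 g X (nabla_vec f Y) z"

section \<open>Conditions on a multiplier\<close>

definition symmetric_tensor ::
    "('q, 'n::finite) chart set \<Rightarrow> 'q set \<Rightarrow> (('q, 'n) chart \<Rightarrow> 'n tcoord \<Rightarrow> real ^ 'n ^ 'n) \<Rightarrow> bool" where
  "symmetric_tensor A U g \<longleftrightarrow>
     (\<forall>c\<in>A. \<forall>z \<in> coords c U \<times> UNIV. transpose (g c z) = g c z)"

definition nonsingular_tensor ::
    "('q, 'n::finite) chart set \<Rightarrow> 'q set \<Rightarrow> (('q, 'n) chart \<Rightarrow> 'n tcoord \<Rightarrow> real ^ 'n ^ 'n) \<Rightarrow> bool" where
  "nonsingular_tensor A U g \<longleftrightarrow>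
     (\<forall>c\<in>A. \<forall>z \<in> coords c U \<times> UNIV. invertible (g c z))"

abbreviation vfield_along :: "(real ^ 'n) set \<Rightarrow> ('n::finite tcoord \<Rightarrow> real ^ 'n) \<Rightarrow> bool" where
  "vfield_along W X \<equiv> smooth_on (W \<times> UNIV) X"

text \<open>The two transpositions of neighbouring arguments generate all permutations.\<close>

definition DV_symmetric ::
    "('q, 'n::finite) chart set \<Rightarrow> 'q set \<Rightarrow> (('q, 'n) chart \<Rightarrow> 'n tcoord \<Rightarrow> real ^ 'n ^ 'n) \<Rightarrow> bool" where
  "DV_symmetric A U g \<longleftrightarrow>
     (\<forall>c\<in>A. \<forall>X Y Z.
        vfield_along (coords c U) X \<longrightarrow> vfield_along (coords c U) Y \<longrightarrow> vfield_along (coords c U) Z \<longrightarrow>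
        (\<forall>z \<in> coords c U \<times> UNIV.
           DV_tensor (g c) X Y Z z = DV_tensor (g c) Y X Z z \<and>
           DV_tensor (g c) X Y Z z = DV_tensor (g c) X Z Y z))"

definition nabla_zero ::
    "('q, 'n::finite) chart set \<Rightarrow> (('q, 'n) chart \<Rightarrow> 'n tcoord \<Rightarrow> real ^ 'n) \<Rightarrow> 'q set \<Rightarrow>
      (('q, 'n) chart \<Rightarrow> 'n tcoord \<Rightarrow> real ^ 'n ^ 'n) \<Rightarrow> bool" where
  "nabla_zero A f U g \<longleftrightarrow>
     (\<forall>c\<in>A. \<forall>X Y. vfield_along (coords c U) X \<longrightarrow> vfield_along (coords c U) Y \<longrightarrow>
        (\<forall>z \<in> coords c U \<times> UNIV. nabla_tensor (f c) (g c) X Y z = 0))"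

definition Phi_R_condition ::
    "('q, 'n::finite) chart set \<Rightarrow> (('q, 'n) chart \<Rightarrow> 'n tcoord \<Rightarrow> real ^ 'n) \<Rightarrow> 'q set \<Rightarrow>
      (('q, 'n) chart \<Rightarrow> 'n tcoord \<Rightarrow> real ^ 'n ^ 'n) \<Rightarrow> bool" where
  "Phi_R_condition A f U g \<longleftrightarrow>
     (\<forall>c\<in>A. \<forall>X Y. vfield_along (coords c U) X \<longrightarrow> vfield_along (coords c U) Y \<longrightarrow>
        (\<forall>z \<in> coords c U \<times> UNIV.
           app2 (g c) (Phi_app (f c) X) Y z - app2 (g c) X (Phi_app (f c) Y) z =
             app2 (g c) (R_app (f c) X Y) TT z + app2 (g c) (R_app (f c) Y TT) X z
               + app2 (g c) (R_app (f c) TT X) Y z))"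

definition Phi_contract_smooth_zero_section ::
    "('q, 'n::finite) chart set \<Rightarrow> (('q, 'n) chart \<Rightarrow> 'n tcoord \<Rightarrow> real ^ 'n) \<Rightarrow> 'q set \<Rightarrow>
      (('q, 'n) chart \<Rightarrow> 'n tcoord \<Rightarrow> real ^ 'n ^ 'n) \<Rightarrow> bool" where
  "Phi_contract_smooth_zero_section A f U g \<longleftrightarrow>
     (\<forall>c\<in>A. \<exists>N. open N \<and> coords c U \<times> {0} \<subseteq> N \<and> smooth_on N (Phi_contract (f c) (g c)))"

section \<open>Gyroscopic systems\<close>

definition regular_function ::
    "('q, 'n::finite) chart set \<Rightarrow> 'q set \<Rightarrow> (('q, 'n) chart \<Rightarrow> 'n tcoord \<Rightarrow> real) \<Rightarrow> bool" where
  "regular_function A U L \<longleftrightarrow>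
     (\<forall>c\<in>A. \<forall>z \<in> coords c U \<times> UNIV. invertible ((\<chi> i j. dv i (dv j (L c)) z) :: real ^ 'n ^ 'n))"

definition velocity :: "(real \<Rightarrow> real ^ 'n) \<Rightarrow> real \<Rightarrow> real ^ 'n::finite" where
  "velocity \<gamma> t = vector_derivative \<gamma> (at t)"

definition twice_differentiable_curve ::
    "(real ^ 'n) set \<Rightarrow> real set \<Rightarrow> (real \<Rightarrow> real ^ 'n::finite) \<Rightarrow> bool" where
  "twice_differentiable_curve W J \<gamma> \<longleftrightarrow>
     (\<forall>t\<in>J. \<gamma> t \<in> W \<and> \<gamma> differentiable (at t) \<and> velocity \<gamma> differentiable (at t))"

definition solves_second_order ::
    "('n::finite tcoord \<Rightarrow> real ^ 'n) \<Rightarrow> (real ^ 'n) set \<Rightarrow> real set \<Rightarrow> (real \<Rightarrow> real ^ 'n) \<Rightarrow> bool" where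
  "solves_second_order f W J \<gamma> \<longleftrightarrow>
     twice_differentiable_curve W J \<gamma> \<and>
     (\<forall>t\<in>J. (velocity \<gamma> has_vector_derivative f (\<gamma> t, velocity \<gamma> t)) (at t))"

definition solves_gyroscopic ::
    "('n::finite tcoord \<Rightarrow> real) \<Rightarrow> (real ^ 'n \<Rightarrow> real ^ 'n ^ 'n) \<Rightarrow> (real ^ 'n) set \<Rightarrow> real set \<Rightarrow>
      (real \<Rightarrow> real ^ 'n) \<Rightarrow> bool" where
  "solves_gyroscopic L \<omega> W J \<gamma> \<longleftrightarrow>
     twice_differentiable_curve W J \<gamma> \<and>
     (\<forall>t\<in>J. \<forall>i. \<exists>p'.
        ((\<lambda>s. dv i L (\<gamma> s, velocity \<gamma> s)) has_real_derivative p') (at t) \<and>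
        p' - dq i L (\<gamma> t, velocity \<gamma> t) = (\<Sum>k\<in>UNIV. \<omega> (\<gamma> t) $ k $ i * velocity \<gamma> t $ k))"

definition equivalent_gyroscopic ::
    "('q, 'n::finite) chart set \<Rightarrow> (('q, 'n) chart \<Rightarrow> 'n tcoord \<Rightarrow> real ^ 'n) \<Rightarrow> 'q set \<Rightarrow>
      (('q, 'n) chart \<Rightarrow> 'n tcoord \<Rightarrow> real) \<Rightarrow> (('q, 'n) chart \<Rightarrow> real ^ 'n \<Rightarrow> real ^ 'n ^ 'n) \<Rightarrow> bool" where
  "equivalent_gyroscopic A f U L \<omega> \<longleftrightarrow>
     (\<forall>c\<in>A. \<forall>J \<gamma>. open J \<longrightarrow> is_interval J \<longrightarrow>
        (solves_gyroscopic (L c) (\<omega> c) (coords c U) J \<gamma> \<longleftrightarrow>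
         solves_second_order (f c) (coords c U) J \<gamma>))"

definition gyroscopic_on ::
    "('q, 'n::finite) chart set \<Rightarrow> (('q, 'n) chart \<Rightarrow> 'n tcoord \<Rightarrow> real ^ 'n) \<Rightarrow> 'q set \<Rightarrow> bool" where
  "gyroscopic_on A f U \<longleftrightarrow>
     (\<exists>L \<omega>. smooth_function_on_TU A U L \<and> regular_function A U L \<and> two_form_on A U \<omega> \<and>
        equivalent_gyroscopic A f U L \<omega>)"

definition gyroscopic_multiplier ::
    "('q, 'n::finite) chart set \<Rightarrow> (('q, 'n) chart \<Rightarrow> 'n tcoord \<Rightarrow> real ^ 'n) \<Rightarrow> 'q set \<Rightarrow>
      (('q, 'n) chart \<Rightarrow> 'n tcoord \<Rightarrow> real ^ 'n ^ 'n) \<Rightarrow> bool" where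
  "gyroscopic_multiplier A f U g \<longleftrightarrow>
     tensor02_along A U g \<and> nonsingular_tensor A U g \<and> symmetric_tensor A U g \<and>
     DV_symmetric A U g \<and> nabla_zero A f U g \<and> Phi_R_condition A f U g"

end

theory Submission
  imports Defs
begin

text \<open>
  Along solutions the Euler--Lagrange expressions \<open>E\<^sub>i = \<Gamma>(V\<^sub>i L) - \<partial>\<^sub>i L\<close> equal \<open>\<omega>\<^sub>k\<^sub>i v\<^sup>k\<close>; since
  \<open>\<Gamma>\<close> has an integral curve through every point of \<open>TQ\<close>, this is an identity on \<open>TQ\<close>. Its vertical
  derivative splits into a symmetric part, \<open>\<nabla>g = 0\<close> for the Hessian \<open>g\<close> of \<open>L\<close>, and an antisymmetric
  part, \<open>H\<^sub>j V\<^sub>i L - H\<^sub>i V\<^sub>j L = \<omega>\<^sub>j\<^sub>i\<close>. The antisymmetrised \<open>q\<close>-derivative gives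
  \<open>g(\<Phi>X, Y) - g(X, \<Phi>Y) = d\<omega>(T, X, Y)\<close>, while the bracket \<open>[H\<^sub>i, H\<^sub>j] = R\<^sup>k\<^sub>i\<^sub>j V\<^sub>k\<close> turns the cyclic
  \<open>H\<close>-derivative of the antisymmetric part into the statement that \<open>d\<omega>\<close> is the cyclic sum of
  \<open>g(R(\<cdot>, \<cdot>), \<cdot>)\<close>.

  Conversely, \<open>g\<close> is the Hessian of some \<open>L\<^sub>0\<close> by the Poincare lemma on the fibres, and \<open>\<nabla>g = 0\<close> makes
  \<open>V\<^sub>j E\<^sub>i\<close> antisymmetric. Then \<open>V\<^sub>k V\<^sub>j E\<^sub>i\<close> is symmetric in \<open>k, j\<close> and antisymmetric in \<open>j, i\<close>, hence zero,
  so that \<open>E\<^sub>i = \<omega>\<^sub>k\<^sub>i(q) v\<^sup>k + c\<^sub>i(q)\<close>. The remaining condition says exactly that \<open>c\<close> is closed, so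
  \<open>c\<^sub>i = \<partial>\<^sub>i b\<close> on a ball, and \<open>L = L\<^sub>0 + b\<close> is the required function.
\<close>

subsection \<open>Smooth maps\<close>

text \<open>Solutions are curves and geometric objects are families of coordinate representatives,
  one for each chart; both facts shape the proof. An equivalence of two systems of curve equations
  has to yield an identity between functions, so local existence for ordinary differential equations
  enters. Conversely, potentials are found by integrating along rays, so \<open>L\<close> and
  \<omega> are built over a coordinate ball of a single chart, and their representatives in all
  other charts are pull-backs; the transformation law of \<Gamma> makes the Euler-Lagrange
  expressions transform as a covector.

  Both directions share one computation, in which the force may have the form s_ki(q) v^k + c_i(q).
  With c = 0 it gives the conditions on the Hessian; with those conditions known, it gives the
  closedness of c.

  \<open>smooth_on\<close> speaks of iterated derivatives in fixed directions. A derivative whose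
  direction varies with the point is therefore expanded in a basis before the next
  differentiation.\<close>

lemma frechet_derivative_cong_open:
  assumes "open S" "x \<in> S" "\<And>y. y \<in> S \<Longrightarrow> F y = G y"
  shows "frechet_derivative F (at x) = frechet_derivative G (at x)"
proof -
  have "(F has_derivative D) (at x) \<longleftrightarrow> (G has_derivative D) (at x)" for D
    using has_derivative_transform_within_open[OF _ assms(1,2)] assms(3) by metis
  then show ?thesis
    by (simp add: frechet_derivative_def)
qed

lemma differentiable_cong_open:
  assumes "open S" "x \<in> S" "\<And>y. y \<in> S \<Longrightarrow> F y = G y" "F differentiable (at x)"
  shows "G differentiable (at x)"
  using has_derivative_transform_within_open[OF _ assms(1,2), of F _ UNIV G] assms(3,4) unfolding differentiable_def by blast

text \<open>Derivatives are taken at points of the whole space, so equality on \<open>S\<close>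
  passes to them because \<open>S\<close> is open. This is why \<open>open S\<close> accompanies
  most closure rules below.\<close>

lemma Ck_on_cong:
  assumes "open S" "\<And>y. y \<in> S \<Longrightarrow> F y = G y" "Ck_on k S F"
  shows "Ck_on k S G"
  using assms(2,3)
proof (induction k arbitrary: F G)
  case 0
  then show ?case by (auto cong: continuous_on_cong)
next
  case (Suc k)
  have "Ck_on k S (\<lambda>x. frechet_derivative G (at x) v)" for v
  proof (rule Suc.IH[of "\<lambda>x. frechet_derivative F (at x) v"])
    show "frechet_derivative F (at y) v = frechet_derivative G (at y) v" if "y \<in> S" for y
      using frechet_derivative_cong_open[OF assms(1) that Suc.prems(1)] by simp
  qed (use Suc.prems in auto)
  moreover have "\<forall>x\<in>S. G differentiable at x"
    using Suc.prems differentiable_cong_open[OF assms(1) _ Suc.prems(1)] by auto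
  ultimately show ?case by simp
qed

lemma Ck_on_continuous: "Ck_on k S F \<Longrightarrow> continuous_on S F"
  by (cases k)
     (auto intro!: continuous_at_imp_continuous_on differentiable_imp_continuous_within)

lemma Ck_on_SucD: "Ck_on (Suc k) S F \<Longrightarrow> Ck_on k S F"
proof (induction k arbitrary: F)
  case 0
  then show ?case using Ck_on_continuous[of "Suc 0" S F] by simp
next
  case (Suc k)
  have "Ck_on k S (\<lambda>x. frechet_derivative F (at x) v)" for v
    using Suc.prems by (intro Suc.IH) auto
  then show ?case using Suc.prems by auto
qed

lemma Ck_on_subset: "Ck_on k S F \<Longrightarrow> T \<subseteq> S \<Longrightarrow> Ck_on k T F"
  by (induction k arbitrary: F) (auto intro: continuous_on_subset)

lemma Ck_on_const: "Ck_on k S (\<lambda>x. c)"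
  by (induction k arbitrary: c) auto

lemma Ck_on_bounded_linear:
  assumes "bounded_linear h"
  shows "Ck_on k S h"
proof -
  have fd: "frechet_derivative h (at x) = h" for x
    using frechet_derivative_at[OF bounded_linear_imp_has_derivative[OF assms]] by metis
  show ?thesis
    by (cases k) (auto simp: fd Ck_on_const assms linear_continuous_on bounded_linear_imp_differentiable)
qed

lemma Ck_on_add:
  assumes "open S" "Ck_on k S F" "Ck_on k S G"
  shows "Ck_on k S (\<lambda>x. F x + G x)"
  using assms(2,3)
proof (induction k arbitrary: F G)
  case 0
  then show ?case by (auto intro: continuous_on_add)
next
  case (Suc k)
  have "Ck_on k S (\<lambda>x. frechet_derivative (\<lambda>x. F x + G x) (at x) v)" for v
  proof (rule Ck_on_cong[OF assms(1)])
    show "Ck_on k S (\<lambda>x. frechet_derivative F (at x) v + frechet_derivative G (at x) v)"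
      using Suc by simp
    show "frechet_derivative F (at x) v + frechet_derivative G (at x) v =
      frechet_derivative (\<lambda>x. F x + G x) (at x) v" if "x \<in> S" for x
    proof -
      have "((\<lambda>x. F x + G x) has_derivative
          (\<lambda>v. frechet_derivative F (at x) v + frechet_derivative G (at x) v)) (at x)"
        using Suc.prems that
        by (intro has_derivative_add) (auto simp: frechet_derivative_works[symmetric])
      then show ?thesis using frechet_derivative_at by metis
    qed
  qed
  then show ?case using Suc.prems by auto
qed

text \<open>One rule for products, scalar multiples and inner products. Each summand of the
  derivative keeps one factor undifferentiated, whose order \<open>Ck_on_SucD\<close> lowers to fit
  the induction.\<close>

lemma Ck_on_bilinear:
  assumes "bounded_bilinear h" "open S" "Ck_on k S F" "Ck_on k S G"
  shows "Ck_on k S (\<lambda>x. h (F x) (G x))"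
  using assms(3,4)
proof (induction k arbitrary: F G)
  case 0
  then show ?case by (auto intro: bounded_bilinear.continuous_on[OF assms(1)])
next
  case (Suc k)
  have der: "((\<lambda>x. h (F x) (G x)) has_derivative
          (\<lambda>v. h (F x) (frechet_derivative G (at x) v) + h (frechet_derivative F (at x) v) (G x))) (at x)"
    if "x \<in> S" for x
    using Suc.prems that
    by (intro bounded_bilinear.FDERIV[OF assms(1)]) (auto simp: frechet_derivative_works[symmetric])
  have "Ck_on k S (\<lambda>x. frechet_derivative (\<lambda>x. h (F x) (G x)) (at x) v)" for v
  proof (rule Ck_on_cong[OF assms(2)])
    show "Ck_on k S (\<lambda>x. h (F x) (frechet_derivative G (at x) v) + h (frechet_derivative F (at x) v) (G x))"
      using Suc.prems Ck_on_SucD[OF Suc.prems(1)] Ck_on_SucD[OF Suc.prems(2)]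
      by (intro Ck_on_add[OF assms(2)] Suc.IH) auto
    show "h (F x) (frechet_derivative G (at x) v) + h (frechet_derivative F (at x) v) (G x) =
      frechet_derivative (\<lambda>x. h (F x) (G x)) (at x) v" if "x \<in> S" for x
      using frechet_derivative_at[OF der[OF that]] by metis
  qed
  moreover have "\<forall>x\<in>S. (\<lambda>x. h (F x) (G x)) differentiable at x"
    using der unfolding differentiable_def by blast
  ultimately show ?case by simp
qed

lemma Ck_on_sum:
  assumes "open S" "\<And>i. i \<in> I \<Longrightarrow> Ck_on k S (F i)"
  shows "Ck_on k S (\<lambda>x. \<Sum>i\<in>I. F i x)"
  using assms(2)
  by (induction I rule: infinite_finite_induct) (auto simp: Ck_on_const intro!: Ck_on_add[OF assms(1)])

lemma frechet_derivative_chain: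
  assumes "F differentiable (at (G x))" "G differentiable (at x)"
  shows "frechet_derivative (\<lambda>x. F (G x)) (at x) v =
     frechet_derivative F (at (G x)) (frechet_derivative G (at x) v)"
  using frechet_derivative_compose[of G x F] assms by (simp add: o_def fun_eq_iff)

lemma frechet_derivative_euclidean_sum:
  fixes F :: "'a::euclidean_space \<Rightarrow> 'b::real_normed_vector"
  assumes "F differentiable (at x)"
  shows "frechet_derivative F (at x) u = (\<Sum>b\<in>Basis. (u \<bullet> b) *\<^sub>R frechet_derivative F (at x) b)"
proof -
  interpret linear "frechet_derivative F (at x)"
    by (rule linear_frechet_derivative[OF assms])
  have "frechet_derivative F (at x) u = frechet_derivative F (at x) (\<Sum>b\<in>Basis. (u \<bullet> b) *\<^sub>R b)"
    by (simp add: euclidean_representation)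
  then show ?thesis by (simp add: sum scaleR)
qed

text \<open>The chain rule differentiates \<open>F\<close> in a direction that varies with
  \<open>x\<close>, while \<open>Ck_on\<close> controls fixed directions only. Expanding that
  direction in \<open>Basis\<close> separates the two, and the induction hypothesis applies to each
  basis derivative of \<open>F\<close>.\<close>

lemma Ck_on_compose:
  fixes F :: "'b::euclidean_space \<Rightarrow> 'c::real_normed_vector"
  assumes "open S" "open T" "Ck_on k S G" "Ck_on k T F" "\<And>x. x \<in> S \<Longrightarrow> G x \<in> T"
  shows "Ck_on k S (\<lambda>x. F (G x))"
  using assms(3,4)
proof (induction k arbitrary: F)
  case 0
  then show ?case using assms(5) by (auto intro: continuous_on_compose2)
next
  case (Suc k)
  have "Ck_on k S (\<lambda>x. frechet_derivative (\<lambda>x. F (G x)) (at x) v)" for v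
  proof (rule Ck_on_cong[OF assms(1)])
    show "Ck_on k S (\<lambda>x. \<Sum>b\<in>Basis. (frechet_derivative G (at x) v \<bullet> b) *\<^sub>R
         frechet_derivative F (at (G x)) b)"
      using Suc.prems Ck_on_SucD[OF Suc.prems(1)]
      by (intro Ck_on_sum[OF assms(1)] Ck_on_bilinear[OF bounded_bilinear_scaleR assms(1)]
           Ck_on_bilinear[OF bounded_bilinear_inner assms(1)] Ck_on_const Suc.IH) auto
    show "(\<Sum>b\<in>Basis. (frechet_derivative G (at x) v \<bullet> b) *\<^sub>R frechet_derivative F (at (G x)) b) =
      frechet_derivative (\<lambda>x. F (G x)) (at x) v" if "x \<in> S" for x
      using Suc.prems that assms(5)
        frechet_derivative_euclidean_sum[of F "G x" "frechet_derivative G (at x) v"]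
      by (simp add: frechet_derivative_chain)
  qed
  moreover have "(\<lambda>x. F (G x)) differentiable at x" if "x \<in> S" for x
    using Suc.prems that assms(5) differentiable_chain_at[of G x F] by (simp add: o_def)
  ultimately show ?case by simp
qed

lemma smooth_on_differentiable: "smooth_on S F \<Longrightarrow> x \<in> S \<Longrightarrow> F differentiable (at x)"
  unfolding smooth_on_def using Ck_on.simps(2)[of 0 S F] by blast

lemma smooth_on_frechet_derivative:
  "smooth_on S F \<Longrightarrow> smooth_on S (\<lambda>x. frechet_derivative F (at x) v)"
  unfolding smooth_on_def using Ck_on.simps(2)[of _ S F] by blast

lemma smooth_on_has_derivative:
  "smooth_on S F \<Longrightarrow> x \<in> S \<Longrightarrow> (F has_derivative frechet_derivative F (at x)) (at x)"
  using smooth_on_differentiable frechet_derivative_works by blast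

lemma smooth_on_continuous: "smooth_on S F \<Longrightarrow> continuous_on S F"
  unfolding smooth_on_def using Ck_on_continuous by blast

lemma smooth_on_cong:
  "open S \<Longrightarrow> (\<And>x. x \<in> S \<Longrightarrow> F x = G x) \<Longrightarrow> smooth_on S F \<Longrightarrow> smooth_on S G"
  unfolding smooth_on_def using Ck_on_cong by metis

lemma smooth_on_subset: "smooth_on S F \<Longrightarrow> T \<subseteq> S \<Longrightarrow> smooth_on T F"
  unfolding smooth_on_def using Ck_on_subset by blast

lemma smooth_on_const: "smooth_on S (\<lambda>x. c)"
  unfolding smooth_on_def using Ck_on_const by blast

lemma smooth_on_bounded_linear: "bounded_linear h \<Longrightarrow> smooth_on S h"
  unfolding smooth_on_def using Ck_on_bounded_linear by blast

lemma smooth_on_add: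
  "open S \<Longrightarrow> smooth_on S F \<Longrightarrow> smooth_on S G \<Longrightarrow> smooth_on S (\<lambda>x. F x + G x)"
  unfolding smooth_on_def using Ck_on_add by blast

lemma smooth_on_bilinear:
  "bounded_bilinear h \<Longrightarrow> open S \<Longrightarrow> smooth_on S F \<Longrightarrow> smooth_on S G \<Longrightarrow>
    smooth_on S (\<lambda>x. h (F x) (G x))"
  unfolding smooth_on_def using Ck_on_bilinear by blast

lemma smooth_on_mult:
  fixes F G :: "'a::real_normed_vector \<Rightarrow> real"
  shows "open S \<Longrightarrow> smooth_on S F \<Longrightarrow> smooth_on S G \<Longrightarrow> smooth_on S (\<lambda>x. F x * G x)"
  using smooth_on_bilinear[OF bounded_bilinear_mult] by blast

lemma smooth_on_scaleR:
  "open S \<Longrightarrow> smooth_on S F \<Longrightarrow> smooth_on S G \<Longrightarrow> smooth_on S (\<lambda>x. F x *\<^sub>R G x)"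
  using smooth_on_bilinear[OF bounded_bilinear_scaleR] by blast

lemma smooth_on_sum:
  "open S \<Longrightarrow> (\<And>i. i \<in> I \<Longrightarrow> smooth_on S (F i)) \<Longrightarrow> smooth_on S (\<lambda>x. \<Sum>i\<in>I. F i x)"
  by (simp add: smooth_on_def Ck_on_sum)

lemma smooth_on_compose:
  fixes F :: "'b::euclidean_space \<Rightarrow> 'c::real_normed_vector"
  shows "open S \<Longrightarrow> open T \<Longrightarrow> smooth_on S G \<Longrightarrow> smooth_on T F \<Longrightarrow> (\<And>x. x \<in> S \<Longrightarrow> G x \<in> T) \<Longrightarrow>
    smooth_on S (\<lambda>x. F (G x))"
  unfolding smooth_on_def using Ck_on_compose by blast

lemma smooth_on_linear_compose:
  fixes F :: "'a::real_normed_vector \<Rightarrow> 'b::euclidean_space"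
  shows "open S \<Longrightarrow> smooth_on S F \<Longrightarrow> bounded_linear h \<Longrightarrow> smooth_on S (\<lambda>x. h (F x))"
  using smooth_on_compose[of S UNIV F h] smooth_on_bounded_linear by blast

lemma smooth_on_minus:
  fixes F :: "'a::real_normed_vector \<Rightarrow> 'b::euclidean_space"
  shows "open S \<Longrightarrow> smooth_on S F \<Longrightarrow> smooth_on S (\<lambda>x. - F x)"
  by (rule smooth_on_linear_compose) (auto intro: bounded_linear_minus bounded_linear_ident)

lemma smooth_on_diff:
  fixes F :: "'a::real_normed_vector \<Rightarrow> 'b::euclidean_space"
  shows "open S \<Longrightarrow> smooth_on S F \<Longrightarrow> smooth_on S G \<Longrightarrow> smooth_on S (\<lambda>x. F x - G x)"
  using smooth_on_add[of S F "\<lambda>x. - G x"] smooth_on_minus by force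

lemma smooth_on_nth:
  fixes F :: "'a::real_normed_vector \<Rightarrow> 'b::euclidean_space ^ 'n::finite"
  shows "open S \<Longrightarrow> smooth_on S F \<Longrightarrow> smooth_on S (\<lambda>x. F x $ i)"
  by (rule smooth_on_linear_compose) (auto intro: bounded_linear_vec_nth)

lemma smooth_on_Pair:
  fixes F :: "'a::real_normed_vector \<Rightarrow> 'b::euclidean_space" and G :: "'a \<Rightarrow> 'c::euclidean_space"
  assumes "open S" "smooth_on S F" "smooth_on S G"
  shows "smooth_on S (\<lambda>x. (F x, G x))"
proof -
  have "smooth_on S (\<lambda>x. (F x, 0) + (0, G x))"
    using assms by (intro smooth_on_add smooth_on_linear_compose[of S F "\<lambda>y. (y, 0)"]
        smooth_on_linear_compose[of S G "\<lambda>y. (0, y)"])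
      (auto intro!: bounded_linear_Pair bounded_linear_ident bounded_linear_zero)
  then show ?thesis by simp
qed

lemma smooth_on_vec:
  fixes F :: "'a::real_normed_vector \<Rightarrow> 'b::euclidean_space ^ 'n::finite"
  assumes "open S" "\<And>i. smooth_on S (\<lambda>x. F x $ i)"
  shows "smooth_on S F"
proof -
  have *: "F = (\<lambda>x. \<Sum>i\<in>UNIV. axis i (F x $ i))"
    by (simp add: fun_eq_iff vec_eq_iff axis_def)
  have ax: "bounded_linear (axis i :: 'b \<Rightarrow> 'b ^ 'n)" for i
    unfolding linear_conv_bounded_linear[symmetric]
    by (auto simp: linear_iff axis_def vec_eq_iff)
  have "smooth_on S (\<lambda>x. \<Sum>i\<in>UNIV. axis i (F x $ i))"
    by (intro smooth_on_sum smooth_on_linear_compose[OF assms(1) assms(2) ax] assms(1))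
  then show ?thesis using * by metis
qed


section \<open>Symmetry of second derivatives and brackets of fields\<close>

text \<open>The mean value theorem is used twice: along \<open>u\<close> for the difference F(y + h
  v) - F(y), then along \<open>v\<close> for the derivative of \<open>F\<close> in direction
  \<open>u\<close>. The bound on \<open>h\<close> keeps the whole parallelogram inside the
  ball.\<close>

lemma second_difference_mvt:
  fixes F :: "'a::real_normed_vector \<Rightarrow> real"
  assumes F: "smooth_on (ball x d) F" and h: "h > 0" "h * (norm u + norm v) < d"
  shows "\<exists>y\<in>ball x d. F (x + h *\<^sub>R u + h *\<^sub>R v) - F (x + h *\<^sub>R u) - F (x + h *\<^sub>R v) + F x =
    h * h * frechet_derivative (\<lambda>y. frechet_derivative F (at y) u) (at y) v"
proof -
  have inb: "x + s *\<^sub>R u + t *\<^sub>R v \<in> ball x d" if "0 \<le> s" "s \<le> h" "0 \<le> t" "t \<le> h" for s t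
  proof -
    have "norm (s *\<^sub>R u + t *\<^sub>R v) \<le> norm (s *\<^sub>R u) + norm (t *\<^sub>R v)"
      by (rule norm_triangle_ineq)
    also have "\<dots> \<le> h * norm u + h * norm v"
      using that by (intro add_mono) (auto intro: mult_right_mono)
    also have "\<dots> < d" using h by (simp add: algebra_simps)
    finally have "norm (s *\<^sub>R u + t *\<^sub>R v) < d" .
    moreover have "dist x (x + s *\<^sub>R u + t *\<^sub>R v) = norm (s *\<^sub>R u + t *\<^sub>R v)"
      by (metis add.assoc dist_add_cancel dist_0_norm add.right_neutral)
    ultimately show ?thesis by simp
  qed
  have line: "((\<lambda>s. G (c + s *\<^sub>R w)) has_real_derivative frechet_derivative G (at (c + s *\<^sub>R w)) w) (at s)"
    if "G differentiable at (c + s *\<^sub>R w)" for G :: "'a \<Rightarrow> real" and c w s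
  proof -
    have "((\<lambda>s. c + s *\<^sub>R w) has_derivative (\<lambda>t. t *\<^sub>R w)) (at s)"
      by (auto intro!: derivative_eq_intros)
    moreover have D: "(G has_derivative frechet_derivative G (at (c + s *\<^sub>R w))) (at (c + s *\<^sub>R w))"
      using that frechet_derivative_works by blast
    ultimately have "((\<lambda>s. G (c + s *\<^sub>R w)) has_derivative
        (\<lambda>t. frechet_derivative G (at (c + s *\<^sub>R w)) (t *\<^sub>R w))) (at s)"
      using has_derivative_compose by blast
    then show ?thesis
      using linear_cmul[OF linear_frechet_derivative[OF that]]
      by (simp add: has_field_derivative_def mult.commute[of _ "frechet_derivative _ _ _"] mult_commute_abs)
  qed
  have D1: "F differentiable at (x + s *\<^sub>R u + t *\<^sub>R v)"
    if "0 \<le> s" "s \<le> h" "0 \<le> t" "t \<le> h" for s t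
    using smooth_on_differentiable[OF F inb[OF that]] .
  have "\<exists>s. 0 < s \<and> s < h \<and>
     (F (x + h *\<^sub>R v + h *\<^sub>R u) - F (x + h *\<^sub>R u)) - (F (x + h *\<^sub>R v + 0 *\<^sub>R u) - F (x + 0 *\<^sub>R u)) =
       (h - 0) * (frechet_derivative F (at (x + h *\<^sub>R v + s *\<^sub>R u)) u - frechet_derivative F (at (x + s *\<^sub>R u)) u)"
    using h D1[of _ h] D1[of _ 0]
    by (intro MVT2 DERIV_diff line) (auto simp: algebra_simps)
  then obtain s where s: "0 < s" "s < h"
    and e1: "(F (x + h *\<^sub>R v + h *\<^sub>R u) - F (x + h *\<^sub>R u)) - (F (x + h *\<^sub>R v) - F x) =
       h * (frechet_derivative F (at (x + h *\<^sub>R v + s *\<^sub>R u)) u - frechet_derivative F (at (x + s *\<^sub>R u)) u)"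
    by auto
  let ?G = "\<lambda>y. frechet_derivative F (at y) u"
  have D2: "?G differentiable at (x + s *\<^sub>R u + t *\<^sub>R v)" if "0 \<le> t" "t \<le> h" for t
    using smooth_on_differentiable[OF smooth_on_frechet_derivative[OF F] inb[OF _ _ that]] s by auto
  have "\<exists>t. 0 < t \<and> t < h \<and> ?G ((x + s *\<^sub>R u) + h *\<^sub>R v) - ?G ((x + s *\<^sub>R u) + 0 *\<^sub>R v) =
     (h - 0) * frechet_derivative ?G (at ((x + s *\<^sub>R u) + t *\<^sub>R v)) v"
    using h(1) D2 by (intro MVT2 line) auto
  then obtain t where t: "0 < t" "t < h"
    and e2: "?G (x + s *\<^sub>R u + h *\<^sub>R v) - ?G (x + s *\<^sub>R u) =
      h * frechet_derivative ?G (at (x + s *\<^sub>R u + t *\<^sub>R v)) v"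
    by auto
  have "F (x + h *\<^sub>R u + h *\<^sub>R v) - F (x + h *\<^sub>R u) - F (x + h *\<^sub>R v) + F x =
    h * h * frechet_derivative ?G (at (x + s *\<^sub>R u + t *\<^sub>R v)) v"
    using e1 e2 by (simp add: algebra_simps)
  then show ?thesis using inb[of s t] s t by auto
qed

text \<open>Clairaut: both iterated derivatives are limits of the same second difference quotient.\<close>

lemma frechet_derivative_commute:
  fixes F :: "'a::real_normed_vector \<Rightarrow> real"
  assumes S: "open S" "x \<in> S" and F: "smooth_on S F"
  shows "frechet_derivative (\<lambda>y. frechet_derivative F (at y) u) (at x) v =
    frechet_derivative (\<lambda>y. frechet_derivative F (at y) v) (at x) u"
proof (rule ccontr)
  let ?p = "\<lambda>u v x. frechet_derivative (\<lambda>y. frechet_derivative F (at y) u) (at x) v"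
  assume ne: "?p u v x \<noteq> ?p v u x"
  \<comment> \<open>Half the gap: the two mixed derivatives take a common value at nearby points,
    and that value cannot be within \<open>e\<close> of both of these numbers.\<close>
  define e where "e = \<bar>?p u v x - ?p v u x\<bar> / 2"
  have e: "e > 0" using ne by (simp add: e_def)
  have cont: "isCont (?p u v) x" for u v
    using smooth_on_continuous[OF smooth_on_frechet_derivative[OF smooth_on_frechet_derivative[OF F]]]
      S by (simp add: continuous_on_eq_continuous_at)
  have "\<exists>d>0. \<forall>y. dist y x < d \<longrightarrow> dist (?p u v y) (?p u v x) < e" for u v
    using cont e unfolding continuous_at_eps_delta by blast
  then obtain d1 d2 where d1: "d1 > 0" "\<And>y. dist y x < d1 \<Longrightarrow> dist (?p u v y) (?p u v x) < e"
    and d2: "d2 > 0" "\<And>y. dist y x < d2 \<Longrightarrow> dist (?p v u y) (?p v u x) < e"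
    by meson
  obtain d3 where d3: "d3 > 0" "ball x d3 \<subseteq> S"
    using S open_contains_ball by blast
  define d where "d = min d1 (min d2 d3)"
  have d: "d > 0" using d1 d2 d3 by (simp add: d_def)
  have Fd: "smooth_on (ball x d) F"
    using F d3 by (rule_tac smooth_on_subset) (auto simp: d_def)
  \<comment> \<open>The summand 1 keeps the denominator positive when \<open>u\<close> and
    \<open>v\<close> vanish; the factor 2 makes the bound \<open>hd\<close> strict.\<close>
  define h where "h = d / (2 * (norm u + norm v + 1))"
  have pos: "norm u + norm v + 1 > 0" by (simp add: add_nonneg_pos)
  have h: "h > 0" using d pos by (simp add: h_def)
  have "h * (norm u + norm v) < h * (2 * (norm u + norm v + 1))"
    using h by (intro mult_strict_left_mono) (auto simp: add_nonneg_pos add_pos_nonneg intro: add_strict_increasing2)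
  also have "\<dots> = d" using pos by (simp add: h_def)
  finally have hd: "h * (norm u + norm v) < d" .
  obtain y where y: "y \<in> ball x d" and
    ey: "F (x + h *\<^sub>R u + h *\<^sub>R v) - F (x + h *\<^sub>R u) - F (x + h *\<^sub>R v) + F x = h * h * ?p u v y"
    using second_difference_mvt[OF Fd h hd] by blast
  obtain z where z: "z \<in> ball x d" and
    ez: "F (x + h *\<^sub>R v + h *\<^sub>R u) - F (x + h *\<^sub>R v) - F (x + h *\<^sub>R u) + F x = h * h * ?p v u z"
    using second_difference_mvt[OF Fd h, of v u] hd by (auto simp: add.commute)
  have "h * h * ?p u v y = h * h * ?p v u z"
    using ey ez by (simp add: algebra_simps)
  then have "?p u v y = ?p v u z" using h by simp
  moreover have "dist (?p u v y) (?p u v x) < e" "dist (?p v u z) (?p v u x) < e"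
    using d1(2)[of y] d2(2)[of z] y z by (simp_all add: d_def dist_commute[of x])
  moreover have False if "p = q" "\<bar>p - a\<bar> < \<bar>a - b\<bar> / 2" "\<bar>q - b\<bar> < \<bar>a - b\<bar> / 2" for p q a b :: real
    using that by argo
  ultimately show False unfolding e_def dist_real_def by blast
qed

lemma frechet_derivative_add_real:
  fixes F G :: "'a::real_normed_vector \<Rightarrow> real"
  assumes "F differentiable at x" "G differentiable at x"
  shows "frechet_derivative (\<lambda>x. F x + G x) (at x) v =
    frechet_derivative F (at x) v + frechet_derivative G (at x) v"
  using frechet_derivative_at[OF has_derivative_add, of F _ x G] assms
  by (metis frechet_derivative_works)

lemma frechet_derivative_diff_real:
  fixes F G :: "'a::real_normed_vector \<Rightarrow> real"
  assumes "F differentiable at x" "G differentiable at x"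
  shows "frechet_derivative (\<lambda>x. F x - G x) (at x) v =
    frechet_derivative F (at x) v - frechet_derivative G (at x) v"
  using frechet_derivative_at[OF has_derivative_diff, of F _ x G] assms
  by (metis frechet_derivative_works)

lemma frechet_derivative_mult_real:
  fixes F G :: "'a::real_normed_vector \<Rightarrow> real"
  assumes "F differentiable at x" "G differentiable at x"
  shows "frechet_derivative (\<lambda>x. F x * G x) (at x) v =
    F x * frechet_derivative G (at x) v + frechet_derivative F (at x) v * G x"
proof -
  have "((\<lambda>x. F x * G x) has_derivative
      (\<lambda>v. F x * frechet_derivative G (at x) v + frechet_derivative F (at x) v * G x)) (at x)"
    using assms frechet_derivative_works by (intro has_derivative_mult) auto
  then show ?thesis using frechet_derivative_at by metis
qed

lemma frechet_derivative_sum_real: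
  fixes F :: "'i \<Rightarrow> 'a::real_normed_vector \<Rightarrow> real"
  assumes "\<And>i. i \<in> I \<Longrightarrow> F i differentiable at x"
  shows "frechet_derivative (\<lambda>x. \<Sum>i\<in>I. F i x) (at x) v =
    (\<Sum>i\<in>I. frechet_derivative (F i) (at x) v)"
proof -
  have "((\<lambda>x. \<Sum>i\<in>I. F i x) has_derivative (\<lambda>v. \<Sum>i\<in>I. frechet_derivative (F i) (at x) v)) (at x)"
    using assms by (intro has_derivative_sum) (auto simp: frechet_derivative_works[symmetric])
  then show ?thesis using frechet_derivative_at by metis
qed

lemma frechet_derivative_linear_comp:
  assumes "bounded_linear h" "F differentiable at x"
  shows "frechet_derivative (\<lambda>x. h (F x)) (at x) v = h (frechet_derivative F (at x) v)"
proof -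
  have "((\<lambda>x. h (F x)) has_derivative (\<lambda>v. h (frechet_derivative F (at x) v))) (at x)"
    using assms bounded_linear.has_derivative frechet_derivative_works by blast
  then show ?thesis using frechet_derivative_at by metis
qed

text \<open>The direction \<open>X w\<close> moves with \<open>w\<close>, so it is expanded in the
  basis; symmetry of second derivatives then reassembles the terms in which \<open>F\<close> is
  differentiated twice. All commutators with \<Gamma> and with horizontal fields come from this
  formula.\<close>

lemma frechet_derivative_along_field:
  fixes F :: "'a::euclidean_space \<Rightarrow> real"
  assumes S: "open S" "x \<in> S" and F: "smooth_on S F" and X: "X differentiable at x"
  shows "frechet_derivative (\<lambda>w. frechet_derivative F (at w) (X w)) (at x) u =
    frechet_derivative (\<lambda>w. frechet_derivative F (at w) u) (at x) (X x) +
    frechet_derivative F (at x) (frechet_derivative X (at x) u)"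
proof -
  have D: "(\<lambda>w. frechet_derivative F (at w) b) differentiable at x" for b
    using smooth_on_differentiable[OF smooth_on_frechet_derivative[OF F] S(2)] .
  have Xb: "(\<lambda>w. X w \<bullet> b) differentiable at x" for b
    using X by (intro differentiable_inner) auto
  have "frechet_derivative (\<lambda>w. frechet_derivative F (at w) (X w)) (at x) u =
     frechet_derivative (\<lambda>w. \<Sum>b\<in>Basis. (X w \<bullet> b) * frechet_derivative F (at w) b) (at x) u"
    using frechet_derivative_cong_open[OF S] frechet_derivative_euclidean_sum smooth_on_differentiable[OF F]
    by (smt (verit) sum.cong real_scaleR_def)
  also have "\<dots> = (\<Sum>b\<in>Basis. (X x \<bullet> b) * frechet_derivative (\<lambda>w. frechet_derivative F (at w) b) (at x) u +
       frechet_derivative (\<lambda>w. X w \<bullet> b) (at x) u * frechet_derivative F (at x) b)"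
    using D Xb by (subst frechet_derivative_sum_real)
      (auto simp: frechet_derivative_mult_real intro!: differentiable_mult)
  also have "\<dots> = (\<Sum>b\<in>Basis. (X x \<bullet> b) *\<^sub>R frechet_derivative (\<lambda>w. frechet_derivative F (at w) u) (at x) b) +
      (\<Sum>b\<in>Basis. (frechet_derivative X (at x) u \<bullet> b) *\<^sub>R frechet_derivative F (at x) b)"
    using frechet_derivative_commute[OF S F, of _ u]
      frechet_derivative_linear_comp[OF bounded_linear_inner_left X]
    by (simp add: sum.distrib)
  also have "\<dots> = frechet_derivative (\<lambda>w. frechet_derivative F (at w) u) (at x) (X x) +
    frechet_derivative F (at x) (frechet_derivative X (at x) u)"
    using frechet_derivative_euclidean_sum[OF D] frechet_derivative_euclidean_sum[OF smooth_on_differentiable[OF F S(2)]]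
    by metis
  finally show ?thesis .
qed

text \<open>The second-derivative terms agree by symmetry and cancel; the derivative of
  \<open>F\<close> along the Lie bracket of \<open>X\<close> and \<open>Y\<close> remains.\<close>

lemma frechet_derivative_bracket:
  fixes F :: "'a::euclidean_space \<Rightarrow> real"
  assumes S: "open S" "x \<in> S" and F: "smooth_on S F"
    and X: "X differentiable at x" and Y: "Y differentiable at x"
  shows "frechet_derivative (\<lambda>w. frechet_derivative F (at w) (Y w)) (at x) (X x) -
    frechet_derivative (\<lambda>w. frechet_derivative F (at w) (X w)) (at x) (Y x) =
    frechet_derivative F (at x)
      (frechet_derivative Y (at x) (X x) - frechet_derivative X (at x) (Y x))"
proof -
  have D: "(\<lambda>w. frechet_derivative F (at w) b) differentiable at x" for b
    using smooth_on_differentiable[OF smooth_on_frechet_derivative[OF F] S(2)] .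
  have swap: "frechet_derivative (\<lambda>w. frechet_derivative F (at w) u) (at x) v =
    frechet_derivative (\<lambda>w. frechet_derivative F (at w) v) (at x) u" for u v
    by (rule frechet_derivative_commute[OF S F])
  show ?thesis
    using frechet_derivative_along_field[OF S F Y, of "X x"] frechet_derivative_along_field[OF S F X, of "Y x"]
      swap[of "X x" "Y x"]
      linear_diff[OF linear_frechet_derivative[OF smooth_on_differentiable[OF F S(2)]]]
    by simp
qed

section \<open>Local existence of integral curves\<close>

text \<open>Each basis derivative is continuous, hence bounded on the compact ball; the bounds add
  up to one for the operator norm, and convexity of the ball turns that into a Lipschitz
  constant.\<close>

lemma smooth_on_locally_lipschitz:
  fixes X :: "'a::euclidean_space \<Rightarrow> 'b::real_normed_vector"
  assumes X: "smooth_on S X" and cb: "cball z r \<subseteq> S"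
  obtains K where "0 \<le> K" "\<And>x y. x \<in> cball z r \<Longrightarrow> y \<in> cball z r \<Longrightarrow> norm (X x - X y) \<le> K * norm (x - y)"
proof -
  let ?D = "\<lambda>x. frechet_derivative X (at x)"
  have "\<exists>m. \<forall>x\<in>cball z r. norm (?D x b) \<le> m" for b
  proof -
    have "continuous_on (cball z r) (\<lambda>x. ?D x b)"
      using smooth_on_continuous[OF smooth_on_frechet_derivative[OF X]] cb continuous_on_subset by blast
    then have "bounded ((\<lambda>x. ?D x b) ` cball z r)"
      by (intro compact_imp_bounded compact_continuous_image) auto
    then show ?thesis unfolding bounded_iff by auto
  qed
  then obtain m where m: "\<And>b x. x \<in> cball z r \<Longrightarrow> norm (?D x b) \<le> m b" by metis
  define K where "K = \<bar>\<Sum>b\<in>Basis. m b\<bar>"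
  have "onorm (?D x) \<le> K" if x: "x \<in> cball z r" for x
  proof (rule onorm_le)
    fix u :: 'a
    have "?D x u = (\<Sum>b\<in>Basis. (u \<bullet> b) *\<^sub>R ?D x b)"
      using frechet_derivative_euclidean_sum smooth_on_differentiable[OF X] x cb by blast
    also have "norm \<dots> \<le> (\<Sum>b\<in>Basis. norm u * m b)"
      by (rule order_trans[OF norm_sum])
        (auto intro!: sum_mono mult_mono m x Basis_le_norm)
    also have "\<dots> \<le> K * norm u"
      unfolding K_def sum_distrib_left[symmetric] by (simp add: mult.commute mult_left_mono)
    finally show "norm (?D x u) \<le> K * norm u" .
  qed
  note on = this
  have "norm (X x - X y) \<le> K * norm (x - y)" if "x \<in> cball z r" "y \<in> cball z r" for x y
  proof (rule differentiable_bound[of "cball z r" X ?D])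
    show "(X has_derivative ?D x) (at x within cball z r)" if "x \<in> cball z r" for x
      using smooth_on_has_derivative[OF X] that cb has_derivative_at_withinI by blast
  qed (use that on in auto)
  moreover have "K \<ge> 0" by (simp add: K_def)
  ultimately show ?thesis using that by blast
qed

text \<open>Picard's argument in the complete space of bounded continuous functions on the whole
  line, where the Banach fixed point theorem is available for an entire type.\<close>

lemma bounded_lipschitz_ode_solution:
  fixes P :: "'a::euclidean_space \<Rightarrow> 'a"
  assumes lip: "\<And>x y. norm (P x - P y) \<le> K * norm (x - y)" and K: "0 \<le> K"
    and bd: "\<And>x. norm (P x) \<le> M" and h: "0 < h" "4 * h * K < 1"
  obtains u where "u 0 = z" "\<And>t. norm (u t - z) \<le> 4 * h * M"
    "\<And>t. -h < t \<Longrightarrow> t < h \<Longrightarrow> (u has_vector_derivative P (u t)) (at t)"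
proof -
  have contP: "continuous_on UNIV P"
    using lip K by (intro lipschitz_on_continuous_on[of K] lipschitz_onI) (auto simp: dist_norm)
  \<comment> \<open>Clamping time to the interval from \<open>-h\<close> to \<open>h\<close> makes
    every iterate a bounded function on the line and changes nothing inside the interval.\<close>
  define \<tau> where "\<tau> t = max (-h) (min h t)" for t
  have \<tau>: "-h \<le> \<tau> t" "\<tau> t \<le> h" for t using h by (auto simp: \<tau>_def)
  have M: "0 \<le> M" using bd[of 0] norm_ge_zero order_trans by blast
  define I where "I u t = integral {-h..t} (\<lambda>s. P (apply_bcontfun u s))" for u t
  have contu: "continuous_on T (\<lambda>s. P (apply_bcontfun u s))" for u :: "real \<Rightarrow>\<^sub>C 'a" and T
    using continuous_on_compose2[OF contP continuous_on_apply_bcontfun] by auto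
  have intu: "(\<lambda>s. P (apply_bcontfun u s)) integrable_on {a..b}" for u :: "real \<Rightarrow>\<^sub>C 'a" and a b
    by (rule integrable_continuous_real[OF contu])
  have bdI: "norm (I u t) \<le> 2 * h * M" if "-h \<le> t" "t \<le> h" for u t
  proof -
    have "norm (I u t) \<le> M * (t - (-h))"
      unfolding I_def using that by (intro integral_bound contu bd) auto
    also have "\<dots> \<le> M * (2 * h)" using that M by (intro mult_left_mono) auto
    finally show ?thesis by (simp add: mult.commute)
  qed
  have lipI: "norm (I u t - I w t) \<le> 2 * h * K * dist u w" if "-h \<le> t" "t \<le> h" for u w t
  proof -
    have "I u t - I w t = integral {-h..t} (\<lambda>s. P (apply_bcontfun u s) - P (apply_bcontfun w s))"
      unfolding I_def by (rule integral_diff[OF intu intu, symmetric])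
    also have "norm \<dots> \<le> (K * dist u w) * (t - (-h))"
    proof (rule integral_bound)
      show "norm (P (apply_bcontfun u s) - P (apply_bcontfun w s)) \<le> K * dist u w" for s
        using lip[of "apply_bcontfun u s" "apply_bcontfun w s"] dist_bounded[of u s w] K
        by (metis dist_norm mult_left_mono order_trans)
    qed (use that in \<open>auto intro!: continuous_intros contu\<close>)
    also have "\<dots> \<le> (K * dist u w) * (2 * h)" using that K by (intro mult_left_mono) auto
    finally show ?thesis by (simp add: algebra_simps)
  qed
  \<comment> \<open>The integrals start at \<open>-h\<close>, so the one up to time 0 is subtracted
    to fix the initial value \<open>z\<close>. Each of the two contributes \<open>2 * h\<close>,
    which explains the \<open>4 * h\<close> in the bounds.\<close>
  define G where "G u t = z + I u (\<tau> t) - I u 0" for u t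
  have Gb: "norm (G u t - z) \<le> 4 * h * M" for u t
    using bdI[OF \<tau>, of u t] bdI[of 0 u] h norm_triangle_ineq4[of "I u (\<tau> t)" "I u 0"]
    by (simp add: G_def)
  have "G u \<in> bcontfun" for u
    unfolding bcontfun_def
  proof (safe)
    have cI: "continuous_on {-h..h} (I u)"
      unfolding I_def by (rule indefinite_integral_continuous_1[OF intu])
    have ct: "continuous_on UNIV \<tau>" unfolding \<tau>_def by (intro continuous_intros)
    have "continuous_on UNIV (\<lambda>t. I u (\<tau> t))"
      by (rule continuous_on_compose2[OF cI ct]) (use \<tau> in auto)
    then show "continuous_on UNIV (G u)"
      unfolding G_def by (intro continuous_intros)
    have "norm (G u t) \<le> norm z + 4 * h * M" for t
      using Gb[of u t] norm_triangle_ineq[of z "G u t - z"] by simp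
    then show "bounded (range (G u))" unfolding bounded_iff by auto
  qed
  then have app: "apply_bcontfun (Bcontfun (G u)) = G u" for u by (simp add: Bcontfun_inverse)
  have "\<exists>!u. Bcontfun (G u) = u"
  proof (rule banach_fix_type)
    show "0 \<le> 4 * h * K" "4 * h * K < 1" using h K by auto
    show "\<forall>u w. dist (Bcontfun (G u)) (Bcontfun (G w)) \<le> 4 * h * K * dist u w"
    proof (intro allI dist_bound)
      fix u w :: "real \<Rightarrow>\<^sub>C 'a" and t
      have "G u t - G w t = (I u (\<tau> t) - I w (\<tau> t)) - (I u 0 - I w 0)" by (simp add: G_def)
      then have "norm (G u t - G w t) \<le> 4 * h * K * dist u w"
        using lipI[OF \<tau>, of u t w] lipI[of 0 u w] h
          norm_triangle_ineq4[of "I u (\<tau> t) - I w (\<tau> t)" "I u 0 - I w 0"] by simp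
      then show "dist (apply_bcontfun (Bcontfun (G u)) t) (apply_bcontfun (Bcontfun (G w)) t) \<le> 4 * h * K * dist u w"
        by (simp add: app dist_norm)
    qed
  qed
  then obtain u where "Bcontfun (G u) = u" by blast
  then have fix_u: "apply_bcontfun u = G u" using app by metis
  show thesis
  proof
    show "apply_bcontfun u 0 = z" using h by (simp add: fix_u G_def \<tau>_def)
    show "norm (apply_bcontfun u t - z) \<le> 4 * h * M" for t by (simp add: fix_u Gb)
    show "(apply_bcontfun u has_vector_derivative P (apply_bcontfun u t)) (at t)"
      if t: "-h < t" "t < h" for t
    proof -
      have "(I u has_vector_derivative P (apply_bcontfun u t)) (at t within {-h..h})"
        unfolding I_def using t by (intro integral_has_vector_derivative contu) auto
      then have "(I u has_vector_derivative P (apply_bcontfun u t)) (at t)"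
        using t at_within_Icc_at[of "-h" t h] by metis
      then have "((\<lambda>t. z + I u t - I u 0) has_vector_derivative P (apply_bcontfun u t)) (at t)"
        by (auto intro!: derivative_eq_intros)
      then show ?thesis
        by (rule has_vector_derivative_transform_within_open[where S = "{-h<..<h}"])
          (use t in \<open>auto simp: fix_u G_def \<tau>_def\<close>)
    qed
  qed
qed

text \<open>Nearest-point projection onto a closed ball does not increase distances, so composing
  the field with it gives a bounded, globally Lipschitz field. The short-time solution stays in the
  ball, where the projection is the identity.\<close>

lemma local_ode_solution:
  fixes X :: "'a::euclidean_space \<Rightarrow> 'a"
  assumes "open S" "z \<in> S" "smooth_on S X"
  obtains h u where "h > 0" "u 0 = z"
    "\<And>t. -h < t \<Longrightarrow> t < h \<Longrightarrow> u t \<in> S \<and> (u has_vector_derivative X (u t)) (at t)"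
proof -
  obtain r where r: "r > 0" "cball z r \<subseteq> S"
    using assms open_contains_cball by metis
  obtain K where K: "0 \<le> K"
    "\<And>x y. x \<in> cball z r \<Longrightarrow> y \<in> cball z r \<Longrightarrow> norm (X x - X y) \<le> K * norm (x - y)"
    using smooth_on_locally_lipschitz[OF assms(3) r(2)] by blast
  have "bounded (X ` cball z r)"
    using smooth_on_continuous[OF assms(3)] r(2) continuous_on_subset
    by (intro compact_imp_bounded compact_continuous_image) auto
  then obtain M where M: "\<And>x. x \<in> cball z r \<Longrightarrow> norm (X x) \<le> M"
    unfolding bounded_iff by blast
  have M0: "0 \<le> M" using M[of z] r(1) norm_ge_zero[of "X z"] by (simp del: norm_ge_zero)
  define c where "c = closest_point (cball z r)"
  have c_in: "c x \<in> cball z r" for x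
    using r(1) unfolding c_def by (intro closest_point_in_set) auto
  have c_id: "c x = x" if "x \<in> cball z r" for x
    using that by (simp add: c_def closest_point_self)
  have c_lip: "norm (c x - c y) \<le> norm (x - y)" for x y
    using closest_point_lipschitz[of "cball z r" x y] r(1) by (auto simp: c_def dist_norm)
  \<comment> \<open>The first bound keeps the solution in the ball (\<open>hM\<close>), the second
    makes the Picard map a contraction (\<open>hK\<close>). The summands 1 guard against
    \<open>M\<close> or \<open>K\<close> being 0.\<close>
  define h where "h = min (r / (4 * (M + 1))) (1 / (8 * (K + 1)))"
  have h: "h > 0" using r(1) M0 K(1) by (auto simp: h_def)
  have "4 * h * K \<le> 4 * (1 / (8 * (K + 1))) * K"
    using K(1) by (intro mult_right_mono mult_left_mono) (auto simp: h_def)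
  also have "\<dots> < 1" using K(1) by (simp add: field_simps)
  finally have hK: "4 * h * K < 1" .
  have "4 * h * M \<le> 4 * (r / (4 * (M + 1))) * M"
    using M0 by (intro mult_right_mono mult_left_mono) (auto simp: h_def)
  also have "\<dots> \<le> r" using M0 r(1) by (simp add: field_simps)
  finally have hM: "4 * h * M \<le> r" .
  have "norm (X (c x) - X (c y)) \<le> K * norm (x - y)" for x y
    using K(2)[OF c_in c_in, of x y] mult_left_mono[OF c_lip K(1), of x y] by linarith
  then obtain u where u: "u 0 = z" "\<And>t. norm (u t - z) \<le> 4 * h * M"
    "\<And>t. -h < t \<Longrightarrow> t < h \<Longrightarrow> (u has_vector_derivative X (c (u t))) (at t)"
    using bounded_lipschitz_ode_solution[of "\<lambda>x. X (c x)" K M h z] K(1) M[OF c_in] h hK by metis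
  have ucb: "u t \<in> cball z r" for t
    using u(2)[of t] hM by (simp add: dist_norm norm_minus_commute)
  show thesis
    by (rule that[of h u]) (use h u(1,3) ucb c_id r(2) in auto)
qed

section \<open>Integrals with a parameter and the Poincare lemma\<close>

text \<open>Smoothness includes two-sided derivatives at the end points of the integration interval,
  hence the open set \<open>V\<close>. The Leibniz rule wants a continuous family of bounded
  operators; in finite dimension continuity may be tested on basis vectors.\<close>

lemma parametric_integral_derivative:
  fixes H :: "'a::euclidean_space \<times> real \<Rightarrow> real"
  assumes W: "open W" and V: "open V" "W \<times> {0..1} \<subseteq> V" and H: "smooth_on V H" and x: "x \<in> W"
  shows "((\<lambda>x. integral {0..1} (\<lambda>s. H (x, s))) has_derivative
    (\<lambda>v. integral {0..1} (\<lambda>s. frechet_derivative H (at (x, s)) (v, 0)))) (at x)"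
proof -
  \<comment> \<open>The Leibniz rule is applied on a convex parameter set, so a ball is cut out of
    \<open>W\<close>.\<close>
  obtain e where e: "e > 0" "ball x e \<subseteq> W" using W x open_contains_ball by blast
  let ?U = "ball x e"
  let ?f = "\<lambda>x s. Blinfun (\<lambda>v. frechet_derivative H (at (x, s)) (v, 0))"
  have inV: "(y, s) \<in> V" if "y \<in> ?U" "s \<in> {0..1}" for y s using that e V by blast
  have bl: "bounded_linear (\<lambda>v. frechet_derivative H (at (y, s)) (v, 0))" if "(y, s) \<in> V" for y s
  proof -
    have "bounded_linear (frechet_derivative H (at (y, s)))"
      using smooth_on_has_derivative[OF H that] has_derivative_bounded_linear by blast
    moreover have "bounded_linear (\<lambda>v::'a. (v, 0::real))"
      by (intro bounded_linear_Pair bounded_linear_ident bounded_linear_zero)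
    ultimately show ?thesis by (rule bounded_linear_compose)
  qed
  have app: "blinfun_apply (?f y s) = (\<lambda>v. frechet_derivative H (at (y, s)) (v, 0))"
    if "y \<in> ?U" "s \<in> {0..1}" for y s
    using bounded_linear_Blinfun_apply[OF bl[OF inV[OF that]]] .
  have contD: "continuous_on (?U \<times> {0..1}) (\<lambda>z. frechet_derivative H (at z) (v, 0))" for v
    by (rule continuous_on_subset[OF smooth_on_continuous[OF smooth_on_frechet_derivative[OF H]]])
      (use inV in blast)
  have contf: "continuous_on (?U \<times> {0..1}) (\<lambda>(y, s). ?f y s)"
  proof (rule continuous_on_blinfun_componentwise)
    fix i :: 'a
    show "continuous_on (?U \<times> {0..1}) (\<lambda>z. blinfun_apply (case z of (y, s) \<Rightarrow> ?f y s) i)"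
      by (rule continuous_on_eq[OF contD[of i]]) (use app in auto)
  qed
  have "((\<lambda>x. integral (cbox 0 1) (\<lambda>s. H (x, s))) has_derivative integral (cbox 0 1) (?f x)) (at x within ?U)"
  proof (rule leibniz_rule)
    show "((\<lambda>y. H (y, s)) has_derivative blinfun_apply (?f y s)) (at y within ?U)"
      if "y \<in> ?U" "s \<in> cbox 0 1" for y s
    proof -
      have "((\<lambda>y. (y, s)) has_derivative (\<lambda>v. (v, 0))) (at y)"
        by (auto intro!: derivative_eq_intros)
      from has_derivative_compose[OF this smooth_on_has_derivative[OF H inV]] that app
      show ?thesis by (auto intro: has_derivative_at_withinI)
    qed
    show "(\<lambda>s. H (y, s)) integrable_on cbox 0 1" if "y \<in> ?U" for y
    proof -
      have "continuous_on {0..1} (\<lambda>s. H (y, s))"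
        using inV[OF that] by (intro continuous_on_compose2[OF smooth_on_continuous[OF H]] continuous_intros) auto
      then show ?thesis by (simp add: integrable_continuous_real)
    qed
    show "continuous_on (?U \<times> cbox 0 1) (\<lambda>(y, s). ?f y s)" using contf by simp
  qed (use e in auto)
  then have D: "((\<lambda>x. integral {0..1} (\<lambda>s. H (x, s))) has_derivative integral {0..1} (?f x)) (at x)"
    using e at_within_open[of x ?U] by simp
  have "blinfun_apply (integral {0..1} (?f x)) v = integral {0..1} (\<lambda>s. frechet_derivative H (at (x, s)) (v, 0))"
    for v
  proof -
    have cx: "continuous_on {0..1} (?f x)"
    proof -
      have "continuous_on {0..1} (\<lambda>s. (x, s))" by (intro continuous_intros)
      moreover have "(\<lambda>s. (x, s)) ` {0..1} \<subseteq> ?U \<times> {0..1}" using e by auto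
      ultimately show ?thesis using continuous_on_compose2[OF contf] by auto
    qed
    then have "blinfun_apply (integral {0..1} (?f x)) v = integral {0..1} (\<lambda>s. blinfun_apply (?f x s) v)"
      using blinfun_apply_integral integrable_continuous_real by blast
    also have "\<dots> = integral {0..1} (\<lambda>s. frechet_derivative H (at (x, s)) (v, 0))"
      by (rule integral_cong) (use app e in auto)
    finally show ?thesis .
  qed
  then have "blinfun_apply (integral {0..1} (?f x)) =
     (\<lambda>v. integral {0..1} (\<lambda>s. frechet_derivative H (at (x, s)) (v, 0)))" by auto
  then show ?thesis using D by simp
qed

text \<open>The derivative in direction \<open>v\<close> is again such an integral, with the
  derivative of \<open>H\<close> in direction \<open>(v, 0)\<close> as integrand. The induction
  therefore runs over all \<open>H\<close> at once.\<close>

lemma smooth_on_parametric_integral: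
  fixes H :: "'a::euclidean_space \<times> real \<Rightarrow> real"
  assumes W: "open W" and V: "open V" "W \<times> {0..1} \<subseteq> V" and H: "smooth_on V H"
  shows "smooth_on W (\<lambda>x. integral {0..1} (\<lambda>s. H (x, s)))"
proof -
  have "Ck_on k W (\<lambda>x. integral {0..1} (\<lambda>s. H (x, s)))" for k
    using H
  proof (induction k arbitrary: H)
    case 0
    then have "continuous_on (W \<times> {0..1}) H"
      using continuous_on_subset[OF smooth_on_continuous V(2)] by blast
    then show ?case using integral_continuous_on_param[of W 0 1 "\<lambda>x s. H (x, s)"] by simp
  next
    case (Suc k)
    note D = parametric_integral_derivative[OF W V Suc.prems]
    have "Ck_on k W (\<lambda>x. frechet_derivative (\<lambda>x. integral {0..1} (\<lambda>s. H (x, s))) (at x) v)" for v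
    proof (rule Ck_on_cong[OF W])
      show "Ck_on k W (\<lambda>x. integral {0..1} (\<lambda>s. frechet_derivative H (at (x, s)) (v, 0)))"
        by (rule Suc.IH[OF smooth_on_frechet_derivative[OF Suc.prems]])
    qed (use frechet_derivative_at[OF D] in metis)
    moreover have "\<forall>x\<in>W. (\<lambda>x. integral {0..1} (\<lambda>s. H (x, s))) differentiable at x"
      using D unfolding differentiable_def by blast
    ultimately show ?case by simp
  qed
  then show ?thesis by (simp add: smooth_on_def)
qed

text \<open>The potential is the integral over s in [0, 1] of the sum of v^i F_i(q, s v), with
  \<open>q\<close> as a mere parameter. Since the parameter space is arbitrary, the same lemma also
  serves for the base.\<close>

lemma fibre_poincare:
  fixes F :: "'n::finite \<Rightarrow> 'p::euclidean_space \<times> (real ^ 'n) \<Rightarrow> real"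
  assumes B: "open B" and C: "open C"
    and star: "\<And>v s. v \<in> C \<Longrightarrow> 0 \<le> s \<Longrightarrow> s \<le> 1 \<Longrightarrow> s *\<^sub>R v \<in> C"
    and F: "\<And>i. smooth_on (B \<times> C) (F i)"
    and sym: "\<And>i j z. z \<in> B \<times> C \<Longrightarrow> frechet_derivative (F i) (at z) (0, axis j 1) =
      frechet_derivative (F j) (at z) (0, axis i 1)"
  obtains P where "smooth_on (B \<times> C) P"
    "\<And>z i. z \<in> B \<times> C \<Longrightarrow> frechet_derivative P (at z) (0, axis i 1) = F i z"
proof -
  let ?\<psi> = "\<lambda>w :: ('p \<times> (real ^ 'n)) \<times> real. (fst (fst w), snd w *\<^sub>R snd (fst w))"
  let ?H = "\<lambda>w. \<Sum>i\<in>UNIV. snd (fst w) $ i * F i (?\<psi> w)"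
  \<comment> \<open>All pairs \<open>(z, s)\<close>, for any real \<open>s\<close>, whose rescaled
    point stays in the domain: an open set which by \<open>star\<close> contains the closed unit
    interval of parameters.\<close>
  define V where "V = ?\<psi> -` (B \<times> C)"
  have oBC: "open (B \<times> C)" using B C by (rule open_Times)
  have oV: "open V" unfolding V_def
    by (rule open_vimage[OF oBC]) (intro continuous_intros)
  have WV: "(B \<times> C) \<times> {0..1} \<subseteq> V" using star by (auto simp: V_def)
  have lin: "bounded_linear (\<lambda>w::('p \<times> (real ^ 'n)) \<times> real. fst (fst w))"
    "bounded_linear (\<lambda>w::('p \<times> (real ^ 'n)) \<times> real. snd (fst w))"
    using bounded_linear_compose[OF bounded_linear_fst bounded_linear_fst]
      bounded_linear_compose[OF bounded_linear_snd bounded_linear_fst] by auto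
  have lin_i: "bounded_linear (\<lambda>w::('p \<times> (real ^ 'n)) \<times> real. snd (fst w) $ i)" for i
    using bounded_linear_compose[OF bounded_linear_vec_nth lin(2)] .
  have sm_\<psi>: "smooth_on V ?\<psi>"
    by (intro smooth_on_Pair smooth_on_scaleR smooth_on_bounded_linear oV lin bounded_linear_snd)
  have sm_F\<psi>: "smooth_on V (\<lambda>w. F i (?\<psi> w))" for i
    by (rule smooth_on_compose[OF oV oBC sm_\<psi> F]) (simp add: V_def)
  have sm_H: "smooth_on V ?H"
    by (intro smooth_on_sum smooth_on_mult sm_F\<psi> smooth_on_bounded_linear lin_i oV)
  let ?P = "\<lambda>z. integral {0..1} (\<lambda>s. ?H (z, s))"
  show thesis
  proof (rule that[of ?P])
    show "smooth_on (B \<times> C) ?P"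
      by (rule smooth_on_parametric_integral[OF oBC oV WV sm_H])
    fix z j assume z: "z \<in> B \<times> C"
    obtain q v where qv: "z = (q, v)" by (cases z)
    have inBC: "(q, s *\<^sub>R v) \<in> B \<times> C" if "s \<in> {0..1}" for s using star z that by (auto simp: qv)
    have dF: "F i differentiable at (q, s *\<^sub>R v)" if "s \<in> {0..1}" for i s
      using smooth_on_differentiable[OF F inBC[OF that]] .
    have DH: "frechet_derivative ?H (at (z, s)) ((0, axis j 1), 0) =
        F j (q, s *\<^sub>R v) + s * frechet_derivative (F j) (at (q, s *\<^sub>R v)) (0, v)" if s: "s \<in> {0..1}" for s
    proof -
      have D\<psi>: "(?\<psi> has_derivative (\<lambda>u. (fst (fst u), s *\<^sub>R snd (fst u) + snd u *\<^sub>R v))) (at (z, s))"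
        by (auto intro!: derivative_eq_intros simp: qv)
      have chain: "frechet_derivative (\<lambda>w. F i (?\<psi> w)) (at (z, s)) ((0, axis j 1), 0) =
          s * frechet_derivative (F j) (at (q, s *\<^sub>R v)) (0, axis i 1)" for i
      proof -
        have "frechet_derivative (\<lambda>w. F i (?\<psi> w)) (at (z, s)) ((0, axis j 1), 0) =
            frechet_derivative (F i) (at (?\<psi> (z, s))) (frechet_derivative ?\<psi> (at (z, s)) ((0, axis j 1), 0))"
          using dF[OF s] D\<psi> by (intro frechet_derivative_chain) (auto simp: qv differentiable_def)
        also have "\<dots> = frechet_derivative (F i) (at (q, s *\<^sub>R v)) (s *\<^sub>R (0, axis j 1))"
          using frechet_derivative_at[OF D\<psi>] by (metis (no_types, lifting) fst_conv snd_conv qv scaleR_Pair scaleR_zero_right scaleR_zero_left add.right_neutral)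
        also have "\<dots> = s * frechet_derivative (F i) (at (q, s *\<^sub>R v)) (0, axis j 1)"
          using linear_scale[OF linear_frechet_derivative[OF dF[OF s]]] by (simp del: scaleR_Pair)
        \<comment> \<open>Symmetry trades the \<open>j\<close>-derivative of \<open>F i\<close> for
          the \<open>i\<close>-derivative of \<open>F j\<close>; summed against \<open>v\<close>,
          these become one radial derivative of \<open>F j\<close>.\<close>
        finally show ?thesis using sym[OF inBC[OF s]] by simp
      qed
      have zs: "(z, s) \<in> V" using WV z s by auto
      have "frechet_derivative ?H (at (z, s)) ((0, axis j 1), 0) =
        (\<Sum>i\<in>UNIV. v $ i * frechet_derivative (\<lambda>w. F i (?\<psi> w)) (at (z, s)) ((0, axis j 1), 0) +
          frechet_derivative (\<lambda>w. snd (fst w) $ i) (at (z, s)) ((0, axis j 1), 0) * F i (q, s *\<^sub>R v))"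
        using smooth_on_differentiable[OF sm_F\<psi> zs] bounded_linear_imp_differentiable[OF lin_i]
        by (subst frechet_derivative_sum_real)
          (auto simp: qv frechet_derivative_mult_real intro!: differentiable_mult)
      also have "\<dots> = (\<Sum>i\<in>UNIV. s * (v $ i * frechet_derivative (F j) (at (q, s *\<^sub>R v)) (0, axis i 1)) +
          (if i = j then F i (q, s *\<^sub>R v) else 0))"
      proof (intro sum.cong refl)
        fix i
        have "frechet_derivative (\<lambda>w::('p \<times> (real ^ 'n)) \<times> real. snd (fst w) $ i) (at (z, s)) ((0, axis j 1), 0) =
           (axis j 1 :: real ^ 'n) $ i"
          using frechet_derivative_at[OF bounded_linear_imp_has_derivative[OF lin_i]] by (metis fst_conv snd_conv)
        then show "v $ i * frechet_derivative (\<lambda>w. F i (?\<psi> w)) (at (z, s)) ((0, axis j 1), 0) +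
          frechet_derivative (\<lambda>w. snd (fst w) $ i) (at (z, s)) ((0, axis j 1), 0) * F i (q, s *\<^sub>R v) =
          s * (v $ i * frechet_derivative (F j) (at (q, s *\<^sub>R v)) (0, axis i 1)) +
          (if i = j then F i (q, s *\<^sub>R v) else 0)"
          unfolding chain by (auto simp: axis_def)
      qed
      also have "\<dots> = s * (\<Sum>i\<in>UNIV. v $ i * frechet_derivative (F j) (at (q, s *\<^sub>R v)) (0, axis i 1)) + F j (q, s *\<^sub>R v)"
        by (simp add: sum.distrib sum_distrib_left)
      also have "(\<Sum>i\<in>UNIV. v $ i * frechet_derivative (F j) (at (q, s *\<^sub>R v)) (0, axis i 1)) =
        frechet_derivative (F j) (at (q, s *\<^sub>R v)) (0, v)"
      proof -
        interpret linear "frechet_derivative (F j) (at (q, s *\<^sub>R v))"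
          by (rule linear_frechet_derivative[OF dF[OF s]])
        have "(0, v) = (\<Sum>i\<in>UNIV. v $ i *\<^sub>R (0 :: 'p, axis i 1 :: real ^ 'n))"
          using basis_expansion[of v]
          by (simp add: prod_eq_iff fst_sum snd_sum scalar_mult_eq_scaleR)
        then show ?thesis by (simp only: sum scale) simp
      qed
      finally show ?thesis by simp
    qed
    have "frechet_derivative ?P (at z) (0, axis j 1) =
        integral {0..1} (\<lambda>s. frechet_derivative ?H (at (z, s)) ((0, axis j 1), 0))"
      using frechet_derivative_at[OF parametric_integral_derivative[OF oBC oV WV sm_H z]] by metis
    also have "\<dots> = integral {0..1} (\<lambda>s. F j (q, s *\<^sub>R v) + s * frechet_derivative (F j) (at (q, s *\<^sub>R v)) (0, v))"
      by (rule integral_cong) (rule DH)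
    \<comment> \<open>The integrand is the \<open>s\<close>-derivative of
      \<open>s * F j (q, s *\<^sub>R v)\<close>, and the factor \<open>s\<close> removes the lower
      limit.\<close>
    also have "\<dots> = 1 * F j (q, 1 *\<^sub>R v) - 0 * F j (q, 0 *\<^sub>R v)"
    proof (rule integral_unique, rule fundamental_theorem_of_calculus)
      fix s :: real assume s: "s \<in> {0..1}"
      have "((\<lambda>s. (q, s *\<^sub>R v)) has_derivative (\<lambda>t. (0, t *\<^sub>R v))) (at s)"
        by (auto intro!: derivative_eq_intros)
      from has_derivative_compose[OF this] have "((\<lambda>s. F j (q, s *\<^sub>R v)) has_derivative
          (\<lambda>t. frechet_derivative (F j) (at (q, s *\<^sub>R v)) (0, t *\<^sub>R v))) (at s)"
        using smooth_on_has_derivative[OF F inBC[OF s]] by blast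
      also have "(\<lambda>t. frechet_derivative (F j) (at (q, s *\<^sub>R v)) (0, t *\<^sub>R v)) =
          (\<lambda>t. t *\<^sub>R frechet_derivative (F j) (at (q, s *\<^sub>R v)) (0, v))"
      proof
        fix t
        have "(0, t *\<^sub>R v) = t *\<^sub>R (0 :: 'p, v)" by simp
        then show "frechet_derivative (F j) (at (q, s *\<^sub>R v)) (0, t *\<^sub>R v) =
            t *\<^sub>R frechet_derivative (F j) (at (q, s *\<^sub>R v)) (0, v)"
          using linear_scale[OF linear_frechet_derivative[OF dF[OF s]]] by metis
      qed
      finally have "((\<lambda>s. F j (q, s *\<^sub>R v)) has_vector_derivative
          frechet_derivative (F j) (at (q, s *\<^sub>R v)) (0, v)) (at s within {0..1})"
        by (auto simp: has_vector_derivative_def intro: has_derivative_at_withinI)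
      then show "((\<lambda>s. s * F j (q, s *\<^sub>R v)) has_vector_derivative
         F j (q, s *\<^sub>R v) + s * frechet_derivative (F j) (at (q, s *\<^sub>R v)) (0, v)) (at s within {0..1})"
        by (auto intro!: derivative_eq_intros simp: has_real_derivative_iff_has_vector_derivative[symmetric])
    qed simp
    finally show "frechet_derivative ?P (at z) (0, axis j 1) = F j z" by (simp add: qv)
  qed
qed

subsection \<open>Second-order fields in a chart\<close>

lemma frechet_derivative_tcoord:
  assumes "F differentiable (at z)"
  shows "frechet_derivative F (at z) (a, b) = (\<Sum>i\<in>UNIV. a $ i * dq i F z) + (\<Sum>i\<in>UNIV. b $ i * dv i F z)"
proof -
  interpret linear "frechet_derivative F (at z)"
    by (rule linear_frechet_derivative[OF assms])
  have "(a, b) = (\<Sum>i\<in>UNIV. a $ i *\<^sub>R (axis i 1, 0)) + (\<Sum>i\<in>UNIV. b $ i *\<^sub>R (0, axis i 1))"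
    using basis_expansion[of a] basis_expansion[of b]
    by (simp add: prod_eq_iff fst_sum snd_sum scalar_mult_eq_scaleR)
  then show ?thesis by (simp only: sum scale add) (simp add: dq_def dv_def)
qed

lemma SODE_frechet:
  assumes "F differentiable (at z)"
  shows "SODE f F z = frechet_derivative F (at z) (snd z, f z)"
  using frechet_derivative_tcoord[OF assms] by (simp add: SODE_def)

lemma dH_frechet:
  assumes "F differentiable (at z)"
  shows "dH f i F z = frechet_derivative F (at z) (axis i 1, - (\<chi> j. Gam f j i z))"
proof -
  have "(\<Sum>k\<in>UNIV. axis i 1 $ k * dq k F z) = dq i F z"
    by (simp add: axis_def if_distrib[of "\<lambda>x. x * _"] cong: if_cong)
  then show ?thesis
    using frechet_derivative_tcoord[OF assms] by (simp add: dH_def sum_negf)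
qed

lemma dv_nth: "F differentiable (at z) \<Longrightarrow> dv i (\<lambda>w. F w $ k) z = frechet_derivative F (at z) (0, axis i 1) $ k"
  unfolding dv_def by (rule frechet_derivative_linear_comp[OF bounded_linear_vec_nth])

lemma dq_nth: "F differentiable (at z) \<Longrightarrow> dq i (\<lambda>w. F w $ k) z = frechet_derivative F (at z) (axis i 1, 0) $ k"
  unfolding dq_def by (rule frechet_derivative_linear_comp[OF bounded_linear_vec_nth])

locale sode_chart =
  fixes B :: "(real ^ 'n::finite) set" and f :: "'n tcoord \<Rightarrow> real ^ 'n"
  assumes open_B: "open B" and smooth_f: "smooth_on (B \<times> UNIV) f"
begin

definition W where "W = B \<times> (UNIV :: (real ^ 'n) set)"

lemma open_W: "open W" unfolding W_def by (intro open_Times open_B open_UNIV)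

text \<open>Membership in \<open>C\<close> carries the differentiability side conditions of the
  calculus rules; \<open>C_intros\<close> discharges it for all expressions that occur.\<close>

definition C where "C = {F :: 'n tcoord \<Rightarrow> real. smooth_on W F}"

lemma C_differentiable: "F \<in> C \<Longrightarrow> z \<in> W \<Longrightarrow> F differentiable (at z)"
  by (simp add: C_def smooth_on_differentiable)

lemma C_dq: "F \<in> C \<Longrightarrow> dq i F \<in> C"
  using smooth_on_frechet_derivative by (simp add: C_def dq_def[abs_def])

lemma C_dv: "F \<in> C \<Longrightarrow> dv i F \<in> C"
  using smooth_on_frechet_derivative by (simp add: C_def dv_def[abs_def])

lemma C_mult: "F \<in> C \<Longrightarrow> G \<in> C \<Longrightarrow> (\<lambda>z. F z * G z) \<in> C"
  and C_add: "F \<in> C \<Longrightarrow> G \<in> C \<Longrightarrow> (\<lambda>z. F z + G z) \<in> C"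
  and C_diff: "F \<in> C \<Longrightarrow> G \<in> C \<Longrightarrow> (\<lambda>z. F z - G z) \<in> C"
  and C_const: "(\<lambda>z. c) \<in> C"
  by (auto simp: C_def intro: smooth_on_mult smooth_on_add smooth_on_diff smooth_on_const open_W)

lemma C_sum: "(\<And>i. i \<in> I \<Longrightarrow> F i \<in> C) \<Longrightarrow> (\<lambda>z. \<Sum>i\<in>I. F i z) \<in> C"
  by (simp add: C_def smooth_on_sum open_W)

lemma C_snd: "(\<lambda>z. snd z $ i) \<in> C"
  unfolding C_def
  using bounded_linear_compose[OF bounded_linear_vec_nth bounded_linear_snd]
  by (auto intro: smooth_on_bounded_linear)

lemma C_f: "(\<lambda>z. f z $ i) \<in> C"
  using smooth_on_nth[OF open_W] smooth_f by (simp add: C_def W_def)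

lemma C_Gam: "Gam f j i \<in> C"
proof -
  have "(\<lambda>z. - (1 / 2) * dv i (\<lambda>w. f w $ j) z) \<in> C"
    by (rule C_mult[OF C_const C_dv[OF C_f]])
  then show ?thesis by (simp add: Gam_def[abs_def])
qed

lemma C_SODE: "F \<in> C \<Longrightarrow> SODE f F \<in> C"
  unfolding SODE_def[abs_def] by (intro C_add C_sum C_mult C_dq C_dv C_snd C_f)

lemma C_dH: "F \<in> C \<Longrightarrow> dH f i F \<in> C"
  unfolding dH_def[abs_def] by (intro C_diff C_sum C_mult C_dq C_dv C_Gam)

lemmas C_intros = C_mult C_add C_diff C_const C_sum C_snd C_f C_Gam C_dq C_dv C_SODE C_dH

lemma dq_cong: "z \<in> W \<Longrightarrow> (\<And>w. w \<in> W \<Longrightarrow> F w = G w) \<Longrightarrow> dq i F z = dq i G z"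
  and dv_cong: "z \<in> W \<Longrightarrow> (\<And>w. w \<in> W \<Longrightarrow> F w = G w) \<Longrightarrow> dv i F z = dv i G z"
  unfolding dq_def dv_def by (simp_all only: frechet_derivative_cong_open[OF open_W, of z F G])

lemma SODE_cong: "z \<in> W \<Longrightarrow> (\<And>w. w \<in> W \<Longrightarrow> F w = G w) \<Longrightarrow> SODE f F z = SODE f G z"
  unfolding SODE_def using dq_cong[of z F G] dv_cong[of z F G] by simp

lemma dH_cong: "z \<in> W \<Longrightarrow> (\<And>w. w \<in> W \<Longrightarrow> F w = G w) \<Longrightarrow> dH f i F z = dH f i G z"
  unfolding dH_def using dq_cong[of z F G] dv_cong[of z F G] by simp

lemma dq_add: "z \<in> W \<Longrightarrow> F \<in> C \<Longrightarrow> G \<in> C \<Longrightarrow> dq i (\<lambda>z. F z + G z) z = dq i F z + dq i G z"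
  and dq_diff: "z \<in> W \<Longrightarrow> F \<in> C \<Longrightarrow> G \<in> C \<Longrightarrow> dq i (\<lambda>z. F z - G z) z = dq i F z - dq i G z"
  and dq_mult: "z \<in> W \<Longrightarrow> F \<in> C \<Longrightarrow> G \<in> C \<Longrightarrow> dq i (\<lambda>z. F z * G z) z = F z * dq i G z + dq i F z * G z"
  unfolding dq_def
  by (simp_all add: C_differentiable frechet_derivative_add_real frechet_derivative_diff_real
      frechet_derivative_mult_real)

lemma dv_add: "z \<in> W \<Longrightarrow> F \<in> C \<Longrightarrow> G \<in> C \<Longrightarrow> dv i (\<lambda>z. F z + G z) z = dv i F z + dv i G z"
  and dv_diff: "z \<in> W \<Longrightarrow> F \<in> C \<Longrightarrow> G \<in> C \<Longrightarrow> dv i (\<lambda>z. F z - G z) z = dv i F z - dv i G z"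
  and dv_mult: "z \<in> W \<Longrightarrow> F \<in> C \<Longrightarrow> G \<in> C \<Longrightarrow> dv i (\<lambda>z. F z * G z) z = F z * dv i G z + dv i F z * G z"
  unfolding dv_def
  by (simp_all add: C_differentiable frechet_derivative_add_real frechet_derivative_diff_real
      frechet_derivative_mult_real)

lemma dq_sum: "z \<in> W \<Longrightarrow> (\<And>k. F k \<in> C) \<Longrightarrow> dq i (\<lambda>z. \<Sum>k\<in>I. F k z) z = (\<Sum>k\<in>I. dq i (F k) z)"
  unfolding dq_def by (simp add: C_differentiable frechet_derivative_sum_real)

lemma dv_sum: "z \<in> W \<Longrightarrow> (\<And>k. F k \<in> C) \<Longrightarrow> dv i (\<lambda>z. \<Sum>k\<in>I. F k z) z = (\<Sum>k\<in>I. dv i (F k) z)"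
  unfolding dv_def by (simp add: C_differentiable frechet_derivative_sum_real)

lemma SODE_add: "z \<in> W \<Longrightarrow> F \<in> C \<Longrightarrow> G \<in> C \<Longrightarrow> SODE f (\<lambda>z. F z + G z) z = SODE f F z + SODE f G z"
  and SODE_diff: "z \<in> W \<Longrightarrow> F \<in> C \<Longrightarrow> G \<in> C \<Longrightarrow> SODE f (\<lambda>z. F z - G z) z = SODE f F z - SODE f G z"
  and SODE_mult: "z \<in> W \<Longrightarrow> F \<in> C \<Longrightarrow> G \<in> C \<Longrightarrow>
    SODE f (\<lambda>z. F z * G z) z = F z * SODE f G z + SODE f F z * G z"
  by (simp_all add: SODE_frechet C_differentiable C_add C_diff C_mult frechet_derivative_add_real
      frechet_derivative_diff_real frechet_derivative_mult_real)

lemma SODE_sum: "z \<in> W \<Longrightarrow> (\<And>k. F k \<in> C) \<Longrightarrow> SODE f (\<lambda>z. \<Sum>k\<in>I. F k z) z = (\<Sum>k\<in>I. SODE f (F k) z)"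
  by (simp add: SODE_frechet C_differentiable C_sum frechet_derivative_sum_real)

lemma dH_diff: "z \<in> W \<Longrightarrow> F \<in> C \<Longrightarrow> G \<in> C \<Longrightarrow> dH f i (\<lambda>z. F z - G z) z = dH f i F z - dH f i G z"
  by (simp add: dH_frechet C_differentiable C_diff frechet_derivative_diff_real)

lemma dv_dv: "z \<in> W \<Longrightarrow> F \<in> C \<Longrightarrow> dv i (dv j F) z = dv j (dv i F) z"
  and dv_dq: "z \<in> W \<Longrightarrow> F \<in> C \<Longrightarrow> dv i (dq j F) z = dq j (dv i F) z"
  and dq_dq: "z \<in> W \<Longrightarrow> F \<in> C \<Longrightarrow> dq i (dq j F) z = dq j (dq i F) z"
  unfolding dv_def[abs_def] dq_def[abs_def] C_def
  by (auto intro: frechet_derivative_commute[OF open_W])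

lemma smooth_field: "smooth_on W (\<lambda>z. (snd z, f z))"
  by (rule smooth_on_Pair[OF open_W smooth_on_bounded_linear[OF bounded_linear_snd]])
    (simp add: W_def smooth_f)

lemma smooth_horizontal: "smooth_on W (\<lambda>z. (axis i 1, - (\<chi> j. Gam f j i z)) :: 'n tcoord)"
proof -
  have "smooth_on W (\<lambda>z. (\<chi> j. Gam f j i z))"
    using C_Gam by (intro smooth_on_vec open_W) (auto simp: C_def)
  then show ?thesis by (intro smooth_on_Pair smooth_on_const smooth_on_minus open_W)
qed

lemma frechet_derivative_field:
  assumes z: "z \<in> W"
  shows "frechet_derivative (\<lambda>z. (snd z, f z)) (at z) u = (snd u, frechet_derivative f (at z) u)"
proof -
  have "f differentiable (at z)"
    using smooth_on_differentiable smooth_f z by (auto simp: W_def)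
  then have "(f has_derivative frechet_derivative f (at z)) (at z)"
    using frechet_derivative_works by blast
  from has_derivative_Pair[OF bounded_linear_imp_has_derivative[OF bounded_linear_snd] this]
  have "((\<lambda>z. (snd z, f z)) has_derivative (\<lambda>u. (snd u, frechet_derivative f (at z) u))) (at z)"
    .
  from frechet_derivative_at[OF this] show ?thesis by (metis (lifting))
qed

text \<open>The commutator of V_j with \<Gamma> is the coordinate field of q^j plus a vertical field
  with components V_j(f^k), and these equal -2 \<open>Gam f k j\<close>.\<close>

lemma dv_SODE:
  assumes z: "z \<in> W" and F: "F \<in> C"
  shows "dv j (SODE f F) z = SODE f (dv j F) z + dq j F z - 2 * (\<Sum>k\<in>UNIV. Gam f k j z * dv k F z)"
proof -
  let ?X = "\<lambda>z. (snd z, f z)"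
  have df: "f differentiable (at z)"
    using smooth_on_differentiable smooth_f z by (auto simp: W_def)
  have "dv j (SODE f F) z = dv j (\<lambda>w. frechet_derivative F (at w) (?X w)) z"
    by (rule dv_cong[OF z]) (simp add: SODE_frechet C_differentiable F)
  also have "\<dots> = frechet_derivative (\<lambda>w. frechet_derivative F (at w) (0, axis j 1)) (at z) (?X z) +
      frechet_derivative F (at z) (frechet_derivative ?X (at z) (0, axis j 1))"
    unfolding dv_def using F smooth_on_differentiable[OF smooth_field z]
    by (intro frechet_derivative_along_field[OF open_W z]) (auto simp: C_def)
  also have "\<dots> = SODE f (dv j F) z + frechet_derivative F (at z) (axis j 1, frechet_derivative f (at z) (0, axis j 1))"
    by (simp add: SODE_frechet C_differentiable C_dv F z frechet_derivative_field)
      (simp add: dv_def[abs_def])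
  also have "frechet_derivative F (at z) (axis j 1, frechet_derivative f (at z) (0, axis j 1)) =
      dq j F z + (\<Sum>k\<in>UNIV. dv j (\<lambda>w. f w $ k) z * dv k F z)"
    by (simp add: frechet_derivative_tcoord C_differentiable F z dv_nth df)
      (simp add: axis_def if_distrib[of "\<lambda>x. x * _"] cong: if_cong)
  finally show ?thesis by (simp add: Gam_def sum_distrib_left sum_negf)
qed

text \<open>The first component of \<open>(snd z, f z)\<close> does not depend on q, so this
  commutator is purely vertical.\<close>

lemma dq_SODE:
  assumes z: "z \<in> W" and F: "F \<in> C"
  shows "dq j (SODE f F) z = SODE f (dq j F) z + (\<Sum>k\<in>UNIV. dq j (\<lambda>w. f w $ k) z * dv k F z)"
proof -
  let ?X = "\<lambda>z. (snd z, f z)"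
  have df: "f differentiable (at z)"
    using smooth_on_differentiable smooth_f z by (auto simp: W_def)
  have "dq j (SODE f F) z = dq j (\<lambda>w. frechet_derivative F (at w) (?X w)) z"
    by (rule dq_cong[OF z]) (simp add: SODE_frechet C_differentiable F)
  also have "\<dots> = frechet_derivative (\<lambda>w. frechet_derivative F (at w) (axis j 1, 0)) (at z) (?X z) +
      frechet_derivative F (at z) (frechet_derivative ?X (at z) (axis j 1, 0))"
    unfolding dq_def using F smooth_on_differentiable[OF smooth_field z]
    by (intro frechet_derivative_along_field[OF open_W z]) (auto simp: C_def)
  also have "\<dots> = SODE f (dq j F) z + frechet_derivative F (at z) (0, frechet_derivative f (at z) (axis j 1, 0))"
    by (simp add: SODE_frechet C_differentiable C_dq F z frechet_derivative_field)
      (simp add: dq_def[abs_def])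
  also have "frechet_derivative F (at z) (0, frechet_derivative f (at z) (axis j 1, 0)) =
      (\<Sum>k\<in>UNIV. dq j (\<lambda>w. f w $ k) z * dv k F z)"
    by (simp add: frechet_derivative_tcoord C_differentiable F z dq_nth df)
  finally show ?thesis .
qed

text \<open>The curvature is the vertical part of the bracket of horizontal fields.\<close>

lemma dH_dH:
  assumes z: "z \<in> W" and F: "F \<in> C"
  shows "dH f i (dH f j F) z - dH f j (dH f i F) z = (\<Sum>l\<in>UNIV. Rc f l i j z * dv l F z)"
proof -
  let ?X = "\<lambda>i z. (axis i 1, - (\<chi> j. Gam f j i z)) :: 'n tcoord"
  note dX = smooth_on_differentiable[OF smooth_horizontal z]
  \<comment> \<open>The component \<open>axis i 1\<close> is constant, so the bracket of two
    horizontal fields has a vertical part only.\<close>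
  have DX: "frechet_derivative (?X i) (at z) (?X j z) = (0, - (\<chi> l. dH f j (Gam f l i) z))" for i j
  proof -
    have fst_lin: "frechet_derivative (\<lambda>w. fst (?X i w)) (at z) (?X j z) = fst (frechet_derivative (?X i) (at z) (?X j z))"
      by (rule frechet_derivative_linear_comp[OF bounded_linear_fst dX])
    have bl: "bounded_linear (\<lambda>w::'n tcoord. snd w $ l)" for l
      by (rule bounded_linear_compose[OF bounded_linear_vec_nth bounded_linear_snd])
    have "frechet_derivative (\<lambda>w. snd (?X i w) $ l) (at z) (?X j z) = snd (frechet_derivative (?X i) (at z) (?X j z)) $ l" for l
      by (rule frechet_derivative_linear_comp[OF bl dX])
    moreover have "frechet_derivative (\<lambda>w. snd (?X i w) $ l) (at z) (?X j z) = - dH f j (Gam f l i) z" for l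
      using frechet_derivative_linear_comp[OF bounded_linear_minus[OF bounded_linear_ident] C_differentiable[OF C_Gam z]]
      by (simp add: dH_frechet C_differentiable C_Gam z)
    ultimately show ?thesis using fst_lin by (simp add: prod_eq_iff vec_eq_iff)
  qed
  have "dH f i (dH f j F) z = frechet_derivative (\<lambda>w. frechet_derivative F (at w) (?X j w)) (at z) (?X i z)" for i j
  proof -
    have "dH f i (dH f j F) z = frechet_derivative (dH f j F) (at z) (?X i z)"
      by (simp add: dH_frechet C_differentiable C_dH F z)
    also have "\<dots> = frechet_derivative (\<lambda>w. frechet_derivative F (at w) (?X j w)) (at z) (?X i z)"
      using dH_frechet[OF C_differentiable[OF F]] by (subst frechet_derivative_cong_open[OF open_W z]) auto
    finally show ?thesis .
  qed
  then have "dH f i (dH f j F) z - dH f j (dH f i F) z =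
      frechet_derivative F (at z) (frechet_derivative (?X j) (at z) (?X i z) - frechet_derivative (?X i) (at z) (?X j z))"
    using frechet_derivative_bracket[OF open_W z _ dX[of i] dX[of j], of F] F by (simp add: C_def)
  also have "\<dots> = (\<Sum>l\<in>UNIV. Rc f l i j z * dv l F z)"
    unfolding DX by (simp add: frechet_derivative_tcoord C_differentiable F z Rc_def)
  finally show ?thesis .
qed

subsection \<open>The Euler--Lagrange expressions\<close>

definition EL where "EL L i z = SODE f (dv i L) z - dq i L z"

lemma C_EL: "L \<in> C \<Longrightarrow> EL L i \<in> C"
  unfolding EL_def[abs_def] by (intro C_intros)

lemma dv_EL:
  assumes z: "z \<in> W" and L: "L \<in> C"
  shows "dv j (EL L i) z = SODE f (dv j (dv i L)) z + dq j (dv i L) z - dq i (dv j L) z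
    - 2 * (\<Sum>k\<in>UNIV. Gam f k j z * dv k (dv i L) z)"
  unfolding EL_def[abs_def]
  using assms by (simp add: dv_diff dv_SODE dv_dq C_intros)

lemma dq_EL:
  assumes z: "z \<in> W" and L: "L \<in> C"
  shows "dq j (EL L i) z = SODE f (dq j (dv i L)) z + (\<Sum>k\<in>UNIV. dq j (\<lambda>w. f w $ k) z * dv k (dv i L) z)
    - dq j (dq i L) z"
  unfolding EL_def[abs_def]
  using assms by (simp add: dq_diff dq_SODE C_intros)

text \<open>The component form of \<nabla>g = 0. Taking \<open>g\<close> as a family of functions
  lets it apply both to iterated vertical derivatives of \<open>L\<close> and to the entries of a
  given matrix field.\<close>

definition nabla_free where
  "nabla_free g \<longleftrightarrow> (\<forall>z\<in>W. \<forall>i j. SODE f (g i j) z =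
     (\<Sum>k\<in>UNIV. Gam f k i z * g k j z) + (\<Sum>k\<in>UNIV. Gam f k j z * g i k z))"

lemma hess_sym: "z \<in> W \<Longrightarrow> L \<in> C \<Longrightarrow> dv i (dv j L) z = dv j (dv i L) z"
  by (rule dv_dv)

text \<open>In the sum of V_j E_i and V_i E_j the mixed derivatives of \<open>L\<close> cancel in
  pairs; what is left is twice the component form of \<nabla>g = 0.\<close>

lemma dv_EL_antisym_imp_nabla_free:
  assumes L: "L \<in> C" and anti: "\<And>z i j. z \<in> W \<Longrightarrow> dv j (EL L i) z = - dv i (EL L j) z"
  shows "nabla_free (\<lambda>i j. dv i (dv j L))"
  unfolding nabla_free_def
proof (intro ballI allI)
  fix z i j assume z: "z \<in> W"
  have s: "SODE f (dv j (dv i L)) z = SODE f (dv i (dv j L)) z"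
    by (rule SODE_cong[OF z]) (simp add: hess_sym L)
  have "dv i (dv k L) z = dv k (dv i L) z" for k using hess_sym[OF z L] .
  with anti[OF z, of j i] s show "SODE f (dv i (dv j L)) z =
     (\<Sum>k\<in>UNIV. Gam f k i z * dv k (dv j L) z) + (\<Sum>k\<in>UNIV. Gam f k j z * dv i (dv k L) z)"
    by (simp add: dv_EL z L)
qed

text \<open>Once \<Gamma>(g_ij) is replaced by connection terms, the surviving ones are exactly
  those that complete partial derivatives to horizontal ones. The result is visibly antisymmetric,
  which the converse direction exploits.\<close>

lemma dv_EL_nabla_free:
  assumes L: "L \<in> C" and nf: "nabla_free (\<lambda>i j. dv i (dv j L))" and z: "z \<in> W"
  shows "dv j (EL L i) z = dH f j (dv i L) z - dH f i (dv j L) z"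
proof -
  have s: "SODE f (dv j (dv i L)) z = SODE f (dv i (dv j L)) z"
    by (rule SODE_cong[OF z]) (simp add: hess_sym L)
  have h: "dv i (dv k L) z = dv k (dv i L) z" for k using hess_sym[OF z L] .
  have "SODE f (dv i (dv j L)) z =
     (\<Sum>k\<in>UNIV. Gam f k i z * dv k (dv j L) z) + (\<Sum>k\<in>UNIV. Gam f k j z * dv k (dv i L) z)"
    using nf z by (simp add: nabla_free_def h)
  then show ?thesis by (simp add: dv_EL z L s dH_def)
qed

end

section \<open>Euler-Lagrange expressions affine in the velocities\<close>

text \<open>The pointwise algebra of \<Phi>, with \<open>N\<close> the connection, \<open>DN\<close>
  and \<open>Dg\<close> the \<Gamma>-derivatives of connection and metric, and \<open>F\<close> the
  q-derivatives of \<open>f\<close>. Adding the \<Phi> term cancels all but a product of two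
  connection factors, which is symmetric in \<open>i\<close> and \<open>j\<close> when
  \<open>g\<close> is symmetric.\<close>

lemma jacobi_endomorphism_sum:
  fixes N DN F P g Dg :: "'n::finite \<Rightarrow> 'n \<Rightarrow> real"
  assumes P: "\<And>k i. P k i = - F k i - (\<Sum>l\<in>UNIV. N l i * N k l) - DN k i"
    and Dg: "\<And>k i. Dg k i = (\<Sum>l\<in>UNIV. N l k * g l i) + (\<Sum>l\<in>UNIV. N l i * g k l)"
  shows "(\<Sum>k\<in>UNIV. N k j * Dg k i + DN k j * g k i) + (\<Sum>k\<in>UNIV. F k j * g k i) + (\<Sum>k\<in>UNIV. P k j * g k i)
    = (\<Sum>k\<in>UNIV. \<Sum>l\<in>UNIV. N k j * N l i * g k l)"
proof -
  have "(\<Sum>k\<in>UNIV. \<Sum>l\<in>UNIV. N k j * N l k * g l i) = (\<Sum>k\<in>UNIV. \<Sum>l\<in>UNIV. N l j * N k l * g k i)"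
    by (rule sum.swap)
  then show ?thesis
    by (simp add: P Dg algebra_simps sum.distrib sum_subtractf sum_distrib_left sum_negf)
qed

context sode_chart
begin

lemma dv_snd: "dv j (\<lambda>z::'n tcoord. snd z $ k) z = (if j = k then 1 else 0)"
  and dq_snd: "dq j (\<lambda>z::'n tcoord. snd z $ k) z = 0"
proof -
  have "bounded_linear (\<lambda>w::'n tcoord. snd w $ k)"
    by (rule bounded_linear_compose[OF bounded_linear_vec_nth bounded_linear_snd])
  from frechet_derivative_at[OF bounded_linear_imp_has_derivative[OF this], symmetric]
  show "dv j (\<lambda>z::'n tcoord. snd z $ k) z = (if j = k then 1 else 0)" "dq j (\<lambda>z::'n tcoord. snd z $ k) z = 0"
    unfolding dv_def dq_def by (auto simp: axis_def)
qed

text \<open>Here \<open>s\<close> and \<open>c\<close> are functions of the base point only; \<open>s\<close> gives the gyroscopic force and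
  \<open>c\<close> is a remaining force which the converse direction absorbs into \<open>L\<close>.\<close>

lemma
  assumes L: "L \<in> C" and s: "\<And>k i. s k i \<in> C" and c: "\<And>i. c i \<in> C"
    and anti: "\<And>z k i. z \<in> W \<Longrightarrow> s k i z = - s i k z"
    and sv: "\<And>z j k i. z \<in> W \<Longrightarrow> dv j (s k i) z = 0"
    and cv: "\<And>z j i. z \<in> W \<Longrightarrow> dv j (c i) z = 0"
    and EL: "\<And>z i. z \<in> W \<Longrightarrow> EL L i z = (\<Sum>k\<in>UNIV. s k i z * snd z $ k) + c i z"
  shows gyroscopic_EL_nabla_free: "nabla_free (\<lambda>i j. dv i (dv j L))" (is ?nf)
    and gyroscopic_EL_jacobi: "z \<in> W \<Longrightarrow>
      (\<Sum>k\<in>UNIV. Phi f k i z * dv k (dv j L) z) - (\<Sum>k\<in>UNIV. Phi f k j z * dv k (dv i L) z) =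
      (\<Sum>k\<in>UNIV. snd z $ k * ((\<Sum>l\<in>UNIV. Rc f l i j z * dv l (dv k L) z) +
         (\<Sum>l\<in>UNIV. Rc f l j k z * dv l (dv i L) z) + (\<Sum>l\<in>UNIV. Rc f l k i z * dv l (dv j L) z))) +
      dq j (c i) z - dq i (c j) z" (is "_ \<Longrightarrow> ?jac")
proof -
  have dvE: "dv j (EL L i) z = s j i z" if z: "z \<in> W" for i j z
  proof -
    have "dv j (EL L i) z = dv j (\<lambda>z. (\<Sum>k\<in>UNIV. s k i z * snd z $ k) + c i z) z"
      by (rule dv_cong[OF z EL])
    also have "\<dots> = (\<Sum>k\<in>UNIV. s k i z * (if j = k then 1 else 0))"
      by (simp add: dv_add dv_sum dv_mult z s c sv cv dv_snd C_intros)
    finally show ?thesis by (simp add: if_distrib[of "\<lambda>x. _ * x"] cong: if_cong)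
  qed
  have dqE: "dq j (EL L i) z = (\<Sum>k\<in>UNIV. dq j (s k i) z * snd z $ k) + dq j (c i) z"
    if z: "z \<in> W" for i j z
  proof -
    have "dq j (EL L i) z = dq j (\<lambda>z. (\<Sum>k\<in>UNIV. s k i z * snd z $ k) + c i z) z"
      by (rule dq_cong[OF z EL])
    then show ?thesis
      by (simp add: dq_add dq_sum dq_mult z s c dq_snd C_intros)
  qed
  show nf: ?nf
  proof (rule dv_EL_antisym_imp_nabla_free[OF L])
    show "dv j (EL L i) z = - dv i (EL L j) z" if "z \<in> W" for z i j
      using dvE[OF that] anti[OF that, of j i] by simp
  qed
  have curl: "dH f j (dv i L) z - dH f i (dv j L) z = s j i z" if z: "z \<in> W" for i j z
    using dv_EL_nabla_free[OF L nf z] dvE[OF z] by simp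
  show ?jac if z: "z \<in> W"
  proof -
    let ?g = "\<lambda>i j. dv i (dv j L) z"
    have g_sym: "?g i j = ?g j i" for i j by (rule hess_sym[OF z L])
    \<comment> \<open>\<open>s\<close> has no vertical derivative, so its horizontal and coordinate
      derivatives coincide.\<close>
    have dHs: "dH f k (s i j) z = dq k (s i j) z" for i j k
      by (simp add: dH_def sv z)
    have dHcurl: "dH f k (dH f j (dv i L)) z - dH f k (dH f i (dv j L)) z = dq k (s j i) z" for i j k
    proof -
      have "dH f k (dH f j (dv i L)) z - dH f k (dH f i (dv j L)) z =
          dH f k (\<lambda>z. dH f j (dv i L) z - dH f i (dv j L) z) z"
        by (simp add: dH_diff z L C_intros)
      also have "\<dots> = dH f k (s j i) z" by (rule dH_cong[OF z curl])
      finally show ?thesis by (simp add: dHs)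
    qed
    have Rc_anti: "Rc f l j i z = - Rc f l i j z" for l i j by (simp add: Rc_def)
    \<comment> \<open>The six terms of the cyclic sum of \<open>dHcurl\<close> are regrouped by
      their innermost vertical derivative; each pair is a commutator of horizontal derivatives,
      hence a curvature term by \<open>dH_dH\<close>.\<close>
    have bianchi: "(\<Sum>l\<in>UNIV. Rc f l i j z * ?g l k) + (\<Sum>l\<in>UNIV. Rc f l j k z * ?g l i) +
        (\<Sum>l\<in>UNIV. Rc f l k i z * ?g l j) = - dq k (s j i) z - dq j (s i k) z - dq i (s k j) z" for k
      using dHcurl[of k j i] dHcurl[of j i k] dHcurl[of i k j]
        dH_dH[OF z C_dv[OF L], of j k i] dH_dH[OF z C_dv[OF L], of i j k] dH_dH[OF z C_dv[OF L], of k i j]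
      by linarith
    have dq_anti: "dq k (s i j) z = - dq k (s j i) z" for i j k
    proof -
      have "dq k (s i j) z = dq k (\<lambda>z. (-1) * s j i z) z"
        by (rule dq_cong[OF z]) (simp add: anti[of _ i j])
      also have "\<dots> = - dq k (s j i) z"
        using dq_mult[OF z C_const s, of k "-1" j i] dq_diff[OF z C_const C_const, of k 0 1]
        by (simp add: dq_def)
      finally show ?thesis .
    qed
    have curl': "dq j (dv i L) w - dq i (dv j L) w = s j i w + ((\<Sum>k\<in>UNIV. Gam f k j w * dv k (dv i L) w) -
        (\<Sum>k\<in>UNIV. Gam f k i w * dv k (dv j L) w))" if "w \<in> W" for w
      using curl[OF that, of j i] by (simp add: dH_def)
    define Dg where "Dg i j = SODE f (dv i (dv j L)) z" for i j
    have Dg: "Dg k i = (\<Sum>l\<in>UNIV. Gam f l k z * ?g l i) + (\<Sum>l\<in>UNIV. Gam f l i z * ?g k l)" for k i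
      using nf z by (simp add: nabla_free_def Dg_def)
    \<comment> \<open>\<open>Q\<close> is what survives in \<open>jacobi_endomorphism_sum\<close>.
      Being symmetric, it drops out of the antisymmetrised equation.\<close>
    define Q where "Q i j = (\<Sum>k\<in>UNIV. \<Sum>l\<in>UNIV. Gam f k j z * Gam f l i z * ?g k l)" for i j
    have Q: "(\<Sum>k\<in>UNIV. Gam f k j z * Dg k i + SODE f (Gam f k j) z * ?g k i) +
        (\<Sum>k\<in>UNIV. dq j (\<lambda>w. f w $ k) z * ?g k i) + (\<Sum>k\<in>UNIV. Phi f k j z * ?g k i) = Q i j" for i j
      unfolding Q_def
      by (rule jacobi_endomorphism_sum[where N = "\<lambda>k i. Gam f k i z"]) (auto simp: Phi_def Dg)
    have Q_sym: "Q i j = Q j i"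
      unfolding Q_def by (subst sum.swap) (simp add: g_sym mult.commute mult.left_commute)
    \<comment> \<open>The terms \<Gamma>(dq_j V_i L) are not known separately, but their
      antisymmetrisation is \<Gamma> of the curl identity \<open>curl'\<close>, which involves only
      \<open>s\<close>, the connection and the Hessian.\<close>
    have "SODE f (dq j (dv i L)) z - SODE f (dq i (dv j L)) z = SODE f (\<lambda>w. dq j (dv i L) w - dq i (dv j L) w) z"
      by (simp add: SODE_diff z L C_intros)
    also have "\<dots> = SODE f (\<lambda>w. s j i w + ((\<Sum>k\<in>UNIV. Gam f k j w * dv k (dv i L) w) -
        (\<Sum>k\<in>UNIV. Gam f k i w * dv k (dv j L) w))) z"
      by (rule SODE_cong[OF z curl'])
    also have "\<dots> = SODE f (s j i) z + ((\<Sum>k\<in>UNIV. Gam f k j z * Dg k i + SODE f (Gam f k j) z * ?g k i) -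
        (\<Sum>k\<in>UNIV. Gam f k i z * Dg k j + SODE f (Gam f k i) z * ?g k j))"
      by (simp add: SODE_add SODE_diff SODE_sum SODE_mult z L s C_intros Dg_def)
    also have "SODE f (s j i) z = (\<Sum>k\<in>UNIV. snd z $ k * dq k (s j i) z)"
      by (simp add: SODE_def sv z)
    finally have main: "SODE f (dq j (dv i L)) z - SODE f (dq i (dv j L)) z =
      (\<Sum>k\<in>UNIV. snd z $ k * dq k (s j i) z) +
      ((\<Sum>k\<in>UNIV. Gam f k j z * Dg k i + SODE f (Gam f k j) z * ?g k i) -
        (\<Sum>k\<in>UNIV. Gam f k i z * Dg k j + SODE f (Gam f k i) z * ?g k j))" .
    \<comment> \<open>Subtracting the two instances of \<open>dq_EL\<close> cancels the second
      q-derivatives of \<open>L\<close>; \<open>main\<close> and the symmetry of \<open>Q\<close>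
      eliminate the remaining connection terms.\<close>
    have "(\<Sum>k\<in>UNIV. Phi f k i z * ?g k j) - (\<Sum>k\<in>UNIV. Phi f k j z * ?g k i) =
       (\<Sum>k\<in>UNIV. dq j (s k i) z * snd z $ k) + dq j (c i) z
       - ((\<Sum>k\<in>UNIV. dq i (s k j) z * snd z $ k) + dq i (c j) z)
       - (\<Sum>k\<in>UNIV. snd z $ k * dq k (s j i) z)"
      using dq_EL[OF z L, of j i] dq_EL[OF z L, of i j] dqE[OF z, of j i] dqE[OF z, of i j]
        Q[of j i] Q[of i j] Q_sym main dq_dq[OF z L, of i j]
      by linarith
    also have "\<dots> = (\<Sum>k\<in>UNIV. snd z $ k * (- dq k (s j i) z - dq j (s i k) z - dq i (s k j) z))
        + dq j (c i) z - dq i (c j) z"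
      by (simp add: dq_anti[of j i] algebra_simps sum_subtractf sum.distrib sum_negf)
    finally show ?thesis unfolding bianchi .
  qed
qed

end

definition hess_mat :: "('n::finite tcoord \<Rightarrow> real) \<Rightarrow> 'n tcoord \<Rightarrow> real ^ 'n ^ 'n" where
  "hess_mat L z = (\<chi> i j. dv i (dv j L) z)"

subsection \<open>Curves\<close>

text \<open>The acceleration \<open>a\<close> stays arbitrary, because it must be compared with
  \<open>f\<close> along curves not yet known to be solutions.\<close>

lemma velocity_chain:
  assumes "\<gamma> differentiable (at t)" "(velocity \<gamma> has_vector_derivative a) (at t)"
    and F: "F differentiable (at (\<gamma> t, velocity \<gamma> t))"
  shows "((\<lambda>s. F (\<gamma> s, velocity \<gamma> s)) has_real_derivative
    frechet_derivative F (at (\<gamma> t, velocity \<gamma> t)) (velocity \<gamma> t, a)) (at t)"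
proof -
  let ?D = "frechet_derivative F (at (\<gamma> t, velocity \<gamma> t))"
  have "(\<gamma> has_vector_derivative velocity \<gamma> t) (at t)"
    using assms(1) by (simp add: velocity_def vector_derivative_works)
  then have "((\<lambda>s. (\<gamma> s, velocity \<gamma> s)) has_derivative (\<lambda>r. (r *\<^sub>R velocity \<gamma> t, r *\<^sub>R a))) (at t)"
    using assms(2) by (auto simp: has_vector_derivative_def intro: has_derivative_Pair)
  from has_derivative_compose[OF this, of F ?D]
  have "((\<lambda>s. F (\<gamma> s, velocity \<gamma> s)) has_derivative (\<lambda>r. ?D (r *\<^sub>R velocity \<gamma> t, r *\<^sub>R a))) (at t)"
    using F frechet_derivative_works by blast
  moreover have "?D (r *\<^sub>R velocity \<gamma> t, r *\<^sub>R a) = ?D (velocity \<gamma> t, a) * r" for r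
    using linear_scale[OF linear_frechet_derivative[OF F], of r "(velocity \<gamma> t, a)"]
    by (simp add: mult.commute)
  ultimately show ?thesis by (simp add: has_field_derivative_def)
qed

context sode_chart
begin

text \<open>Subtracting the identity \<open>EL\<close> from the curve equation leaves the Hessian
  applied to the difference between the actual acceleration and \<open>f\<close>. Invertibility of
  the Hessian makes that difference vanish.\<close>

lemma solves_gyroscopic_iff:
  assumes L: "L \<in> C" and reg: "\<And>z. z \<in> W \<Longrightarrow> invertible (hess_mat L z)"
    and EL: "\<And>z i. z \<in> W \<Longrightarrow> EL L i z = (\<Sum>k\<in>UNIV. \<omega> (fst z) $ k $ i * snd z $ k)"
  shows "solves_gyroscopic L \<omega> B J \<gamma> \<longleftrightarrow> solves_second_order f B J \<gamma>"
proof -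
  have "(\<forall>i. \<exists>p'. ((\<lambda>s. dv i L (\<gamma> s, velocity \<gamma> s)) has_real_derivative p') (at t) \<and>
        p' - dq i L (\<gamma> t, velocity \<gamma> t) = (\<Sum>k\<in>UNIV. \<omega> (\<gamma> t) $ k $ i * velocity \<gamma> t $ k)) \<longleftrightarrow>
      (velocity \<gamma> has_vector_derivative f (\<gamma> t, velocity \<gamma> t)) (at t)" (is "?l \<longleftrightarrow> ?r")
    if tc: "twice_differentiable_curve B J \<gamma>" and t: "t \<in> J" for t
  proof -
    let ?z = "(\<gamma> t, velocity \<gamma> t)"
    have z: "?z \<in> W" and d1: "\<gamma> differentiable (at t)" and "velocity \<gamma> differentiable (at t)"
      using tc t by (auto simp: twice_differentiable_curve_def W_def)
    then obtain a where a: "(velocity \<gamma> has_vector_derivative a) (at t)"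
      using vector_derivative_works by blast
    have dL: "dv i L differentiable (at ?z)" for i using C_differentiable[OF C_dv[OF L] z] .
    note der = velocity_chain[OF d1 a dL]
    have EL': "frechet_derivative (dv i L) (at ?z) (velocity \<gamma> t, a) - dq i L ?z -
       (\<Sum>k\<in>UNIV. \<omega> (\<gamma> t) $ k $ i * velocity \<gamma> t $ k) = (hess_mat L ?z *v (a - f ?z)) $ i" for i
    proof -
      have "frechet_derivative (dv i L) (at ?z) (velocity \<gamma> t, a) - SODE f (dv i L) ?z =
          (\<Sum>k\<in>UNIV. (a - f ?z) $ k * dv k (dv i L) ?z)"
        by (simp add: frechet_derivative_tcoord[OF dL] SODE_def algebra_simps sum_subtractf)
      also have "\<dots> = (hess_mat L ?z *v (a - f ?z)) $ i"
        unfolding hess_mat_def matrix_vector_mult_def using hess_sym[OF z L]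
        by (simp add: mult.commute cong: sum.cong)
      finally show ?thesis using EL[OF z, of i] by (simp add: EL_def)
    qed
    have "?l \<longleftrightarrow> (\<forall>i. (hess_mat L ?z *v (a - f ?z)) $ i = 0)"
    proof (intro iff_allI)
      fix i
      show "(\<exists>p'. ((\<lambda>s. dv i L (\<gamma> s, velocity \<gamma> s)) has_real_derivative p') (at t) \<and>
        p' - dq i L (\<gamma> t, velocity \<gamma> t) = (\<Sum>k\<in>UNIV. \<omega> (\<gamma> t) $ k $ i * velocity \<gamma> t $ k)) \<longleftrightarrow>
        (hess_mat L ?z *v (a - f ?z)) $ i = 0"
        (is "(\<exists>p'. ?d p' \<and> p' - ?b = ?c) \<longleftrightarrow> _")
      proof
        assume "\<exists>p'. ?d p' \<and> p' - ?b = ?c"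
        then obtain p' where p': "?d p'" "p' - ?b = ?c" by blast
        then show "(hess_mat L ?z *v (a - f ?z)) $ i = 0"
          using EL'[of i] DERIV_unique[OF der[of i] p'(1)] by simp
      next
        assume "(hess_mat L ?z *v (a - f ?z)) $ i = 0"
        then have "frechet_derivative (dv i L) (at ?z) (velocity \<gamma> t, a) - ?b = ?c"
          using EL'[of i] by simp
        then show "\<exists>p'. ?d p' \<and> p' - ?b = ?c" using der[of i] by blast
      qed
    qed
    also have "\<dots> \<longleftrightarrow> hess_mat L ?z *v (a - f ?z) = 0" by (simp add: vec_eq_iff)
    also have "\<dots> \<longleftrightarrow> a = f ?z"
    proof
      assume "hess_mat L ?z *v (a - f ?z) = 0"
      moreover obtain N where "N ** hess_mat L ?z = mat 1"
        using reg[OF z] unfolding invertible_def by blast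
      ultimately have "a - f ?z = 0"
        by (metis matrix_vector_mul_assoc matrix_vector_mul_lid matrix_vector_mult_0_right)
      then show "a = f ?z" by simp
    qed simp
    also have "\<dots> \<longleftrightarrow> ?r"
      using a vector_derivative_unique_at by blast
    finally show ?thesis .
  qed
  then show ?thesis
    unfolding solves_gyroscopic_def solves_second_order_def by blast
qed

lemma EL_of_equivalence:
  assumes L: "L \<in> C" and z: "z \<in> W"
    and eq: "\<And>J \<gamma>. open J \<Longrightarrow> is_interval J \<Longrightarrow>
       solves_gyroscopic L \<omega> B J \<gamma> \<longleftrightarrow> solves_second_order f B J \<gamma>"
  shows "EL L i z = (\<Sum>k\<in>UNIV. \<omega> (fst z) $ k $ i * snd z $ k)"
proof -
  obtain h u where h: "h > 0" and u0: "u 0 = z"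
    and u: "\<And>t. -h < t \<Longrightarrow> t < h \<Longrightarrow> u t \<in> W \<and> (u has_vector_derivative (snd (u t), f (u t))) (at t)"
    using local_ode_solution[OF open_W z smooth_field] by metis
  define J where "J = {-h<..<h}"
  have oJ: "open J" and iJ: "is_interval J" by (auto simp: J_def)
  have u1: "u t \<in> W" "(u has_vector_derivative (snd (u t), f (u t))) (at t)" if "t \<in> J" for t
    using u that by (auto simp: J_def)
  \<comment> \<open>An integral curve of a second-order field is the lift of its projection, so
    \<open>velocity \<gamma>\<close> recovers the second component of \<open>u\<close>.\<close>
  define \<gamma> where "\<gamma> t = fst (u t)" for t
  have dg: "(\<gamma> has_vector_derivative snd (u t)) (at t)" if "t \<in> J" for t
    using bounded_linear.has_vector_derivative[OF bounded_linear_fst u1(2)[OF that]]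
    by (simp add: \<gamma>_def[abs_def])
  have vel: "velocity \<gamma> t = snd (u t)" if "t \<in> J" for t
    using dg[OF that] by (simp add: velocity_def vector_derivative_at)
  have dsnd: "((\<lambda>t. snd (u t)) has_vector_derivative f (u t)) (at t)" if "t \<in> J" for t
    using bounded_linear.has_vector_derivative[OF bounded_linear_snd u1(2)[OF that]] by simp
  \<comment> \<open>\<open>velocity \<gamma>\<close> agrees with the second component of
    \<open>u\<close> on \<open>J\<close> only; since \<open>J\<close> is open, that suffices for the
    derivative.\<close>
  have dvel: "(velocity \<gamma> has_vector_derivative f (u t)) (at t)" if "t \<in> J" for t
    by (rule has_vector_derivative_transform_within_open[OF dsnd[OF that] oJ that]) (simp add: vel)
  have uz: "u t = (\<gamma> t, velocity \<gamma> t)" if "t \<in> J" for t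
    by (simp add: \<gamma>_def vel that)
  have "\<gamma> t \<in> B" if "t \<in> J" for t using u1(1)[OF that] by (auto simp: W_def \<gamma>_def)
  then have "solves_second_order f B J \<gamma>"
    unfolding solves_second_order_def twice_differentiable_curve_def
    using dg dvel uz differentiableI_vector by metis
  then have "solves_gyroscopic L \<omega> B J \<gamma>" using eq[OF oJ iJ] by simp
  have t0: "0 \<in> J" using h by (simp add: J_def)
  have z0: "(\<gamma> 0, velocity \<gamma> 0) = z" using uz[OF t0] u0 by simp
  have "\<exists>p'. ((\<lambda>s. dv i L (\<gamma> s, velocity \<gamma> s)) has_real_derivative p') (at 0) \<and>
    p' - dq i L (\<gamma> 0, velocity \<gamma> 0) = (\<Sum>k\<in>UNIV. \<omega> (\<gamma> 0) $ k $ i * velocity \<gamma> 0 $ k)"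
    using \<open>solves_gyroscopic L \<omega> B J \<gamma>\<close> t0 unfolding solves_gyroscopic_def by blast
  then have "\<exists>p'. ((\<lambda>s. dv i L (\<gamma> s, velocity \<gamma> s)) has_real_derivative p') (at 0) \<and>
    p' - dq i L z = (\<Sum>k\<in>UNIV. \<omega> (\<gamma> 0) $ k $ i * velocity \<gamma> 0 $ k)"
    unfolding z0 .
  then obtain p' where p': "((\<lambda>s. dv i L (\<gamma> s, velocity \<gamma> s)) has_real_derivative p') (at 0)"
    "p' - dq i L z = (\<Sum>k\<in>UNIV. \<omega> (\<gamma> 0) $ k $ i * velocity \<gamma> 0 $ k)"
    by blast
  have "((\<lambda>s. dv i L (\<gamma> s, velocity \<gamma> s)) has_real_derivative
      frechet_derivative (dv i L) (at z) (velocity \<gamma> 0, f z)) (at 0)"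
    using velocity_chain[OF differentiableI_vector[OF dg[OF t0]] dvel[OF t0], of "dv i L"]
      C_differentiable[OF C_dv[OF L] z] by (simp add: z0 u0)
  from DERIV_unique[OF p'(1) this]
  have "p' = frechet_derivative (dv i L) (at z) (velocity \<gamma> 0, f z)" .
  also have "\<dots> = SODE f (dv i L) z"
    using SODE_frechet[OF C_differentiable[OF C_dv[OF L] z]] z0 by (metis snd_conv)
  finally show ?thesis using p'(2) z0 by (auto simp: EL_def)
qed

end

subsection \<open>Tensorial conditions in components\<close>

lemma sum_axis: "(\<Sum>k\<in>UNIV. F k * axis j 1 $ k) = (F j :: real)"
  by (simp add: axis_def if_distrib[of "\<lambda>x. _ * x"] cong: if_cong)

lemma sum_axis': "(\<Sum>k\<in>UNIV. axis j 1 $ k * F k) = (F j :: real)"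
  using sum_axis[of F j] by (simp add: mult.commute)

lemma bil_axis_right: "bil M x (axis j 1) = (\<Sum>k\<in>UNIV. x $ k * M $ k $ j)"
  by (simp add: bil_def sum_axis' mult.commute)

lemma bil_axis: "bil M (axis i 1) (axis j 1) = M $ i $ j"
  by (simp add: bil_axis_right sum_axis')

lemma bil_axis_left: "bil M (axis i 1) y = (\<Sum>k\<in>UNIV. y $ k * M $ i $ k)"
proof -
  have "bil M (axis i 1) y = (\<Sum>k\<in>UNIV. if k = i then \<Sum>j\<in>UNIV. M $ k $ j * y $ j else 0)"
    unfolding bil_def by (intro sum.cong refl) (auto simp: axis_def)
  then show ?thesis by (simp add: mult.commute)
qed

lemma bilinear_bil: "bilinear (bil M)"
  unfolding bilinear_def linear_iff bil_def
  by (simp add: algebra_simps sum.distrib sum_distrib_left)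

text \<open>The standard reduction to coordinate vector fields below: the difference of two tensor
  expressions is bilinear and is tested on \<open>axis\<close> vectors.\<close>

lemma bilinear_eq_zero_axis:
  fixes h :: "real ^ 'n::finite \<Rightarrow> real ^ 'n \<Rightarrow> real"
  assumes "bilinear h" "\<And>i j. h (axis i 1) (axis j 1) = 0"
  shows "h x y = 0"
proof -
  have "bilinear (\<lambda>(x::real ^ 'n) (y::real ^ 'n). 0 :: real)"
    by (simp add: bilinear_def linear_iff)
  then have "h = (\<lambda>x y. 0)"
    using assms by (rule_tac bilinear_eq_stdbasis) (auto simp: Basis_vec_def)
  then show ?thesis by simp
qed

lemma bil_contract_left:
  "bil M (\<chi> i. \<Sum>j\<in>UNIV. N i j * x $ j) y = bil (\<chi> a b. \<Sum>k\<in>UNIV. N k a * M $ k $ b) x y"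
proof -
  have "bilinear (\<lambda>x y. bil M (\<chi> i. \<Sum>j\<in>UNIV. N i j * x $ j) y - bil (\<chi> a b. \<Sum>k\<in>UNIV. N k a * M $ k $ b) x y)"
    unfolding bilinear_def linear_iff bil_def
    by (simp add: algebra_simps sum.distrib sum_distrib_left)
  from bilinear_eq_zero_axis[OF this, of x y] show ?thesis
    unfolding bil_axis sum_axis by (simp add: bil_axis_right)
qed

lemma bil_contract_right:
  "bil M x (\<chi> i. \<Sum>j\<in>UNIV. N i j * y $ j) = bil (\<chi> a b. \<Sum>k\<in>UNIV. N k b * M $ a $ k) x y"
proof -
  have "bilinear (\<lambda>x y. bil M x (\<chi> i. \<Sum>j\<in>UNIV. N i j * y $ j) - bil (\<chi> a b. \<Sum>k\<in>UNIV. N k b * M $ a $ k) x y)"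
    unfolding bilinear_def linear_iff bil_def
    by (simp add: algebra_simps sum.distrib sum_distrib_left)
  from bilinear_eq_zero_axis[OF this, of x y] show ?thesis
    unfolding bil_axis sum_axis by (simp add: bil_axis_left)
qed

context sode_chart
begin

lemma C_component: "vfield_along B X \<Longrightarrow> (\<lambda>z. X z $ i) \<in> C"
  using smooth_on_nth[OF open_W, of X i] by (simp add: C_def W_def)

text \<open>\<open>D\<close> is a derivation followed by evaluation at the fixed point
  \<open>z\<close>; the instances are \<open>DV_fun X\<close> and \<open>SODE f\<close>.\<close>

lemma derivation_app2:
  assumes mult: "\<And>F G. F \<in> C \<Longrightarrow> G \<in> C \<Longrightarrow> D (\<lambda>z. F z * G z) = F z * D G + D F * G z"
    and sum: "\<And>F. (\<And>k::'n. F k \<in> C) \<Longrightarrow> D (\<lambda>z. \<Sum>k\<in>UNIV. F k z) = (\<Sum>k\<in>UNIV. D (F k))"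
    and g: "\<And>a b. (\<lambda>w. g w $ a $ b) \<in> C" and X: "vfield_along B X" and Y: "vfield_along B Y"
  shows "D (app2 g X Y) = bil (\<chi> a b. D (\<lambda>w. g w $ a $ b)) (X z) (Y z)
    + bil (g z) (\<chi> a. D (\<lambda>w. X w $ a)) (Y z) + bil (g z) (X z) (\<chi> a. D (\<lambda>w. Y w $ a))"
proof -
  have "app2 g X Y = (\<lambda>z. \<Sum>a\<in>UNIV. \<Sum>b\<in>UNIV. g z $ a $ b * X z $ a * Y z $ b)"
    by (simp add: app2_def[abs_def] bil_def fun_eq_iff)
  then have "D (app2 g X Y) = (\<Sum>a\<in>UNIV. \<Sum>b\<in>UNIV. D (\<lambda>z. g z $ a $ b * X z $ a * Y z $ b))"
    using C_component[OF X] C_component[OF Y] by (simp add: sum g C_intros)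
  also have "\<dots> = (\<Sum>a\<in>UNIV. \<Sum>b\<in>UNIV. D (\<lambda>w. g w $ a $ b) * X z $ a * Y z $ b +
      g z $ a $ b * D (\<lambda>w. X w $ a) * Y z $ b + g z $ a $ b * X z $ a * D (\<lambda>w. Y w $ b))"
    using C_component[OF X] C_component[OF Y] by (simp add: mult g C_intros algebra_simps)
  finally show ?thesis by (simp add: bil_def sum.distrib)
qed

text \<open>The Leibniz corrections in \<open>DV_tensor\<close> cancel every derivative of
  \<open>Y\<close> and \<open>Z\<close>, so only values of the fields at \<open>z\<close>
  remain.\<close>

lemma DV_tensor_components:
  assumes z: "z \<in> W" and g: "\<And>a b. (\<lambda>w. g w $ a $ b) \<in> C"
    and Y: "vfield_along B Y" and Z: "vfield_along B Z"
  shows "DV_tensor g X Y Z z =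
    (\<Sum>i\<in>UNIV. \<Sum>a\<in>UNIV. \<Sum>b\<in>UNIV. X z $ i * dv i (\<lambda>w. g w $ a $ b) z * Y z $ a * Z z $ b)"
proof -
  have "DV_fun X (app2 g Y Z) z = bil (\<chi> a b. DV_fun X (\<lambda>w. g w $ a $ b) z) (Y z) (Z z)
    + bil (g z) (\<chi> a. DV_fun X (\<lambda>w. Y w $ a) z) (Z z) + bil (g z) (Y z) (\<chi> a. DV_fun X (\<lambda>w. Z w $ a) z)"
  proof (rule derivation_app2[OF _ _ g Y Z])
    show "DV_fun X (\<lambda>z. F z * G z) z = F z * DV_fun X G z + DV_fun X F z * G z"
      if "F \<in> C" "G \<in> C" for F G
      using that z by (simp add: DV_fun_def dv_mult algebra_simps sum.distrib sum_distrib_left)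
    show "DV_fun X (\<lambda>z. \<Sum>k\<in>UNIV. F k z) z = (\<Sum>k\<in>UNIV. DV_fun X (F k) z)"
      if "\<And>k::'n. F k \<in> C" for F
      using that z sum.swap[of "\<lambda>i k. X z $ i * dv i (F k) z" UNIV UNIV]
      by (simp add: DV_fun_def dv_sum sum_distrib_left)
  qed
  then have "DV_tensor g X Y Z z = bil (\<chi> a b. DV_fun X (\<lambda>w. g w $ a $ b) z) (Y z) (Z z)"
    by (simp add: DV_tensor_def app2_def DV_vec_def)
  also have "\<dots> = (\<Sum>a\<in>UNIV. \<Sum>b\<in>UNIV. \<Sum>i\<in>UNIV. X z $ i * dv i (\<lambda>w. g w $ a $ b) z * Y z $ a * Z z $ b)"
    by (simp add: bil_def DV_fun_def sum_distrib_right)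
  also have "\<dots> = (\<Sum>a\<in>UNIV. \<Sum>i\<in>UNIV. \<Sum>b\<in>UNIV. X z $ i * dv i (\<lambda>w. g w $ a $ b) z * Y z $ a * Z z $ b)"
    by (intro sum.cong refl sum.swap)
  also have "\<dots> = (\<Sum>i\<in>UNIV. \<Sum>a\<in>UNIV. \<Sum>b\<in>UNIV. X z $ i * dv i (\<lambda>w. g w $ a $ b) z * Y z $ a * Z z $ b)"
    by (rule sum.swap)
  finally show ?thesis .
qed

text \<open>Derivatives of the fields cancel here too; the connection terms of
  \<open>nabla_vec\<close> are shifted onto \<open>g\<close> by contraction.\<close>

lemma nabla_tensor_components:
  assumes z: "z \<in> W" and g: "\<And>a b. (\<lambda>w. g w $ a $ b) \<in> C"
    and X: "vfield_along B X" and Y: "vfield_along B Y"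
  shows "nabla_tensor f g X Y z = bil (\<chi> a b. SODE f (\<lambda>w. g w $ a $ b) z -
    ((\<Sum>k\<in>UNIV. Gam f k a z * g z $ k $ b) + (\<Sum>k\<in>UNIV. Gam f k b z * g z $ a $ k))) (X z) (Y z)"
proof -
  have bl: "bilinear (bil (g z))" by (rule bilinear_bil)
  have nv: "nabla_vec f X z = (\<chi> a. SODE f (\<lambda>w. X w $ a) z) + (\<chi> i. \<Sum>j\<in>UNIV. Gam f i j z * X z $ j)" for X
    by (simp add: nabla_vec_def vec_eq_iff)
  have "SODE f (app2 g X Y) z = bil (\<chi> a b. SODE f (\<lambda>w. g w $ a $ b) z) (X z) (Y z)
    + bil (g z) (\<chi> a. SODE f (\<lambda>w. X w $ a) z) (Y z) + bil (g z) (X z) (\<chi> a. SODE f (\<lambda>w. Y w $ a) z)"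
    by (rule derivation_app2[OF _ _ g X Y]) (simp_all add: SODE_mult SODE_sum z)
  then have "nabla_tensor f g X Y z = bil (\<chi> a b. SODE f (\<lambda>w. g w $ a $ b) z) (X z) (Y z) -
      (bil (g z) (\<chi> i. \<Sum>j\<in>UNIV. Gam f i j z * X z $ j) (Y z) + bil (g z) (X z) (\<chi> i. \<Sum>j\<in>UNIV. Gam f i j z * Y z $ j))"
    by (simp add: nabla_tensor_def app2_def nv bilinear_ladd[OF bl] bilinear_radd[OF bl])
  then show ?thesis
    unfolding bil_contract_left bil_contract_right
    by (simp add: bil_def algebra_simps sum.distrib sum_subtractf)
qed

text \<open>Phrased as a difference of the two sides so that it works both ways: it derives the
  condition from components, and it extracts components from the condition.\<close>

lemma Phi_R_axis:
  "app2 g (Phi_app f (\<lambda>_. axis i 1)) (\<lambda>_. axis j 1) z - app2 g (\<lambda>_. axis i 1) (Phi_app f (\<lambda>_. axis j 1)) z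
    - (app2 g (R_app f (\<lambda>_. axis i 1) (\<lambda>_. axis j 1)) TT z
       + app2 g (R_app f (\<lambda>_. axis j 1) TT) (\<lambda>_. axis i 1) z + app2 g (R_app f TT (\<lambda>_. axis i 1)) (\<lambda>_. axis j 1) z)
   = (\<Sum>k\<in>UNIV. Phi f k i z * g z $ k $ j) - (\<Sum>k\<in>UNIV. Phi f k j z * g z $ i $ k)
    - (\<Sum>k\<in>UNIV. snd z $ k * ((\<Sum>l\<in>UNIV. Rc f l i j z * g z $ l $ k) +
         (\<Sum>l\<in>UNIV. Rc f l j k z * g z $ l $ i) + (\<Sum>l\<in>UNIV. Rc f l k i z * g z $ l $ j)))"
proof -
  have Phi: "Phi_app f (\<lambda>_. axis i 1) z = (\<chi> k. Phi f k i z)" for i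
    by (simp add: Phi_app_def sum_axis)
  have R1: "R_app f (\<lambda>_. axis i 1) (\<lambda>_. axis j 1) z = (\<chi> k. Rc f k i j z)"
    by (simp add: R_app_def sum_axis)
  have R2: "R_app f (\<lambda>_. axis j 1) TT z = (\<chi> l. \<Sum>k\<in>UNIV. Rc f l j k z * snd z $ k)"
  proof -
    have "(\<Sum>i\<in>UNIV. \<Sum>k\<in>UNIV. Rc f l i k z * axis j 1 $ i * snd z $ k) =
        (\<Sum>i\<in>UNIV. if i = j then \<Sum>k\<in>UNIV. Rc f l i k z * snd z $ k else 0)" for l
      by (intro sum.cong refl) (auto simp: axis_def)
    then show ?thesis by (simp add: R_app_def TT_def)
  qed
  have R3: "R_app f TT (\<lambda>_. axis i 1) z = (\<chi> l. \<Sum>k\<in>UNIV. Rc f l k i z * snd z $ k)"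
    by (simp add: R_app_def TT_def sum_axis)
  have s1: "bil (g z) (\<chi> k. Rc f k i j z) (snd z) = (\<Sum>k\<in>UNIV. \<Sum>l\<in>UNIV. snd z $ k * (Rc f l i j z * g z $ l $ k))"
    unfolding bil_def by (subst sum.swap) (simp add: mult_ac)
  have s2: "(\<Sum>l\<in>UNIV. (\<Sum>k\<in>UNIV. Rr l k * snd z $ k) * g z $ l $ m) =
      (\<Sum>k\<in>UNIV. \<Sum>l\<in>UNIV. snd z $ k * (Rr l k * g z $ l $ m))" for Rr :: "'n \<Rightarrow> 'n \<Rightarrow> real" and m
    unfolding sum_distrib_right by (subst sum.swap) (simp add: mult_ac)
  show ?thesis
    by (simp add: app2_def Phi R1 R2 R3 bil_axis_left bil_axis_right TT_def s1 s2 sum.distrib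
        distrib_left sum_distrib_left)
qed

text \<open>Each side depends on \<open>X\<close> and \<open>Y\<close> bilinearly and through their
  values at \<open>z\<close> alone, so coordinate fields suffice.\<close>

lemma Phi_R_components:
  assumes "\<And>i j. (\<Sum>k\<in>UNIV. Phi f k i z * g z $ k $ j) - (\<Sum>k\<in>UNIV. Phi f k j z * g z $ i $ k)
    = (\<Sum>k\<in>UNIV. snd z $ k * ((\<Sum>l\<in>UNIV. Rc f l i j z * g z $ l $ k) +
         (\<Sum>l\<in>UNIV. Rc f l j k z * g z $ l $ i) + (\<Sum>l\<in>UNIV. Rc f l k i z * g z $ l $ j)))"
  shows "app2 g (Phi_app f X) Y z - app2 g X (Phi_app f Y) z =
    app2 g (R_app f X Y) TT z + app2 g (R_app f Y TT) X z + app2 g (R_app f TT X) Y z"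
proof -
  define h where "h x y = app2 g (Phi_app f (\<lambda>_. x)) (\<lambda>_. y) z - app2 g (\<lambda>_. x) (Phi_app f (\<lambda>_. y)) z
    - (app2 g (R_app f (\<lambda>_. x) (\<lambda>_. y)) TT z
       + app2 g (R_app f (\<lambda>_. y) TT) (\<lambda>_. x) z + app2 g (R_app f TT (\<lambda>_. x)) (\<lambda>_. y) z)" for x y
  have "bilinear h"
    unfolding bilinear_def linear_iff h_def app2_def bil_def Phi_app_def R_app_def TT_def
    by (simp add: algebra_simps sum.distrib sum_distrib_left)
  moreover have "h (axis i 1) (axis j 1) = 0" for i j
    unfolding h_def Phi_R_axis using assms[of i j] by simp
  ultimately have "h (X z) (Y z) = 0" by (rule bilinear_eq_zero_axis)
  then show ?thesis by (simp add: h_def app2_def Phi_app_def R_app_def)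
qed

end

subsection \<open>Construction of the Lagrangian in a chart\<close>

context sode_chart
begin

lemma C_base:
  assumes "smooth_on B a"
  shows "(\<lambda>z. a (fst z)) \<in> C"
  unfolding C_def
  by (simp, rule smooth_on_compose[OF open_W open_B smooth_on_bounded_linear[OF bounded_linear_fst] assms])
    (auto simp: W_def)

lemma frechet_derivative_base:
  assumes "a differentiable (at (fst z))"
  shows "frechet_derivative (\<lambda>z::'n tcoord. a (fst z)) (at z) u = frechet_derivative a (at (fst z)) (fst u)"
proof -
  have "frechet_derivative (fst :: 'n tcoord \<Rightarrow> _) (at z) u = fst u"
    using frechet_derivative_at[OF bounded_linear_imp_has_derivative[OF bounded_linear_fst]] by metis
  then show ?thesis
    using frechet_derivative_chain[of a fst z u] assms bounded_linear_imp_differentiable[OF bounded_linear_fst, of "at z"]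
    by simp
qed

lemma dv_base:
  assumes "smooth_on B a" "z \<in> W"
  shows "dv i (\<lambda>z. a (fst z)) z = (0 :: real)"
proof -
  have "a differentiable (at (fst z))"
    using assms by (intro smooth_on_differentiable[OF assms(1)]) (auto simp: W_def)
  then show ?thesis
    using linear_0[OF linear_frechet_derivative] by (simp add: dv_def frechet_derivative_base)
qed

text \<open>The fibre is all of \<real>^n, where a zero derivative forces constancy; the zero
  section then supplies a representative value.\<close>

lemma dv_zero_imp_base:
  assumes F: "F \<in> C" and "\<And>z k. z \<in> W \<Longrightarrow> dv k F z = 0" and z: "z \<in> W"
  shows "F z = F (fst z, 0)"
proof -
  have in_W: "(fst z, v) \<in> W" for v using z by (auto simp: W_def)
  have "((\<lambda>v. F (fst z, v)) has_derivative (\<lambda>v. 0)) (at v)" for v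
  proof -
    have "((\<lambda>v. (fst z, v)) has_derivative (\<lambda>u. (0, u))) (at v)"
      by (auto intro!: derivative_eq_intros)
    from has_derivative_compose[OF this, of F "frechet_derivative F (at (fst z, v))"]
    have "((\<lambda>v. F (fst z, v)) has_derivative (\<lambda>u. frechet_derivative F (at (fst z, v)) (0, u))) (at v)"
      using C_differentiable[OF F in_W] frechet_derivative_works by blast
    moreover have "frechet_derivative F (at (fst z, v)) (0, u) = 0" for u
      using assms(2)[OF in_W] by (simp add: frechet_derivative_tcoord C_differentiable[OF F in_W])
    ultimately show ?thesis by simp
  qed
  then obtain c where "\<And>v. F (fst z, v) = c"
    using has_derivative_zero_constant[of UNIV "\<lambda>v. F (fst z, v)"] by auto
  then show ?thesis by (metis prod.collapse)
qed

lemma smooth_on_zero_section: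
  assumes "F \<in> C"
  shows "smooth_on B (\<lambda>q. F (q, 0))"
proof (rule smooth_on_compose[OF open_B open_W _ assms[unfolded C_def, simplified]])
  show "smooth_on B (\<lambda>q. (q, 0) :: 'n tcoord)"
    by (rule smooth_on_Pair[OF open_B smooth_on_bounded_linear[OF bounded_linear_ident] smooth_on_const])
qed (auto simp: W_def)

lemma fibre_potential:
  assumes "\<And>i. F i \<in> C" "\<And>z i j. z \<in> W \<Longrightarrow> dv j (F i) z = dv i (F j) z"
  obtains P where "P \<in> C" "\<And>z i. z \<in> W \<Longrightarrow> dv i P z = F i z"
  using fibre_poincare[of B UNIV F] open_B assms
  unfolding C_def W_def dv_def by auto

text \<open>\<open>fibre_poincare\<close> is reused with the base in the role of the fibre over a
  dummy real parameter. The ball is translated to the origin because that lemma integrates along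
  rays from 0.\<close>

lemma base_potential:
  assumes B: "B = ball q0 r" and c: "\<And>i. c i \<in> C"
    and cv: "\<And>z i j. z \<in> W \<Longrightarrow> dv j (c i) z = 0"
    and closed: "\<And>z i j. z \<in> W \<Longrightarrow> dq j (c i) z = dq i (c j) z"
  obtains b where "smooth_on B b" "\<And>z i. z \<in> W \<Longrightarrow> dq i (\<lambda>z. b (fst z)) z = c i z"
proof -
  let ?F = "\<lambda>i (w :: real \<times> (real ^ 'n)). c i (q0 + snd w, 0)"
  let ?S = "(UNIV :: real set) \<times> ball (0 :: real ^ 'n) r"
  have oS: "open ?S" by (intro open_Times open_UNIV open_ball)
  have inW: "(q0 + w, 0) \<in> W" if "w \<in> ball 0 r" for w
    using that unfolding W_def unfolding B by (simp add: dist_norm)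
  have sm: "smooth_on ?S (\<lambda>w. (q0 + snd w, 0) :: 'n tcoord)"
    by (intro smooth_on_Pair smooth_on_add smooth_on_const oS smooth_on_bounded_linear bounded_linear_snd)
  have smF: "smooth_on ?S (?F i)" for i
    using c[of i] inW unfolding C_def
    by (intro smooth_on_compose[OF oS open_W sm]) auto
  have DF: "frechet_derivative (?F i) (at w) (0, axis j 1) = dq j (c i) (q0 + snd w, 0)" if "w \<in> ?S" for i j w
  proof -
    have "((\<lambda>w. (q0 + snd w, 0) :: 'n tcoord) has_derivative (\<lambda>u. (snd u, 0))) (at w)"
      by (auto intro!: derivative_eq_intros)
    from has_derivative_compose[OF this, of "c i" "frechet_derivative (c i) (at (q0 + snd w, 0))"]
    have "(?F i has_derivative (\<lambda>u. frechet_derivative (c i) (at (q0 + snd w, 0)) (snd u, 0))) (at w)"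
      using C_differentiable[OF c[of i] inW] that frechet_derivative_works by (metis mem_Times_iff)
    from frechet_derivative_at[OF this, symmetric] show ?thesis by (simp add: dq_def)
  qed
  have "\<exists>P. smooth_on ?S P \<and> (\<forall>w i. w \<in> ?S \<longrightarrow> frechet_derivative P (at w) (0, axis i 1) = ?F i w)"
  proof (rule fibre_poincare[of UNIV "ball 0 r" ?F])
    show "s *\<^sub>R v \<in> ball 0 r" if "v \<in> ball (0 :: real ^ 'n) r" "0 \<le> s" "s \<le> 1" for v s
      using that mult_left_le_one_le[of "norm v" s] by simp
    show "frechet_derivative (?F i) (at z) (0, axis j 1) = frechet_derivative (?F j) (at z) (0, axis i 1)"
      if "z \<in> ?S" for i j z
    proof -
      have "snd z \<in> ball 0 r" using that by (simp add: mem_Times_iff)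
      then show ?thesis using closed[OF inW] that by (simp add: DF)
    qed
  qed (use smF in auto)
  then obtain P where P: "smooth_on ?S P"
    "\<And>w i. w \<in> ?S \<Longrightarrow> frechet_derivative P (at w) (0, axis i 1) = ?F i w" by blast
  define b where "b q = P (0, q - q0)" for q
  have inS: "(0, q - q0) \<in> ?S" if "q \<in> B" for q
    using that by (auto simp: B dist_norm norm_minus_commute)
  show thesis
  proof (rule that[of b])
    show sb: "smooth_on B b"
      unfolding b_def[abs_def]
    proof (rule smooth_on_compose[OF open_B oS _ P(1) inS])
      show "smooth_on B (\<lambda>q. (0 :: real, q - q0))"
        by (rule smooth_on_Pair[OF open_B smooth_on_const smooth_on_diff[OF open_B
            smooth_on_bounded_linear[OF bounded_linear_ident] smooth_on_const]])
    qed
    fix z i assume z: "z \<in> W"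
    then have q: "fst z \<in> B" by (auto simp: W_def)
    have "((\<lambda>q. (0, q - q0)) has_derivative (\<lambda>u. (0 :: real, u))) (at (fst z))"
      by (auto intro!: derivative_eq_intros)
    from has_derivative_compose[OF this, of P "frechet_derivative P (at (0, fst z - q0))"]
    have "(b has_derivative (\<lambda>u. frechet_derivative P (at (0, fst z - q0)) (0, u))) (at (fst z))"
      unfolding b_def[abs_def] using smooth_on_has_derivative[OF P(1) inS[OF q]] by blast
    from frechet_derivative_at[OF this, symmetric]
    have "frechet_derivative b (at (fst z)) (axis i 1) = c i (fst z, 0)"
      using P(2)[OF inS[OF q]] by simp
    then show "dq i (\<lambda>z. b (fst z)) z = c i z"
      using dv_zero_imp_base[OF c cv z, of i] smooth_on_differentiable[OF sb q]
      by (simp add: dq_def frechet_derivative_base)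
  qed
qed

lemma gyroscopic_lagrangian:
  fixes G :: "'n tcoord \<Rightarrow> real ^ 'n ^ 'n"
  assumes B: "B = ball q0 r" and G: "\<And>i j. (\<lambda>z. G z $ i $ j) \<in> C"
    and G_sym: "\<And>z i j. z \<in> W \<Longrightarrow> G z $ i $ j = G z $ j $ i"
    and G_dv: "\<And>z i j k. z \<in> W \<Longrightarrow> dv i (\<lambda>z. G z $ j $ k) z = dv j (\<lambda>z. G z $ i $ k) z"
    and G_nabla: "nabla_free (\<lambda>i j z. G z $ i $ j)"
    and G_jac: "\<And>z i j. z \<in> W \<Longrightarrow> (\<Sum>k\<in>UNIV. Phi f k i z * G z $ k $ j) - (\<Sum>k\<in>UNIV. Phi f k j z * G z $ i $ k)
      = (\<Sum>k\<in>UNIV. snd z $ k * ((\<Sum>l\<in>UNIV. Rc f l i j z * G z $ l $ k) +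
         (\<Sum>l\<in>UNIV. Rc f l j k z * G z $ l $ i) + (\<Sum>l\<in>UNIV. Rc f l k i z * G z $ l $ j)))"
  obtains L \<omega> where "L \<in> C" "\<And>z. z \<in> W \<Longrightarrow> hess_mat L z = G z" "smooth_on B \<omega>"
    "\<And>q i k. q \<in> B \<Longrightarrow> \<omega> q $ k $ i = - (\<omega> q $ i $ k)"
    "\<And>z i. z \<in> W \<Longrightarrow> EL L i z = (\<Sum>k\<in>UNIV. \<omega> (fst z) $ k $ i * snd z $ k)"
proof -
  \<comment> \<open>Two integrations along the fibres: each column of \<open>G\<close> is a vertical
    gradient of some \<open>P j\<close>, and symmetry of \<open>G\<close> makes the family
    \<open>P\<close> itself a vertical gradient.\<close>
  have "\<exists>P. P \<in> C \<and> (\<forall>z i. z \<in> W \<longrightarrow> dv i P z = G z $ i $ j)" for j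
    using G_dv by (rule_tac fibre_potential[of "\<lambda>i z. G z $ i $ j"]) (auto intro: G)
  then obtain P where P: "\<And>j. P j \<in> C" "\<And>j z i. z \<in> W \<Longrightarrow> dv i (P j) z = G z $ i $ j" by metis
  obtain L0 where L0: "L0 \<in> C" "\<And>z i. z \<in> W \<Longrightarrow> dv i L0 z = P i z"
    by (rule fibre_potential[of P]) (use P G_sym in auto)
  have hess0: "dv i (dv j L0) z = G z $ i $ j" if z: "z \<in> W" for i j z
    using dv_cong[OF z L0(2)] P(2)[OF z] by simp
  have nf: "nabla_free (\<lambda>i j. dv i (dv j L0))"
    unfolding nabla_free_def
  proof (intro ballI allI)
    fix z i j assume z: "z \<in> W"
    show "SODE f (dv i (dv j L0)) z = (\<Sum>k\<in>UNIV. Gam f k i z * dv k (dv j L0) z) + (\<Sum>k\<in>UNIV. Gam f k j z * dv i (dv k L0) z)"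
      using SODE_cong[OF z, of "dv i (dv j L0)" "\<lambda>z. G z $ i $ j"] hess0 G_nabla z
      by (simp add: nabla_free_def)
  qed
  \<comment> \<open>The candidate for \<omega>: if E_i is \<omega>_ki v^k + c_i with coefficients on
    the base, its vertical derivative V_k E_i is \<omega>_ki.\<close>
  define s where "s k i = dv k (EL L0 i)" for k i
  have sC: "s k i \<in> C" for k i unfolding s_def by (intro C_dv C_EL L0)
  have anti: "s k i z = - s i k z" if z: "z \<in> W" for z k i
    unfolding s_def using dv_EL_nabla_free[OF L0(1) nf z] by simp
  have sv: "dv j (s k i) z = 0" if z: "z \<in> W" for z j k i
  proof -
    have sw: "dv j (s k i) z = dv k (s j i) z" for i j k
      unfolding s_def by (rule dv_dv[OF z C_EL[OF L0(1)]])
    have neg: "dv j (s k i) z = - dv j (s i k) z" for i j k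
    proof -
      have "dv j (s k i) z = dv j (\<lambda>z. (-1) * s i k z) z"
        by (rule dv_cong[OF z]) (simp add: anti[of _ k i])
      also have "\<dots> = - dv j (s i k) z"
        using dv_mult[OF z C_const sC, of j "-1" i k] by (simp add: dv_def)
      finally show ?thesis .
    qed
    \<comment> \<open>Alternating the symmetric exchange \<open>sw\<close> with the sign-changing
      exchange \<open>neg\<close>, three times each, leads back to the same entry with the opposite
      sign.\<close>
    show ?thesis
      using sw[of j k i] neg[of k j i] sw[of k i j] neg[of i k j] sw[of i j k] neg[of j i k] by linarith
  qed
  define c where "c i z = EL L0 i z - (\<Sum>k\<in>UNIV. s k i z * snd z $ k)" for i z
  have cC: "c i \<in> C" for i
    unfolding c_def[abs_def] by (intro C_diff C_sum C_mult C_EL L0(1) sC C_snd)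
  have cv: "dv j (c i) z = 0" if z: "z \<in> W" for z j i
  proof -
    have "dv j (c i) z = s j i z - (\<Sum>k\<in>UNIV. s k i z * (if j = k then 1 else 0))"
      unfolding c_def[abs_def]
      by (simp add: dv_diff dv_sum dv_mult z C_EL L0 sC sv dv_snd C_intros) (simp add: s_def)
    then show ?thesis by (simp add: if_distrib[of "\<lambda>x. _ * x"] cong: if_cong)
  qed
  have EL0: "EL L0 i z = (\<Sum>k\<in>UNIV. s k i z * snd z $ k) + c i z" for i z
    by (simp add: c_def)
  have closed: "dq j (c i) z = dq i (c j) z" if z: "z \<in> W" for z i j
  proof -
    have "(\<Sum>k\<in>UNIV. Phi f k j z * G z $ i $ k) = (\<Sum>k\<in>UNIV. Phi f k j z * G z $ k $ i)"
      using G_sym[OF z] by metis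
    then show ?thesis
      using gyroscopic_EL_jacobi[of L0 s c z i j, OF L0(1) sC cC anti sv cv EL0 z] G_jac[OF z, of i j]
      by (simp add: hess0 z)
  qed
  obtain b where b: "smooth_on B b" "\<And>z i. z \<in> W \<Longrightarrow> dq i (\<lambda>z. b (fst z)) z = c i z"
    using base_potential[OF B cC cv closed] by blast
  have bC: "(\<lambda>z. b (fst z)) \<in> C" by (rule C_base[OF b(1)])
  \<comment> \<open>A function of the base point leaves the Hessian unchanged and alters E_i by
    minus its q-derivative, which is exactly \<open>- c i\<close>.\<close>
  define L where "L z = L0 z + b (fst z)" for z
  have LC: "L \<in> C" unfolding L_def[abs_def] by (intro C_add L0 bC)
  have dvL: "dv i L z = dv i L0 z" if "z \<in> W" for i z
    unfolding L_def[abs_def] using that by (simp add: dv_add L0 bC dv_base[OF b(1)])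
  have dqL: "dq i L z = dq i L0 z + c i z" if "z \<in> W" for i z
    unfolding L_def[abs_def] using that by (simp add: dq_add L0 bC b)
  show thesis
  \<comment> \<open>\<open>s\<close> is constant along the fibres, so its values on the zero section
    define the form on the base.\<close>
  proof (rule that[of L "\<lambda>q. \<chi> k i. s k i (q, 0)"])
    show "L \<in> C" by (rule LC)
    show "hess_mat L z = G z" if "z \<in> W" for z
      using dv_cong[OF that dvL] hess0[OF that] by (simp add: hess_mat_def vec_eq_iff)
    show "smooth_on B (\<lambda>q. \<chi> k i. s k i (q, 0))"
      by (intro smooth_on_vec open_B) (simp add: smooth_on_zero_section sC)
    show "(\<chi> k i. s k i (q, 0)) $ k $ i = - ((\<chi> k i. s k i (q, 0)) $ i $ k)" if "q \<in> B" for q i k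
      using anti[of "(q, 0)" k i] that by (simp add: W_def)
    show "EL L i z = (\<Sum>k\<in>UNIV. (\<chi> k i. s k i (fst z, 0)) $ k $ i * snd z $ k)" if z: "z \<in> W" for z i
    proof -
      have "EL L i z = EL L0 i z - c i z"
        using SODE_cong[OF z dvL] dqL[OF z] by (simp add: EL_def)
      then show ?thesis
        using dv_zero_imp_base[OF sC sv z] by (simp add: EL0)
    qed
  qed
qed

end

subsection \<open>Change of coordinates\<close>

text \<open>Inside one fibre the base point is fixed, and a change of coordinates is just the linear
  map \<open>J\<close>.\<close>

lemma dv_fibre_pullback:
  assumes J: "linear J" and eq: "\<And>v. F (q, v) = H (q', J v)"
    and F: "F differentiable (at (q, v))" and H: "H differentiable (at (q', J v))"
  shows "dv j F (q, v) = (\<Sum>k\<in>UNIV. J (axis j 1) $ k * dv k H (q', J v))"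
proof -
  have "((\<lambda>v. (q, v)) has_derivative (\<lambda>u. (0, u))) (at v)"
    by (auto intro!: derivative_eq_intros)
  from has_derivative_compose[OF this, of F "frechet_derivative F (at (q, v))"]
  have 1: "((\<lambda>v. F (q, v)) has_derivative (\<lambda>u. frechet_derivative F (at (q, v)) (0, u))) (at v)"
    using F frechet_derivative_works by blast
  have "(J has_derivative J) (at v)"
    by (rule bounded_linear_imp_has_derivative) (rule linear_conv_bounded_linear[THEN iffD1, OF J])
  then have "((\<lambda>v. (q', J v)) has_derivative (\<lambda>u. (0, J u))) (at v)"
    by (auto intro!: derivative_eq_intros)
  from has_derivative_compose[OF this, of H "frechet_derivative H (at (q', J v))"]
  have "((\<lambda>v. H (q', J v)) has_derivative (\<lambda>u. frechet_derivative H (at (q', J v)) (0, J u))) (at v)"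
    using H frechet_derivative_works by blast
  then have "(\<lambda>u. frechet_derivative F (at (q, v)) (0, u)) = (\<lambda>u. frechet_derivative H (at (q', J v)) (0, J u))"
    using 1 eq has_derivative_unique by (metis (no_types, lifting) ext)
  then have "dv j F (q, v) = frechet_derivative H (at (q', J v)) (0, J (axis j 1))"
    unfolding dv_def by (rule fun_cong)
  then show ?thesis by (simp add: frechet_derivative_tcoord H)
qed

text \<open>Because \<open>J\<close> is linear, two fibre derivatives produce two factors of
  \<open>J\<close> and no further term; this is what makes the Hessian a tensor along
  \<tau>.\<close>

lemma hess_mat_fibre_pullback:
  assumes J: "linear J" and eq: "\<And>v. F (q, v) = H (q', J v)"
    and F: "\<And>v. F differentiable (at (q, v))" "\<And>v i. dv i F differentiable (at (q, v))"
    and H: "\<And>v. H differentiable (at (q', v))" "\<And>v i. dv i H differentiable (at (q', v))"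
  shows "bil (hess_mat F (q, v)) x y = bil (hess_mat H (q', J v)) (J x) (J y)"
proof -
  have ax: "hess_mat F (q, v) $ i $ j = bil (hess_mat H (q', J v)) (J (axis i 1)) (J (axis j 1))" for i j
  proof -
    let ?H = "\<lambda>z. \<Sum>k\<in>UNIV. J (axis j 1) $ k * dv k H z"
    have dH: "(\<lambda>z. J (axis j 1) $ k * dv k H z) differentiable (at (q', v))" for k v
      by (intro differentiable_mult differentiable_const H)
    have "dv i (dv j F) (q, v) = (\<Sum>l\<in>UNIV. J (axis i 1) $ l * dv l ?H (q', J v))"
    proof (rule dv_fibre_pullback[OF J])
      show "dv j F (q, w) = ?H (q', J w)" for w
        by (rule dv_fibre_pullback[OF J eq F(1) H(1)])
    qed (use F dH in \<open>auto intro: differentiable_sum\<close>)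
    also have "\<dots> = (\<Sum>l\<in>UNIV. \<Sum>k\<in>UNIV. J (axis i 1) $ l * (J (axis j 1) $ k * dv l (dv k H) (q', J v)))"
      unfolding dv_def[of _ ?H]
      by (simp add: frechet_derivative_sum_real dH frechet_derivative_mult_real H sum_distrib_left)
        (simp add: dv_def)
    finally show ?thesis by (simp add: hess_mat_def bil_def mult_ac)
  qed
  have "bilinear (\<lambda>x y. bil (hess_mat F (q, v)) x y - bil (hess_mat H (q', J v)) (J x) (J y))"
    unfolding bilinear_def linear_iff bil_def
    by (simp add: linear_add[OF J] linear_scale[OF J] algebra_simps sum.distrib sum_distrib_left)
  from bilinear_eq_zero_axis[OF this, of x y] show ?thesis unfolding bil_axis by (simp add: ax)
qed

text \<open>\<open>\<phi>\<close> is the transition from the chart over \<open>B1\<close> to the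
  chart over \<open>B0\<close>; functions and forms are pulled back from \<open>B0\<close> to
  \<open>B1\<close>.\<close>

locale chart_change = c1: sode_chart B1 f1 + c0: sode_chart B0 f0
  for B1 :: "(real ^ 'n::finite) set" and f1 and B0 :: "(real ^ 'n) set" and f0 +
  fixes \<phi> :: "real ^ 'n \<Rightarrow> real ^ 'n"
  assumes smooth_\<phi>: "smooth_on B1 \<phi>" and \<phi>_in: "q \<in> B1 \<Longrightarrow> \<phi> q \<in> B0"
    and field_law: "q \<in> B1 \<Longrightarrow> f0 (\<phi> q, frechet_derivative \<phi> (at q) v) =
      frechet_derivative \<phi> (at q) (f1 (q, v)) +
      frechet_derivative (\<lambda>y. frechet_derivative \<phi> (at y) v) (at q) v"
begin

definition J where "J q = frechet_derivative \<phi> (at q)"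

definition K where "K q v = frechet_derivative (\<lambda>y. J y v) (at q)"

definition \<Psi> :: "'n tcoord \<Rightarrow> 'n tcoord" where "\<Psi> z = (\<phi> (fst z), J (fst z) (snd z))"

lemma linear_J: "q \<in> B1 \<Longrightarrow> linear (J q)"
  unfolding J_def by (rule linear_frechet_derivative[OF smooth_on_differentiable[OF smooth_\<phi>]])

lemma smooth_J: "smooth_on B1 (\<lambda>q. J q v)"
  unfolding J_def by (rule smooth_on_frechet_derivative[OF smooth_\<phi>])

lemma J_differentiable: "q \<in> B1 \<Longrightarrow> (\<lambda>y. J y v) differentiable (at q)"
  by (rule smooth_on_differentiable[OF smooth_J])

lemma J_sum:
  assumes "q \<in> B1"
  shows "J q v = (\<Sum>i\<in>UNIV. v $ i *\<^sub>R J q (axis i 1))"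
proof -
  interpret linear "J q" by (rule linear_J[OF assms])
  have "J q v = J q (\<Sum>i\<in>UNIV. v $ i *\<^sub>R axis i 1)"
    using basis_expansion[of v] by (simp add: scalar_mult_eq_scaleR)
  then show ?thesis by (simp only: sum scale)
qed

text \<open>Symmetry of second derivatives is available for real-valued functions, hence the passage
  to the components of \<open>\<phi>\<close>.\<close>

lemma K_sym:
  assumes "q \<in> B1"
  shows "K q v a = K q a v"
proof (rule vec_eq_iff[THEN iffD2], rule allI)
  fix k
  have comp: "K q v a $ k = frechet_derivative (\<lambda>y. frechet_derivative (\<lambda>x. \<phi> x $ k) (at y) v) (at q) a" for v a
  proof -
    have "K q v a $ k = frechet_derivative (\<lambda>y. J y v $ k) (at q) a"
      unfolding K_def
      by (rule frechet_derivative_linear_comp[OF bounded_linear_vec_nth J_differentiable[OF assms], symmetric])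
    also have "\<dots> = frechet_derivative (\<lambda>y. frechet_derivative (\<lambda>x. \<phi> x $ k) (at y) v) (at q) a"
    proof -
      have "J y v $ k = frechet_derivative (\<lambda>x. \<phi> x $ k) (at y) v" if "y \<in> B1" for y
        unfolding J_def
        by (rule frechet_derivative_linear_comp[OF bounded_linear_vec_nth smooth_on_differentiable[OF smooth_\<phi> that], symmetric])
      from frechet_derivative_cong_open[OF c1.open_B assms this] show ?thesis by simp
    qed
    finally show ?thesis .
  qed
  show "K q v a $ k = K q a v $ k"
    unfolding comp by (rule frechet_derivative_commute[OF c1.open_B assms smooth_on_nth[OF c1.open_B smooth_\<phi>]])
qed

text \<open>\<open>smooth_J\<close> concerns a fixed direction, whereas here the direction is the
  velocity coordinate; \<open>J_sum\<close> separates the two.\<close>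

lemma smooth_\<Psi>: "smooth_on c1.W \<Psi>"
proof -
  have base: "smooth_on c1.W (\<lambda>z. a (fst z))" if "smooth_on B1 a" for a :: "real ^ 'n \<Rightarrow> real ^ 'n"
    by (rule smooth_on_compose[OF c1.open_W c1.open_B smooth_on_bounded_linear[OF bounded_linear_fst] that])
      (auto simp: c1.W_def)
  have "smooth_on c1.W (\<lambda>z. (\<phi> (fst z), \<Sum>i\<in>UNIV. snd z $ i *\<^sub>R J (fst z) (axis i 1)))"
    using c1.C_snd unfolding c1.C_def
    by (intro smooth_on_Pair smooth_on_sum smooth_on_scaleR c1.open_W base smooth_\<phi> smooth_J) auto
  then show ?thesis
    by (rule smooth_on_cong[OF c1.open_W, rotated]) (auto simp: c1.W_def \<Psi>_def J_sum[symmetric])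
qed

lemma \<Psi>_in: "z \<in> c1.W \<Longrightarrow> \<Psi> z \<in> c0.W"
  by (auto simp: c1.W_def c0.W_def \<Psi>_def \<phi>_in)

text \<open>The off-diagonal block \<open>K\<close> is the second derivative of
  \<open>\<phi>\<close>. It accounts for the inhomogeneous term of \<open>field_law\<close> and
  cancels again in \<open>EL_pullback\<close>.\<close>

lemma derivative_\<Psi>:
  assumes z: "z \<in> c1.W"
  shows "frechet_derivative \<Psi> (at z) (a, b) =
    (J (fst z) a, K (fst z) (snd z) a + J (fst z) b)"
proof -
  have q: "fst z \<in> B1" using z by (auto simp: c1.W_def)
  let ?\<Psi> = "\<lambda>z. (\<phi> (fst z), \<Sum>i\<in>UNIV. snd z $ i *\<^sub>R J (fst z) (axis i 1))"
  have Kh: "((\<lambda>y. J y v) has_derivative K (fst z) v) (at (fst z))" for v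
    unfolding K_def using J_differentiable[OF q] frechet_derivative_works by blast
  have f: "(fst has_derivative fst) (at z)"
    by (rule bounded_linear_imp_has_derivative[OF bounded_linear_fst])
  have s: "((\<lambda>z. snd z $ i) has_derivative (\<lambda>u. snd u $ i)) (at z)" for i
    by (rule bounded_linear_imp_has_derivative[OF bounded_linear_compose[OF bounded_linear_vec_nth bounded_linear_snd]])
  have "(\<phi> has_derivative J (fst z)) (at (fst z))"
    unfolding J_def by (rule smooth_on_has_derivative[OF smooth_\<phi> q])
  from has_derivative_compose[OF f this] have 1: "((\<lambda>z. \<phi> (fst z)) has_derivative (\<lambda>u. J (fst z) (fst u))) (at z)" .
  have 2: "((\<lambda>z. J (fst z) v) has_derivative (\<lambda>u. K (fst z) v (fst u))) (at z)" for v
    by (rule has_derivative_compose[OF f Kh])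
  have "(?\<Psi> has_derivative (\<lambda>u. (J (fst z) (fst u), \<Sum>i\<in>UNIV. snd z $ i *\<^sub>R K (fst z) (axis i 1) (fst u) +
      snd u $ i *\<^sub>R J (fst z) (axis i 1)))) (at z)"
    by (intro has_derivative_Pair 1 has_derivative_sum has_derivative_scaleR s 2)
  from frechet_derivative_at[OF this, symmetric]
  have "frechet_derivative ?\<Psi> (at z) (a, b) =
      (J (fst z) a, \<Sum>i\<in>UNIV. snd z $ i *\<^sub>R K (fst z) (axis i 1) a + b $ i *\<^sub>R J (fst z) (axis i 1))"
    by simp
  moreover have "frechet_derivative \<Psi> (at z) = frechet_derivative ?\<Psi> (at z)"
    by (rule frechet_derivative_cong_open[OF c1.open_W z]) (auto simp: c1.W_def \<Psi>_def J_sum[symmetric])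
  moreover have "(\<Sum>i\<in>UNIV. v $ i *\<^sub>R K (fst z) (axis i 1) a) = K (fst z) v a" for v
  proof -
    interpret linear "K (fst z) a"
      unfolding K_def by (rule linear_frechet_derivative[OF J_differentiable[OF q]])
    have "K (fst z) a v = K (fst z) a (\<Sum>i\<in>UNIV. v $ i *\<^sub>R axis i 1)"
      using basis_expansion[of v] by (simp add: scalar_mult_eq_scaleR)
    then have "K (fst z) a v = (\<Sum>i\<in>UNIV. v $ i *\<^sub>R K (fst z) a (axis i 1))"
      by (simp only: sum scale)
    then show ?thesis by (simp add: K_sym[OF q, of a])
  qed
  ultimately show ?thesis by (simp add: sum.distrib J_sum[OF q, of b])
qed

lemma C_pullback:
  assumes "F \<in> c0.C"
  shows "(\<lambda>z. F (\<Psi> z)) \<in> c1.C"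
  using smooth_on_compose[OF c1.open_W c0.open_W smooth_\<Psi> _ \<Psi>_in, of F] assms
  by (simp add: c1.C_def c0.C_def)

lemma derivative_pullback:
  assumes F: "F \<in> c0.C" and z: "z \<in> c1.W"
  shows "frechet_derivative (\<lambda>z. F (\<Psi> z)) (at z) (a, b) =
    (\<Sum>k\<in>UNIV. J (fst z) a $ k * dq k F (\<Psi> z)) +
    (\<Sum>k\<in>UNIV. (K (fst z) (snd z) a + J (fst z) b) $ k * dv k F (\<Psi> z))"
  using frechet_derivative_chain[of F \<Psi> z "(a, b)"] c0.C_differentiable[OF F \<Psi>_in[OF z]]
    smooth_on_differentiable[OF smooth_\<Psi> z]
  by (simp add: derivative_\<Psi>[OF z] frechet_derivative_tcoord)

text \<open>\<open>field_law\<close> says precisely that the derivative of \<open>\<Psi>\<close>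
  carries one coordinate representative of \<Gamma> to the other.\<close>

lemma SODE_pullback:
  assumes F: "F \<in> c0.C" and z: "z \<in> c1.W"
  shows "SODE f1 (\<lambda>z. F (\<Psi> z)) z = SODE f0 F (\<Psi> z)"
proof -
  have q: "fst z \<in> B1" using z by (auto simp: c1.W_def)
  have f0: "f0 (\<Psi> z) = K (fst z) (snd z) (snd z) + J (fst z) (f1 z)"
    using field_law[OF q, of "snd z"] by (simp add: \<Psi>_def J_def K_def add.commute)
  show ?thesis
    using SODE_frechet[OF c1.C_differentiable[OF C_pullback[OF F] z], of f1]
    by (simp only: derivative_pullback[OF F z] SODE_def[of f0] f0) (simp add: \<Psi>_def)
qed

text \<open>\<Gamma> acting on the Jacobian factor of the vertical derivative yields second
  derivatives of \<open>\<phi>\<close>; the q-derivative of the pull-back yields the same terms.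
  They cancel, so the expressions transform as a covector.\<close>

lemma EL_pullback:
  assumes L: "L \<in> c0.C" and z: "z \<in> c1.W"
  shows "c1.EL (\<lambda>z. L (\<Psi> z)) i z = (\<Sum>k\<in>UNIV. J (fst z) (axis i 1) $ k * c0.EL L k (\<Psi> z))"
proof -
  have q: "fst w \<in> B1" if "w \<in> c1.W" for w using that by (auto simp: c1.W_def)
  have J0: "J (fst w) 0 = 0" if "w \<in> c1.W" for w using linear_0[OF linear_J[OF q[OF that]]] .
  have K0: "K (fst w) v 0 = 0" if "w \<in> c1.W" for w v
    unfolding K_def by (rule linear_0[OF linear_frechet_derivative[OF J_differentiable[OF q[OF that]]]])
  have JC: "(\<lambda>w. J (fst w) (axis i 1) $ k) \<in> c1.C" for k
    using c1.C_base[OF smooth_on_nth[OF c1.open_B smooth_J]] .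
  have SJ: "SODE f1 (\<lambda>w. J (fst w) (axis i 1) $ k) z = K (fst z) (snd z) (axis i 1) $ k" for k
  proof -
    have "SODE f1 (\<lambda>w. J (fst w) (axis i 1) $ k) z =
        frechet_derivative (\<lambda>w. J (fst w) (axis i 1) $ k) (at z) (snd z, f1 z)"
      by (rule SODE_frechet[OF c1.C_differentiable[OF JC z]])
    also have "\<dots> = frechet_derivative (\<lambda>y. J y (axis i 1) $ k) (at (fst z)) (snd z)"
      using c1.frechet_derivative_base[of "\<lambda>y. J y (axis i 1) $ k" z]
        smooth_on_differentiable[OF smooth_on_nth[OF c1.open_B smooth_J] q[OF z]] by simp
    also have "\<dots> = K (fst z) (axis i 1) (snd z) $ k"
      unfolding K_def by (rule frechet_derivative_linear_comp[OF bounded_linear_vec_nth J_differentiable[OF q[OF z]]])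
    finally show ?thesis using K_sym[OF q[OF z]] by metis
  qed
  have "dv i (\<lambda>z. L (\<Psi> z)) w = (\<Sum>k\<in>UNIV. J (fst w) (axis i 1) $ k * dv k L (\<Psi> w))" if "w \<in> c1.W" for w
    unfolding dv_def[of i "\<lambda>z. L (\<Psi> z)"] derivative_pullback[OF L that]
    by (simp add: J0[OF that] K0[OF that])
  then have "SODE f1 (dv i (\<lambda>z. L (\<Psi> z))) z =
      SODE f1 (\<lambda>w. \<Sum>k\<in>UNIV. J (fst w) (axis i 1) $ k * dv k L (\<Psi> w)) z"
    by (rule c1.SODE_cong[OF z])
  also have "\<dots> = (\<Sum>k\<in>UNIV. J (fst z) (axis i 1) $ k * SODE f0 (dv k L) (\<Psi> z) +
      K (fst z) (snd z) (axis i 1) $ k * dv k L (\<Psi> z))"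
    by (simp add: c1.SODE_sum c1.SODE_mult z JC c1.C_mult C_pullback c0.C_dv L SODE_pullback SJ)
  finally have S: "SODE f1 (dv i (\<lambda>z. L (\<Psi> z))) z = \<dots>" .
  have "dq i (\<lambda>z. L (\<Psi> z)) z = (\<Sum>k\<in>UNIV. J (fst z) (axis i 1) $ k * dq k L (\<Psi> z)) +
      (\<Sum>k\<in>UNIV. K (fst z) (snd z) (axis i 1) $ k * dv k L (\<Psi> z))"
    unfolding dq_def[of i "\<lambda>z. L (\<Psi> z)"] derivative_pullback[OF L z]
    by (simp add: J0[OF z])
  with S show ?thesis
    by (simp add: c1.EL_def c0.EL_def sum.distrib sum_subtractf algebra_simps)
qed

end

subsection \<open>Charts of an atlas\<close>

lemma coordsE:
  assumes "q \<in> coords c U"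
  obtains x where "x \<in> U" "x \<in> fst c" "q = snd c x"
  using assms by (auto simp: coords_def)

context
  fixes A :: "('q::{t2_space, second_countable_topology}, 'n::finite) chart set"
  assumes A: "smooth_atlas A"
begin

lemma open_chart: "c \<in> A \<Longrightarrow> open (fst c)"
  using A unfolding smooth_atlas_def by blast

lemma chart_homeo: "c \<in> A \<Longrightarrow> homeomorphism (fst c) (snd c ` fst c) (snd c) (inv_into (fst c) (snd c))"
  using A unfolding smooth_atlas_def by blast

lemma inv_into_chart: "c \<in> A \<Longrightarrow> x \<in> fst c \<Longrightarrow> inv_into (fst c) (snd c) (snd c x) = x"
  using chart_homeo unfolding homeomorphism_def by blast

lemma chart_inj: "c \<in> A \<Longrightarrow> x \<in> fst c \<Longrightarrow> y \<in> fst c \<Longrightarrow> snd c x = snd c y \<Longrightarrow> x = y"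
  using inv_into_chart by metis

lemma transition_apply: "c \<in> A \<Longrightarrow> x \<in> fst c \<Longrightarrow> transition c d (snd c x) = snd d x"
  by (simp add: transition_def inv_into_chart)

lemma open_coords:
  assumes c: "c \<in> A" and U: "open U"
  shows "open (coords c U)"
proof -
  have "coords c U = snd c ` fst c \<inter> (inv_into (fst c) (snd c)) -` (U \<inter> fst c)"
    using inv_into_chart[OF c] by (auto simp: coords_def)
  moreover have "continuous_on (snd c ` fst c) (inv_into (fst c) (snd c))"
    using chart_homeo[OF c] by (simp add: homeomorphism_def)
  moreover have "open (snd c ` fst c)" using A c unfolding smooth_atlas_def by blast
  ultimately show ?thesis
    using continuous_open_preimage U open_chart[OF c] by (metis open_Int)
qed

lemma smooth_transition: "c \<in> A \<Longrightarrow> d \<in> A \<Longrightarrow> smooth_on (coords c (fst d)) (transition c d)"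
  using A unfolding smooth_atlas_def coords_def by (metis Int_commute)

lemma transition_chain:
  assumes c: "c \<in> A" "d \<in> A" "e \<in> A" and q: "q \<in> coords c (fst d \<inter> fst e)"
  shows "transition c e q = transition d e (transition c d q)"
  using coordsE[OF q] transition_apply c by (metis Int_iff)

text \<open>The chain rule for the cocycle identity \<open>transition_chain\<close>, which holds on
  an open set and so may be differentiated.\<close>

lemma jac_chain:
  assumes c: "c \<in> A" "d \<in> A" "e \<in> A" and x: "x \<in> fst c" "x \<in> fst d" "x \<in> fst e"
  shows "jac c e (snd c x) v = jac d e (snd d x) (jac c d (snd c x) v)"
proof -
  let ?S = "coords c (fst d \<inter> fst e)"
  have oS: "open ?S" using c by (intro open_coords open_Int open_chart)
  have q: "snd c x \<in> ?S" "snd c x \<in> coords c (fst d)" "snd d x \<in> coords d (fst e)"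
    using x by (auto simp: coords_def)
  have "jac c e (snd c x) v = frechet_derivative (\<lambda>q. transition d e (transition c d q)) (at (snd c x)) v"
    unfolding jac_def using frechet_derivative_cong_open[OF oS q(1) transition_chain[OF c]] by simp
  also have "\<dots> = jac d e (snd d x) (jac c d (snd c x) v)"
    unfolding jac_def using smooth_on_differentiable[OF smooth_transition q(2)]
      smooth_on_differentiable[OF smooth_transition q(3)] c x
    by (subst frechet_derivative_chain) (simp_all add: transition_apply)
  finally show ?thesis .
qed

lemma linear_jac:
  assumes "c \<in> A" "d \<in> A" "x \<in> fst c" "x \<in> fst d"
  shows "linear (jac c d (snd c x))"
  unfolding jac_def
  by (rule linear_frechet_derivative[OF smooth_on_differentiable[OF smooth_transition]])
    (use assms in \<open>auto simp: coords_def\<close>)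

end

section \<open>The Hessian of the Lagrangian as a multiplier\<close>

context sode_chart
begin

lemma hess_mat_nth: "hess_mat L z $ i $ j = dv i (dv j L) z"
  by (simp add: hess_mat_def)

lemma C_hess: "L \<in> C \<Longrightarrow> (\<lambda>z. hess_mat L z $ a $ b) \<in> C"
  using C_dv[OF C_dv, of L a b] by (simp add: hess_mat_def)

lemma smooth_hess: "L \<in> C \<Longrightarrow> smooth_on W (hess_mat L)"
  using C_hess by (intro smooth_on_vec open_W) (simp add: C_def)

text \<open>In components, both exchanges are permutations of the third vertical derivatives of
  \<open>L\<close>.\<close>

lemma DV_tensor_hess_sym:
  assumes L: "L \<in> C" and z: "z \<in> W"
    and X: "vfield_along B X" and Y: "vfield_along B Y" and Z: "vfield_along B Z"
  shows "DV_tensor (hess_mat L) X Y Z z = DV_tensor (hess_mat L) Y X Z z"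
    and "DV_tensor (hess_mat L) X Y Z z = DV_tensor (hess_mat L) X Z Y z"
proof -
  let ?T = "\<lambda>i a b. dv i (dv a (dv b L)) z"
  have T12: "?T i a b = ?T a i b" for i a b by (rule dv_dv[OF z C_dv[OF L]])
  have T23: "?T i a b = ?T i b a" for i a b by (rule dv_cong[OF z]) (simp add: hess_sym L)
  have comp: "DV_tensor (hess_mat L) X Y Z z = (\<Sum>i\<in>UNIV. \<Sum>a\<in>UNIV. \<Sum>b\<in>UNIV. X z $ i * ?T i a b * Y z $ a * Z z $ b)"
    if "vfield_along B Y" "vfield_along B Z" for X Y Z
    using DV_tensor_components[OF z C_hess[OF L] that, of X] by (simp add: hess_mat_nth)
  have "(\<Sum>i\<in>UNIV. \<Sum>a\<in>UNIV. \<Sum>b\<in>UNIV. X z $ i * ?T i a b * Y z $ a * Z z $ b) =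
      (\<Sum>a\<in>UNIV. \<Sum>i\<in>UNIV. \<Sum>b\<in>UNIV. X z $ i * ?T i a b * Y z $ a * Z z $ b)"
    by (rule sum.swap)
  also have "\<dots> = (\<Sum>a\<in>UNIV. \<Sum>i\<in>UNIV. \<Sum>b\<in>UNIV. Y z $ a * ?T a i b * X z $ i * Z z $ b)"
    by (intro sum.cong refl) (simp add: T12 mult_ac)
  finally show "DV_tensor (hess_mat L) X Y Z z = DV_tensor (hess_mat L) Y X Z z"
    by (simp add: comp X Y Z)
  have "(\<Sum>a\<in>UNIV. \<Sum>b\<in>UNIV. X z $ i * ?T i a b * Y z $ a * Z z $ b) =
      (\<Sum>b\<in>UNIV. \<Sum>a\<in>UNIV. X z $ i * ?T i a b * Y z $ a * Z z $ b)" for i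
    by (rule sum.swap)
  also have "\<dots> i = (\<Sum>b\<in>UNIV. \<Sum>a\<in>UNIV. X z $ i * ?T i b a * Z z $ b * Y z $ a)" for i
    by (intro sum.cong refl) (simp add: T23 mult_ac)
  finally show "DV_tensor (hess_mat L) X Y Z z = DV_tensor (hess_mat L) X Z Y z"
    by (simp add: comp X Y Z)
qed

text \<open>The case c = 0 of the common computation, with \<omega> read as a velocity-independent
  family of functions on \<open>W\<close>.\<close>

lemma hess_multiplier:
  assumes L: "L \<in> C" and \<omega>: "smooth_on B \<omega>"
    and anti: "\<And>q i k. q \<in> B \<Longrightarrow> \<omega> q $ k $ i = - (\<omega> q $ i $ k)"
    and EL: "\<And>z i. z \<in> W \<Longrightarrow> EL L i z = (\<Sum>k\<in>UNIV. \<omega> (fst z) $ k $ i * snd z $ k)"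
    and z: "z \<in> W" and X: "vfield_along B X" and Y: "vfield_along B Y"
  shows "nabla_tensor f (hess_mat L) X Y z = 0"
    and "app2 (hess_mat L) (Phi_app f X) Y z - app2 (hess_mat L) X (Phi_app f Y) z =
      app2 (hess_mat L) (R_app f X Y) TT z + app2 (hess_mat L) (R_app f Y TT) X z
        + app2 (hess_mat L) (R_app f TT X) Y z"
proof -
  let ?s = "\<lambda>k i z. \<omega> (fst z) $ k $ i"
  have sm: "smooth_on B (\<lambda>q. \<omega> q $ k $ i)" for k i
    by (intro smooth_on_nth open_B \<omega>)
  have s: "?s k i \<in> C" for k i using C_base[OF sm] .
  have sv: "dv j (?s k i) z = 0" if "z \<in> W" for z j k i using dv_base[OF sm that] .
  have s_anti: "?s k i z = - ?s i k z" if "z \<in> W" for z k i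
    by (rule anti) (use that in \<open>auto simp: W_def\<close>)
  have EL': "EL L i z = (\<Sum>k\<in>UNIV. ?s k i z * snd z $ k) + (\<lambda>i z. 0) i z" if "z \<in> W" for i z
    using EL[OF that] by simp
  have zero: "dv j (\<lambda>z. 0) z = 0" "dq j (\<lambda>z. 0) z = 0" for j z by (simp_all add: dv_def dq_def)
  note facts = L s C_const s_anti sv zero(1) EL'
  have "nabla_free (\<lambda>i j. dv i (dv j L))"
    by (rule gyroscopic_EL_nabla_free[of L ?s "\<lambda>i z. 0", OF facts])
  then have "(\<chi> a b. SODE f (\<lambda>w. hess_mat L w $ a $ b) z -
    ((\<Sum>k\<in>UNIV. Gam f k a z * hess_mat L z $ k $ b) + (\<Sum>k\<in>UNIV. Gam f k b z * hess_mat L z $ a $ k))) = 0"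
    using z by (simp add: nabla_free_def hess_mat_def vec_eq_iff)
  then show "nabla_tensor f (hess_mat L) X Y z = 0"
    using nabla_tensor_components[OF z C_hess[OF L] X Y] by (simp add: bil_def)
  have "(\<Sum>k\<in>UNIV. Phi f k j z * dv i (dv k L) z) = (\<Sum>k\<in>UNIV. Phi f k j z * dv k (dv i L) z)" for i j
    using hess_sym[OF z L] by metis
  then show "app2 (hess_mat L) (Phi_app f X) Y z - app2 (hess_mat L) X (Phi_app f Y) z =
      app2 (hess_mat L) (R_app f X Y) TT z + app2 (hess_mat L) (R_app f Y TT) X z
        + app2 (hess_mat L) (R_app f TT X) Y z"
    using gyroscopic_EL_jacobi[of L ?s "\<lambda>i z. 0", OF facts z]
    by (intro Phi_R_components) (simp add: hess_mat_def zero)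
qed

end

lemma sode_chart_coords:
  assumes "smooth_atlas A" "second_order_field A f" "open U" "c \<in> A"
  shows "sode_chart (coords c U) (f c)"
proof
  show "open (coords c U)" by (rule open_coords[OF assms(1,4,3)])
  have "smooth_on (coords c UNIV \<times> UNIV) (f c)"
    using assms(2,4) by (simp add: second_order_field_def)
  then show "smooth_on (coords c U \<times> UNIV) (f c)"
    by (rule smooth_on_subset) (auto simp: coords_def)
qed

lemma gyroscopic_imp_multiplier:
  assumes A: "smooth_atlas A" and f: "second_order_field A f" and U: "open U"
    and gyr: "gyroscopic_on A f U"
  shows "\<exists>g. gyroscopic_multiplier A f U g"
proof -
  obtain L \<omega> where L: "smooth_function_on_TU A U L" and reg: "regular_function A U L"
    and \<omega>: "two_form_on A U \<omega>" and eq: "equivalent_gyroscopic A f U L \<omega>"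
    using gyr unfolding gyroscopic_on_def by blast
  \<comment> \<open>Only the tensor law compares different charts; all other conditions are verified
    in one chart at a time.\<close>
  define g where "g c = hess_mat (L c)" for c
  note chart = sode_chart_coords[OF A f U]
  have LC: "L c \<in> sode_chart.C (coords c U)" if "c \<in> A" for c
    using L that by (simp add: smooth_function_on_TU_def sode_chart.C_def[OF chart[OF that]]
        sode_chart.W_def[OF chart[OF that]])
  have W: "sode_chart.W (coords c U) = coords c U \<times> UNIV" if "c \<in> A" for c
    by (rule sode_chart.W_def[OF chart[OF that]])
  have EL: "sode_chart.EL (f c) (L c) i z = (\<Sum>k\<in>UNIV. \<omega> c (fst z) $ k $ i * snd z $ k)"
    if c: "c \<in> A" and z: "z \<in> sode_chart.W (coords c U)" for c i z
    by (rule sode_chart.EL_of_equivalence[OF chart[OF c] LC[OF c] z])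
      (use eq c in \<open>simp add: equivalent_gyroscopic_def\<close>)
  have "tensor02_along A U g"
    unfolding tensor02_along_def
  proof (intro conjI ballI allI)
    show "smooth_on (coords c U \<times> UNIV) (g c)" if "c \<in> A" for c
      using sode_chart.smooth_hess[OF chart LC] that by (simp add: g_def W)
    fix c d x v X Y assume c: "c \<in> A" and d: "d \<in> A" and x: "x \<in> U \<inter> fst c \<inter> fst d"
    have dif: "F differentiable (at (snd e x, w))"
      if "F \<in> sode_chart.C (coords e U)" "e \<in> A" "x \<in> fst e" for F e w
    proof (rule sode_chart.C_differentiable[OF chart[OF that(2)] that(1)])
      have "snd e x \<in> coords e U" using that(3) x by (auto simp: coords_def)
      then show "(snd e x, w) \<in> sode_chart.W (coords e U)" by (simp add: W that(2))
    qed
    show "bil (g d (snd d x, jac c d (snd c x) v)) (jac c d (snd c x) X) (jac c d (snd c x) Y) =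
          bil (g c (snd c x, v)) X Y"
      unfolding g_def
    proof (rule hess_mat_fibre_pullback[symmetric])
      show "linear (jac c d (snd c x))" using linear_jac[OF A c d] x by blast
      show "L c (snd c x, v) = L d (snd d x, jac c d (snd c x) v)" for v
        using L c d x by (simp add: smooth_function_on_TU_def)
    qed (use x c d in \<open>auto intro!: dif LC sode_chart.C_dv chart\<close>)
  qed
  moreover have "nonsingular_tensor A U g"
    using reg by (simp add: nonsingular_tensor_def regular_function_def g_def hess_mat_def)
  moreover have "symmetric_tensor A U g"
    unfolding symmetric_tensor_def g_def
  proof (intro ballI)
    show "transpose (hess_mat (L c) z) = hess_mat (L c) z" if "c \<in> A" "z \<in> coords c U \<times> UNIV" for c z
      using sode_chart.hess_sym[OF chart _ LC] that by (simp add: transpose_def hess_mat_def vec_eq_iff W)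
  qed
  moreover have "DV_symmetric A U g"
    unfolding DV_symmetric_def g_def
    using sode_chart.DV_tensor_hess_sym[OF chart LC] W by blast
  moreover have "nabla_zero A f U g" "Phi_R_condition A f U g"
  proof -
    have "nabla_tensor (f c) (g c) X Y z = 0 \<and> app2 (g c) (Phi_app (f c) X) Y z - app2 (g c) X (Phi_app (f c) Y) z =
             app2 (g c) (R_app (f c) X Y) TT z + app2 (g c) (R_app (f c) Y TT) X z
               + app2 (g c) (R_app (f c) TT X) Y z"
      if c: "c \<in> A" and X: "vfield_along (coords c U) X" "vfield_along (coords c U) Y"
        and z: "z \<in> coords c U \<times> UNIV" for c X Y z
    proof -
      interpret sode_chart "coords c U" "f c" by (rule chart[OF c])
      have sm: "smooth_on (coords c U) (\<omega> c)" using \<omega> c by (simp add: two_form_on_def)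
      have anti: "\<omega> c q $ k $ i = - (\<omega> c q $ i $ k)" if "q \<in> coords c U" for q i k
        using \<omega> c that unfolding two_form_on_def by blast
      have z: "z \<in> W" using z by (simp add: W_def)
      show ?thesis
        unfolding g_def using hess_multiplier[OF LC[OF c] sm anti EL[OF c] z X] by blast
    qed
    then show "nabla_zero A f U g" "Phi_R_condition A f U g"
      unfolding nabla_zero_def Phi_R_condition_def by blast+
  qed
  ultimately show ?thesis unfolding gyroscopic_multiplier_def by blast
qed

section \<open>From a multiplier to a gyroscopic system\<close>

lemma bil_antisym:
  assumes "\<And>i k. M $ k $ i = - (M $ i $ k)"
  shows "bil M y x = - bil M x y"
proof -
  have "bil M y x = (\<Sum>j\<in>UNIV. \<Sum>i\<in>UNIV. M $ i $ j * y $ i * x $ j)"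
    unfolding bil_def by (rule sum.swap)
  also have "\<dots> = (\<Sum>j\<in>UNIV. \<Sum>i\<in>UNIV. - (M $ j $ i * x $ j * y $ i))"
  proof (intro sum.cong refl)
    show "M $ i $ j * y $ i * x $ j = - (M $ j $ i * x $ j * y $ i)" for i j
      using assms[of i j] by simp
  qed
  finally show ?thesis by (simp add: bil_def sum_negf)
qed

context sode_chart
begin

text \<open>A field over the small ball need not extend to the larger chart domain on which the
  multiplier conditions are given. The hypotheses therefore quantify over everywhere defined fields,
  which restrict to any domain and include the constant coordinate fields inserted here.\<close>

lemma multiplier_lagrangian:
  fixes G :: "'n tcoord \<Rightarrow> real ^ 'n ^ 'n"
  assumes G: "\<And>i j. (\<lambda>z. G z $ i $ j) \<in> C" and sym: "\<And>z. z \<in> W \<Longrightarrow> transpose (G z) = G z"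
    and DV: "\<And>X Y Z z. z \<in> W \<Longrightarrow> vfield_along UNIV X \<Longrightarrow> vfield_along UNIV Y \<Longrightarrow> vfield_along UNIV Z \<Longrightarrow>
      DV_tensor G X Y Z z = DV_tensor G Y X Z z"
    and nabla: "\<And>X Y z. z \<in> W \<Longrightarrow> vfield_along UNIV X \<Longrightarrow> vfield_along UNIV Y \<Longrightarrow> nabla_tensor f G X Y z = 0"
    and jac: "\<And>X Y z. z \<in> W \<Longrightarrow> vfield_along UNIV X \<Longrightarrow> vfield_along UNIV Y \<Longrightarrow>
      app2 G (Phi_app f X) Y z - app2 G X (Phi_app f Y) z =
        app2 G (R_app f X Y) TT z + app2 G (R_app f Y TT) X z + app2 G (R_app f TT X) Y z"
    and B: "B = ball q0 r"
  obtains L \<omega> where "L \<in> C" "\<And>z. z \<in> W \<Longrightarrow> hess_mat L z = G z" "smooth_on B \<omega>"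
    "\<And>q i k. q \<in> B \<Longrightarrow> \<omega> q $ k $ i = - (\<omega> q $ i $ k)"
    "\<And>z i. z \<in> W \<Longrightarrow> EL L i z = (\<Sum>k\<in>UNIV. \<omega> (fst z) $ k $ i * snd z $ k)"
proof (rule gyroscopic_lagrangian[OF B G])
  have const: "vfield_along V (\<lambda>_. axis i 1 :: real ^ 'n)" for V i by (rule smooth_on_const)
  show "G z $ i $ j = G z $ j $ i" if "z \<in> W" for z i j
  proof -
    have "transpose (G z) $ j $ i = G z $ j $ i" by (simp only: sym[OF that])
    then show ?thesis by (simp add: transpose_def)
  qed
  show "dv i (\<lambda>z. G z $ j $ k) z = dv j (\<lambda>z. G z $ i $ k) z" if z: "z \<in> W" for z i j k
  proof -
    have "DV_tensor G (\<lambda>_. axis i 1) (\<lambda>_. axis j 1) (\<lambda>_. axis k 1) z = dv i (\<lambda>z. G z $ j $ k) z" for i j k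
      using DV_tensor_components[OF z G const const] by (simp add: sum_axis sum_axis')
    then show ?thesis using DV[OF z const const const] by metis
  qed
  show "nabla_free (\<lambda>i j z. G z $ i $ j)"
    unfolding nabla_free_def
  proof (intro ballI allI)
    fix z i j assume z: "z \<in> W"
    show "SODE f (\<lambda>z. G z $ i $ j) z =
        (\<Sum>k\<in>UNIV. Gam f k i z * G z $ k $ j) + (\<Sum>k\<in>UNIV. Gam f k j z * G z $ i $ k)"
      using nabla[OF z const const] nabla_tensor_components[OF z G const const, of i j]
      by (simp add: bil_axis)
  qed
  show "(\<Sum>k\<in>UNIV. Phi f k i z * G z $ k $ j) - (\<Sum>k\<in>UNIV. Phi f k j z * G z $ i $ k)
      = (\<Sum>k\<in>UNIV. snd z $ k * ((\<Sum>l\<in>UNIV. Rc f l i j z * G z $ l $ k) +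
         (\<Sum>l\<in>UNIV. Rc f l j k z * G z $ l $ i) + (\<Sum>l\<in>UNIV. Rc f l k i z * G z $ l $ j)))"
    if z: "z \<in> W" for z i j
    using jac[OF z const[of UNIV i] const[of UNIV j]] Phi_R_axis[of G i j z] by linarith
qed (rule that)

end

context chart_change
begin

definition \<omega>_pullback :: "(real ^ 'n \<Rightarrow> real ^ 'n ^ 'n) \<Rightarrow> real ^ 'n \<Rightarrow> real ^ 'n ^ 'n" where
  "\<omega>_pullback \<omega> q = (\<chi> k i. bil (\<omega> (\<phi> q)) (J q (axis k 1)) (J q (axis i 1)))"

lemma bil_\<omega>_pullback:
  assumes "q \<in> B1"
  shows "bil (\<omega>_pullback \<omega> q) x y = bil (\<omega> (\<phi> q)) (J q x) (J q y)"
proof -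
  note J = linear_J[OF assms]
  have "bilinear (\<lambda>x y. bil (\<omega>_pullback \<omega> q) x y - bil (\<omega> (\<phi> q)) (J q x) (J q y))"
    unfolding bilinear_def linear_iff bil_def
    by (simp add: linear_add[OF J] linear_scale[OF J] algebra_simps sum.distrib sum_distrib_left)
  from bilinear_eq_zero_axis[OF this, of x y] show ?thesis
    unfolding bil_axis by (simp add: \<omega>_pullback_def)
qed

lemma smooth_\<omega>_pullback:
  assumes "smooth_on B0 \<omega>"
  shows "smooth_on B1 (\<omega>_pullback \<omega>)"
proof -
  have "smooth_on B1 (\<lambda>q. \<omega> (\<phi> q))"
    by (rule smooth_on_compose[OF c1.open_B c0.open_B smooth_\<phi> assms \<phi>_in])
  then have "smooth_on B1 (\<lambda>q. \<omega> (\<phi> q) $ k $ i)" for k i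
    by (intro smooth_on_nth c1.open_B)
  moreover have "smooth_on B1 (\<lambda>q. J q v $ k)" for v k
    by (rule smooth_on_nth[OF c1.open_B smooth_J])
  ultimately have "smooth_on B1 (\<lambda>q. bil (\<omega> (\<phi> q)) (J q v) (J q w))" for v w
    unfolding bil_def by (intro smooth_on_sum smooth_on_mult c1.open_B)
  then show ?thesis
    by (intro smooth_on_vec c1.open_B) (simp add: \<omega>_pullback_def)
qed

text \<open>The Euler-Lagrange expressions and the contraction of \<omega> with the velocity
  transform as covectors under the same Jacobian.\<close>

lemma gyroscopic_EL_pullback:
  assumes L: "L \<in> c0.C" and EL: "\<And>z i. z \<in> c0.W \<Longrightarrow> c0.EL L i z = (\<Sum>k\<in>UNIV. \<omega> (fst z) $ k $ i * snd z $ k)"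
    and z: "z \<in> c1.W"
  shows "c1.EL (\<lambda>z. L (\<Psi> z)) i z = (\<Sum>k\<in>UNIV. \<omega>_pullback \<omega> (fst z) $ k $ i * snd z $ k)"
proof -
  have q: "fst z \<in> B1" using z by (auto simp: c1.W_def)
  have "c1.EL (\<lambda>z. L (\<Psi> z)) i z =
      (\<Sum>k\<in>UNIV. \<Sum>l\<in>UNIV. \<omega> (\<phi> (fst z)) $ l $ k * J (fst z) (snd z) $ l * J (fst z) (axis i 1) $ k)"
    unfolding EL_pullback[OF L z] EL[OF \<Psi>_in[OF z]]
    by (simp add: \<Psi>_def sum_distrib_left mult_ac)
  also have "\<dots> = bil (\<omega> (\<phi> (fst z))) (J (fst z) (snd z)) (J (fst z) (axis i 1))"
    unfolding bil_def by (rule sum.swap)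
  also have "\<dots> = bil (\<omega>_pullback \<omega> (fst z)) (snd z) (axis i 1)"
    by (rule bil_\<omega>_pullback[OF q, symmetric])
  finally show ?thesis by (simp add: bil_axis_right mult.commute)
qed

end

text \<open>The neighbourhood lies in the domain of one chart \<open>c0\<close>, where its image is
  a ball; this is the shape needed for the potentials, and it makes the transition to
  \<open>c0\<close> available over the whole neighbourhood in every other chart.\<close>

lemma multiplier_imp_gyroscopic:
  fixes A :: "('q::{t2_space, second_countable_topology}, 'n::finite) chart set"
  assumes A: "smooth_atlas A" and f: "second_order_field A f" and U: "open U" and p: "p \<in> U"
    and mult: "gyroscopic_multiplier A f U g"
  shows "\<exists>U'. open U' \<and> p \<in> U' \<and> gyroscopic_on A f U'"
proof -
  have tens: "tensor02_along A U g" and nons: "nonsingular_tensor A U g" and sym: "symmetric_tensor A U g"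
    and DV: "DV_symmetric A U g" and nab: "nabla_zero A f U g" and PR: "Phi_R_condition A f U g"
    using mult by (auto simp: gyroscopic_multiplier_def)
  obtain c0 where c0: "c0 \<in> A" and p0: "p \<in> fst c0"
    using A unfolding smooth_atlas_def by blast
  obtain r where r: "r > 0" "ball (snd c0 p) r \<subseteq> coords c0 U"
  proof -
    have "snd c0 p \<in> coords c0 U" using p p0 by (auto simp: coords_def)
    then show ?thesis using that open_coords[OF A c0 U] open_contains_ball by blast
  qed
  define B0 where "B0 = ball (snd c0 p) r"
  define U' where "U' = fst c0 \<inter> snd c0 -` B0"
  have "open U'"
    unfolding U'_def using chart_homeo[OF A c0] open_chart[OF A c0]
    by (intro continuous_open_preimage) (auto simp: B0_def homeomorphism_def)
  have pU': "p \<in> U'" using p0 r by (simp add: U'_def B0_def)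
  have U'c0: "x \<in> fst c0" "snd c0 x \<in> B0" if "x \<in> U'" for x using that by (auto simp: U'_def)
  have U'U: "x \<in> U" if "x \<in> U'" for x
  proof -
    have "snd c0 x \<in> coords c0 U" using U'c0[OF that] r by (auto simp: B0_def)
    then obtain y where "y \<in> U" "y \<in> fst c0" "snd c0 x = snd c0 y"
      unfolding coords_def by blast
    then show ?thesis using chart_inj[OF A c0 U'c0(1)[OF that]] by metis
  qed
  have coords_U': "coords c0 U' = B0"
  proof
    show "coords c0 U' \<subseteq> B0" by (auto simp: coords_def U'_def)
    show "B0 \<subseteq> coords c0 U'"
    proof
      fix q assume q: "q \<in> B0"
      then have "q \<in> coords c0 U" using r by (auto simp: B0_def)
      then obtain x where "x \<in> fst c0" "q = snd c0 x" unfolding coords_def by blast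
      then show "q \<in> coords c0 U'" using q by (auto simp: coords_def U'_def)
    qed
  qed
  interpret k0: sode_chart B0 "f c0"
    using sode_chart_coords[OF A f \<open>open U'\<close> c0] by (simp add: coords_U')
  have in_U: "z \<in> coords c0 U \<times> UNIV" if "z \<in> k0.W" for z
    using that r(2) unfolding k0.W_def unfolding B0_def by auto
  have vf: "vfield_along (coords c0 U) X" if "vfield_along UNIV X" for X :: "'n tcoord \<Rightarrow> real ^ 'n"
    using that by (rule smooth_on_subset) auto
  have "smooth_on (coords c0 U \<times> UNIV) (g c0)"
    using tens c0 by (simp add: tensor02_along_def)
  then have "smooth_on k0.W (g c0)"
    by (rule smooth_on_subset) (use in_U in blast)
  then have G: "(\<lambda>z. g c0 z $ i $ j) \<in> k0.C" for i j
    unfolding k0.C_def mem_Collect_eq by (intro smooth_on_nth k0.open_W)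
  obtain L0 \<omega>0 where L0: "L0 \<in> k0.C" "\<And>z. z \<in> k0.W \<Longrightarrow> hess_mat L0 z = g c0 z"
    and \<omega>0: "smooth_on B0 \<omega>0" "\<And>q i k. q \<in> B0 \<Longrightarrow> \<omega>0 q $ k $ i = - (\<omega>0 q $ i $ k)"
    and EL0: "\<And>z i. z \<in> k0.W \<Longrightarrow> k0.EL L0 i z = (\<Sum>k\<in>UNIV. \<omega>0 (fst z) $ k $ i * snd z $ k)"
  proof (rule k0.multiplier_lagrangian[OF G, of "snd c0 p" r])
    show "transpose (g c0 z) = g c0 z" if "z \<in> k0.W" for z
      using sym c0 in_U[OF that] unfolding symmetric_tensor_def by blast
    show "DV_tensor (g c0) X Y Z z = DV_tensor (g c0) Y X Z z"
      if "z \<in> k0.W" "vfield_along UNIV X" "vfield_along UNIV Y" "vfield_along UNIV Z" for X Y Z z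
      using DV c0 in_U[OF that(1)] that(2-)[THEN vf] unfolding DV_symmetric_def by blast
    show "nabla_tensor (f c0) (g c0) X Y z = 0"
      if "z \<in> k0.W" "vfield_along UNIV X" "vfield_along UNIV Y" for X Y z
      using nab c0 in_U[OF that(1)] that(2-)[THEN vf] unfolding nabla_zero_def by blast
    show "app2 (g c0) (Phi_app (f c0) X) Y z - app2 (g c0) X (Phi_app (f c0) Y) z =
        app2 (g c0) (R_app (f c0) X Y) TT z + app2 (g c0) (R_app (f c0) Y TT) X z + app2 (g c0) (R_app (f c0) TT X) Y z"
      if "z \<in> k0.W" "vfield_along UNIV X" "vfield_along UNIV Y" for X Y z
      using PR c0 in_U[OF that(1)] that(2-)[THEN vf] unfolding Phi_R_condition_def by blast
    show "B0 = ball (snd c0 p) r" by (rule B0_def)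
  qed (rule that)
  define \<Psi> :: "('q, 'n) chart \<Rightarrow> 'n tcoord \<Rightarrow> 'n tcoord"
    where "\<Psi> d z = (transition d c0 (fst z), jac d c0 (fst z) (snd z))" for d z
  define L where "L d z = L0 (\<Psi> d z)" for d z
  define \<omega> where "\<omega> d = chart_change.\<omega>_pullback (transition d c0) \<omega>0" for d
  have cc: "chart_change (coords d U') (f d) B0 (f c0) (transition d c0)" if d: "d \<in> A" for d
  proof -
    interpret k1: sode_chart "coords d U'" "f d"
      by (rule sode_chart_coords[OF A f \<open>open U'\<close> d])
    show ?thesis
    proof
      show "smooth_on (coords d U') (transition d c0)"
        by (rule smooth_on_subset[OF smooth_transition[OF A d c0]]) (auto simp: coords_def U'_def)
      show "transition d c0 q \<in> B0" if "q \<in> coords d U'" for q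
        using that by (rule coordsE) (simp add: transition_apply[OF A d] U'c0)
      show "f c0 (transition d c0 q, frechet_derivative (transition d c0) (at q) v) =
          frechet_derivative (transition d c0) (at q) (f d (q, v)) +
          frechet_derivative (\<lambda>y. frechet_derivative (transition d c0) (at y) v) (at q) v"
        if q: "q \<in> coords d U'" for q v
      proof -
        obtain x where x: "x \<in> U'" "x \<in> fst d" "q = snd d x" using q by (rule coordsE)
        have "f c0 (snd c0 x, jac d c0 (snd d x) v) = jac d c0 (snd d x) (f d (snd d x, v)) + hess d c0 (snd d x) v"
          using f d c0 x U'c0(1) unfolding second_order_field_def by blast
        then show ?thesis
          using x by (simp add: transition_apply[OF A d] jac_def hess_def)
      qed
    qed
  qed
  have W: "sode_chart.W (coords d U') = coords d U' \<times> UNIV" if "d \<in> A" for d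
    by (rule sode_chart.W_def[OF sode_chart_coords[OF A f \<open>open U'\<close> that]])
  have LC: "L d \<in> sode_chart.C (coords d U')" if d: "d \<in> A" for d
    using chart_change.C_pullback[OF cc[OF d] L0(1)]
    by (simp add: L_def[abs_def] \<Psi>_def[abs_def] chart_change.\<Psi>_def[OF cc[OF d]] chart_change.J_def[OF cc[OF d]] jac_def)
  have EL: "sode_chart.EL (f d) (L d) i z = (\<Sum>k\<in>UNIV. \<omega> d (fst z) $ k $ i * snd z $ k)"
    if d: "d \<in> A" and z: "z \<in> sode_chart.W (coords d U')" for d i z
    using chart_change.gyroscopic_EL_pullback[OF cc[OF d] L0(1) EL0 z, of i]
    by (simp add: L_def[abs_def] \<Psi>_def[abs_def] chart_change.\<Psi>_def[OF cc[OF d]] chart_change.J_def[OF cc[OF d]] jac_def \<omega>_def)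
  have L_x: "L d (snd d x, v) = L0 (snd c0 x, jac d c0 (snd d x) v)" if "d \<in> A" "x \<in> fst d" for d x v
    using that by (simp add: L_def \<Psi>_def transition_apply[OF A])
  \<comment> \<open>The tensor law of \<open>g\<close> identifies the Hessian of the pulled-back
    function with \<open>g d\<close> in each chart \<open>d\<close>, so regularity comes directly
    from \<open>nons\<close>.\<close>
  have hess_L: "hess_mat (L d) z = g d z" if d: "d \<in> A" and z: "z \<in> coords d U' \<times> UNIV" for d z
  proof -
    obtain q v where qv: "z = (q, v)" by (cases z)
    then obtain x where x: "x \<in> U'" "x \<in> fst d" "q = snd d x" using z by (auto elim: coordsE)
    let ?J = "jac d c0 q"
    have in1: "(q, w) \<in> sode_chart.W (coords d U')" for w
      using z by (simp add: W d qv)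
    have in0: "(snd c0 x, w) \<in> k0.W" for w using U'c0[OF x(1)] by (simp add: k0.W_def)
    note ch = sode_chart_coords[OF A f \<open>open U'\<close> d]
    have "bil (hess_mat (L d) z) X Y = bil (g d z) X Y" for X Y
    proof -
      have "bil (hess_mat (L d) (q, v)) X Y = bil (hess_mat L0 (snd c0 x, ?J v)) (?J X) (?J Y)"
      proof (rule hess_mat_fibre_pullback)
        show "linear ?J" using linear_jac[OF A d c0 x(2)] U'c0(1)[OF x(1)] x(3) by simp
        show "L d (q, v) = L0 (snd c0 x, ?J v)" for v using L_x[OF d x(2)] x(3) by simp
        show "L d differentiable (at (q, v))" "dv i (L d) differentiable (at (q, v))" for v i
          using sode_chart.C_differentiable[OF ch _ in1] sode_chart.C_dv[OF ch] LC[OF d] by blast+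
        show "L0 differentiable (at (snd c0 x, v))" "dv i L0 differentiable (at (snd c0 x, v))" for v i
          using k0.C_differentiable[OF _ in0] k0.C_dv L0(1) by blast+
      qed
      also have "\<dots> = bil (g c0 (snd c0 x, ?J v)) (?J X) (?J Y)" by (simp add: L0(2) in0)
      also have "\<dots> = bil (g d (q, v)) X Y"
        using tens d c0 x U'c0(1) U'U unfolding tensor02_along_def by blast
      finally show ?thesis by (simp add: qv)
    qed
    from this[of "axis _ 1" "axis _ 1"] show ?thesis unfolding bil_axis by (simp add: vec_eq_iff)
  qed
  have reg: "invertible (hess_mat (L d) z)" if "d \<in> A" "z \<in> coords d U' \<times> UNIV" for d z
  proof -
    have "z \<in> coords d U \<times> UNIV" using that(2) U'U by (auto simp: coords_def)
    then have "invertible (g d z)" using nons that(1) unfolding nonsingular_tensor_def by blast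
    then show ?thesis by (simp only: hess_L[OF that])
  qed
  \<comment> \<open>All representatives are pulled back from \<open>c0\<close>, so their mutual
    compatibility reduces to the chain rule for Jacobians.\<close>
  have chain: "jac c c0 (snd c x) v = jac d c0 (snd d x) (jac c d (snd c x) v)"
    if "c \<in> A" "d \<in> A" "x \<in> U'" "x \<in> fst c" "x \<in> fst d" for c d x v
    by (rule jac_chain[OF A]) (use that c0 U'c0 in auto)
  have bil_\<omega>: "bil (\<omega> d (snd d x)) X Y =
      bil (\<omega>0 (snd c0 x)) (jac d c0 (snd d x) X) (jac d c0 (snd d x) Y)"
    if d: "d \<in> A" and x: "x \<in> U'" "x \<in> fst d" for d x X Y
  proof -
    have "snd d x \<in> coords d U'" using x by (auto simp: coords_def)
    from chart_change.bil_\<omega>_pullback[OF cc[OF d] this, of \<omega>0 X Y] show ?thesis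
      by (simp add: \<omega>_def chart_change.J_def[OF cc[OF d]] jac_def transition_apply[OF A d x(2)])
  qed
  have "smooth_function_on_TU A U' L"
    unfolding smooth_function_on_TU_def
  proof (intro conjI ballI allI)
    show "smooth_on (coords c U' \<times> UNIV) (L c)" if c: "c \<in> A" for c
      using LC[OF c] by (simp add: sode_chart.C_def[OF sode_chart_coords[OF A f \<open>open U'\<close> c]] W c)
    show "L d (snd d x, jac c d (snd c x) v) = L c (snd c x, v)"
      if "c \<in> A" "d \<in> A" "x \<in> U' \<inter> fst c \<inter> fst d" for c d x v
      using that by (simp add: L_x chain[of c d x])
  qed
  moreover have "regular_function A U' L"
    unfolding regular_function_def using reg by (simp add: hess_mat_def)
  moreover have "two_form_on A U' \<omega>"
    unfolding two_form_on_def
  proof (intro conjI ballI allI)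
    show "smooth_on (coords c U') (\<omega> c)" if c: "c \<in> A" for c
      unfolding \<omega>_def by (rule chart_change.smooth_\<omega>_pullback[OF cc[OF c] \<omega>0(1)])
    show "\<omega> c q $ k $ i = - (\<omega> c q $ i $ k)" if c: "c \<in> A" and q: "q \<in> coords c U'" for c q i k
    proof -
      obtain x where x: "x \<in> U'" "x \<in> fst c" "q = snd c x" using q by (rule coordsE)
      have "bil (\<omega> c q) (axis k 1) (axis i 1) = - bil (\<omega> c q) (axis i 1) (axis k 1)"
        unfolding x(3) bil_\<omega>[OF c x(1,2)] by (rule bil_antisym[OF \<omega>0(2)[OF U'c0(2)[OF x(1)]]])
      then show ?thesis by (simp only: bil_axis)
    qed
    show "bil (\<omega> d (snd d x)) (jac c d (snd c x) X) (jac c d (snd c x) Y) = bil (\<omega> c (snd c x)) X Y"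
      if "c \<in> A" "d \<in> A" "x \<in> U' \<inter> fst c \<inter> fst d" for c d x X Y
      using that by (simp add: bil_\<omega> chain[of c d x])
  qed
  moreover have "equivalent_gyroscopic A f U' L \<omega>"
    unfolding equivalent_gyroscopic_def
    using sode_chart.solves_gyroscopic_iff[OF sode_chart_coords[OF A f \<open>open U'\<close>] LC reg EL] W by simp
  ultimately show ?thesis
    using \<open>open U'\<close> pU' unfolding gyroscopic_on_def by blast
qed

theorem theorem4:
  fixes A :: "('q::{t2_space, second_countable_topology}, 'n::finite) chart set"
    and f :: "('q, 'n) chart \<Rightarrow> 'n tcoord \<Rightarrow> real ^ 'n"
  assumes "smooth_atlas A"
    and "second_order_field A f"
  shows "((\<forall>p. \<exists>U. open U \<and> p \<in> U \<and> gyroscopic_on A f U) \<longrightarrow>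
            (\<forall>p. \<exists>U. open U \<and> p \<in> U \<and> (\<exists>g. gyroscopic_multiplier A f U g))) \<and>
         ((\<forall>p. \<exists>U. open U \<and> p \<in> U \<and>
              (\<exists>g. gyroscopic_multiplier A f U g \<and> Phi_contract_smooth_zero_section A f U g)) \<longrightarrow>
            (\<forall>p. \<exists>U. open U \<and> p \<in> U \<and> gyroscopic_on A f U))"
  using gyroscopic_imp_multiplier[OF assms] multiplier_imp_gyroscopic[OF assms] by meson

end
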